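(* Let $\varepsilon,\mu:\Omega\to\mathbb{R}^{3\times 3}$ be matrix fields with bounded measurable entries such that $\varepsilon(x)$ and $\mu(x)$ are symmetric for all $x\in\Omega$, and such that there exist constants $\varepsilon_*>0$ and $\mu_*>0$ with $\varepsilon(x)\xi\cdot\xi\ge\varepsilon_*|\xi|^2$ and $\mu(x)\xi\cdot\xi\ge\mu_*|\xi|^2$ for all $x\in\Omega$ and all $\xi\in\mathbb{R}^3$. Let $j(x,t,\xi)=j_0(x,t)+j_1(x,t,\xi)$ for $(x,t,\xi)\in Q_T\times\mathbb{R}^3$, where $j_0\in L^2(Q_T)^3$ and $j_1:Q_T\times\mathbb{R}^3\to\mathbb{R}^3$ is a Carath\'eodory function such that, for some constant $c_1>0$, $|j_1(x,t,\xi)|\le c_1|\xi|$ for all $(x,t,\xi)\in Q_T\times\mathbb{R}^3$. Let $(e_0,h_0)\in L^2(\Omega)^3\times L^2(\Omega)^3$. Let $(e,h)\in L^2(Q_T)^3\times L^2(Q_T)^3$ be any weak solution of the Maxwell problem with data $(\varepsilon,\mu,j,e_0,h_0)$ and denote by $\hat e,\hat h\in C([0,T];H)$ the continuous representatives in the equivalence classes $e,h\in L^2(0,T;H)$. Then $$\frac12\Big(\|\hat e(t)\|_{H_\varepsilon}^2+\|\hat h(t)\|_{H_\mu}^2\Big)+\int_0^t(j(e),e)_H\,ds=\frac12\Big(\|e_0\|_{H_\varepsilon}^2+\|h_0\|_{H_\mu}^2\Big)\qquad\text{for all }t\in[0,T].$$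
   Context: Setting and notation. $\Omega\subset\mathbb{R}^3$ is an open set, $0<T<+\infty$, $Q_T=\Omega\times\,]0,T[$. $H:=L^2(\Omega)^3$ with scalar product $(u,v)_H=\int_\Omega u\cdot v\,dx$; weighted scalar products on $H$ are $(u,v)_{H_\varepsilon}=\int_\Omega\varepsilon(x)u(x)\cdot v(x)\,dx$ and $(u,v)_{H_\mu}=\int_\Omega\mu(x)u(x)\cdot v(x)\,dx$, with induced norms $\|\cdot\|_{H_\varepsilon}$, $\|\cdot\|_{H_\mu}$. $V$ is the space of all $u\in L^2(\Omega)^3$ whose distributional curl is represented by a field in $L^2(\Omega)^3$, i.e. there is $F=:\operatorname{curl}u\in L^2(\Omega)^3$ with $\int_\Omega u\cdot\operatorname{curl}\varphi\,dx=\int_\Omega F\cdot\varphi\,dx$ for all $\varphi\in C_c^\infty(\Omega)^3$; it is a Hilbert space with scalar product $(u,v)_V=\int_\Omega(u\cdot v+\operatorname{curl}u\cdot\operatorname{curl}v)\,dx$. $V_0$ is the closed subspace $V_0:=\{u\in V:\int_\Omega(\operatorname{curl}u)\cdot\psi\,dx=\int_\Omega u\cdot\operatorname{curl}\psi\,dx\text{ for all }\psi\in V\}$. $L^2(Q_T)^3$ is identified with the Bochner space $L^2(0,T;H)$ via $u\mapsto(t\mapsto u(\cdot,t))$. Carath\'eodory function: $(x,t)\mapsto j_1(x,t,\xi)$ is measurable in $Q_T$ for all $\xi\in\mathbb{R}^3$, and $\xi\mapsto j_1(x,t,\xi)$ is continuous on $\mathbb{R}^3$ for a.e. $(x,t)\in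 Q_T$. For $u\in L^2(Q_T)^3$, $j(u)$ denotes the field $(x,t)\mapsto j(x,t,u(x,t))$, which lies in $L^2(Q_T)^3$; $\int_0^t(j(e),e)_H\,ds$ means $\int_0^t\int_\Omega j(x,s,e(x,s))\cdot e(x,s)\,dx\,ds$. Weak solution: $(e,h)\in L^2(Q_T)^3\times L^2(Q_T)^3$ is a weak solution of the Maxwell problem with data $(\varepsilon,\mu,j,e_0,h_0)$ (that is, of $\partial_t(\varepsilon e)=\operatorname{curl}h-j$, $\partial_t(\mu h)=-\operatorname{curl}e$ in $Q_T$, $n\times e=0$ on $\partial\Omega\times\,]0,T[$, $e=e_0$, $h=h_0$ at $t=0$) if $$-\int_{Q_T}(\varepsilon e)\cdot\partial_t\Phi\,dx\,dt+\int_{Q_T}\big(-h\cdot\operatorname{curl}\Phi+j(e)\cdot\Phi\big)\,dx\,dt=\int_\Omega(\varepsilon e_0)(x)\cdot\Phi(x,0)\,dx$$ for all $\Phi\in L^2(0,T;V_0)$ with $\partial_t\Phi\in L^2(Q_T)^3$ and $\Phi(\cdot,T)=0$ a.e. in $\Omega$, and $$-\int_{Q_T}(\mu h)\cdot\partial_t\Psi\,dx\,dt+\int_{Q_T}e\cdot\operatorname{curl}\Psi\,dx\,dt=\int_\Omega(\mu h_0)(x)\cdot\Psi(x,0)\,dx$$ for all $\Psi\in L^2(0,T;V)$ with $\partial_t\Psi\in L^2(Q_T)^3$ and $\Psi(\cdot,T)=0$ a.e. in $\Omega$. (Values of $\Phi,\Psi$ at $t=0,T$ are those of the representatives in $C([0,T];H)$.)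 Under the stated hypotheses, every weak solution $(e,h)$ has (unique) representatives $\hat e,\hat h\in C([0,T];H)$ of the classes $e,h\in L^2(0,T;H)$, and $\hat e(0)=e_0$, $\hat h(0)=h_0$ in $H$. *)

theory Defs
  imports "HOL-Analysis.Analysis"
begin

text \<open>
  Elements of Lebesgue spaces are rendered by (total) representatives; their values outside the
  domain of integration are irrelevant.  Measurable means Lebesgue measurable throughout.
\<close>

type_synonym vec3 = "real ^ 3"

definition L2 :: "'a::euclidean_space set \<Rightarrow> ('a \<Rightarrow> vec3) set" where
  "L2 S = {u. u \<in> borel_measurable (lebesgue_on S) \<and>
              integrable (lebesgue_on S) (\<lambda>x. (norm (u x))\<^sup>2)}"

definition inner_H :: "vec3 set \<Rightarrow> (vec3 \<Rightarrow> vec3) \<Rightarrow> (vec3 \<Rightarrow> vec3) \<Rightarrow> real" where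
  "inner_H \<Omega> u v = (LINT x|lebesgue_on \<Omega>. u x \<bullet> v x)"

definition norm_H :: "vec3 set \<Rightarrow> (vec3 \<Rightarrow> vec3) \<Rightarrow> real" where
  "norm_H \<Omega> u = sqrt (inner_H \<Omega> u u)"

definition inner_Hw ::
    "vec3 set \<Rightarrow> (vec3 \<Rightarrow> real^3^3) \<Rightarrow> (vec3 \<Rightarrow> vec3) \<Rightarrow> (vec3 \<Rightarrow> vec3) \<Rightarrow> real" where
  "inner_Hw \<Omega> w u v = (LINT x|lebesgue_on \<Omega>. (w x *v u x) \<bullet> v x)"

definition norm_Hw :: "vec3 set \<Rightarrow> (vec3 \<Rightarrow> real^3^3) \<Rightarrow> (vec3 \<Rightarrow> vec3) \<Rightarrow> real" where
  "norm_Hw \<Omega> w u = sqrt (inner_Hw \<Omega> w u u)"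

definition QT :: "vec3 set \<Rightarrow> real \<Rightarrow> (vec3 \<times> real) set" where
  "QT \<Omega> T = \<Omega> \<times> {0<..<T}"


subsection \<open>Test functions and distributional derivatives\<close>

primrec Ck :: "nat \<Rightarrow> ('a::euclidean_space \<Rightarrow> 'b::euclidean_space) \<Rightarrow> bool" where
  "Ck 0 f \<longleftrightarrow> continuous_on UNIV f"
| "Ck (Suc k) f \<longleftrightarrow>
     f differentiable_on UNIV \<and> (\<forall>v. Ck k (\<lambda>x. frechet_derivative f (at x) v))"

text \<open>Functions in \<open>C\<^sub>c\<^sup>\<infinity>(S)\<close>, extended by zero to the whole space.\<close>

definition test_functions :: "'a::euclidean_space set \<Rightarrow> ('a \<Rightarrow> vec3) set" where
  "test_functions S = {\<phi>. (\<forall>k. Ck k \<phi>) \<and>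
      compact (closure {x. \<phi> x \<noteq> 0}) \<and> closure {x. \<phi> x \<noteq> 0} \<subseteq> S}"

definition partial :: "3 \<Rightarrow> (vec3 \<Rightarrow> vec3) \<Rightarrow> vec3 \<Rightarrow> vec3" where
  "partial i \<phi> x = frechet_derivative \<phi> (at x) (axis i 1)"

definition curl :: "(vec3 \<Rightarrow> vec3) \<Rightarrow> vec3 \<Rightarrow> vec3" where
  "curl \<phi> x = vector [partial 2 \<phi> x $ 3 - partial 3 \<phi> x $ 2,
                      partial 3 \<phi> x $ 1 - partial 1 \<phi> x $ 3,
                      partial 1 \<phi> x $ 2 - partial 2 \<phi> x $ 1]"

definition has_weak_curl :: "vec3 set \<Rightarrow> (vec3 \<Rightarrow> vec3) \<Rightarrow> (vec3 \<Rightarrow> vec3) \<Rightarrow> bool" where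
  "has_weak_curl \<Omega> u F \<longleftrightarrow> u \<in> L2 \<Omega> \<and> F \<in> L2 \<Omega> \<and>
     (\<forall>\<phi>\<in>test_functions \<Omega>. inner_H \<Omega> u (curl \<phi>) = inner_H \<Omega> F \<phi>)"

definition weak_curl :: "vec3 set \<Rightarrow> (vec3 \<Rightarrow> vec3) \<Rightarrow> vec3 \<Rightarrow> vec3" where
  "weak_curl \<Omega> u = (SOME F. has_weak_curl \<Omega> u F)"

definition has_weak_dt ::
    "(vec3 \<times> real) set \<Rightarrow> (vec3 \<times> real \<Rightarrow> vec3) \<Rightarrow> (vec3 \<times> real \<Rightarrow> vec3) \<Rightarrow> bool" where
  "has_weak_dt Q u w \<longleftrightarrow> u \<in> L2 Q \<and> w \<in> L2 Q \<and>
     (\<forall>\<phi>\<in>test_functions Q.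
        (LINT z|lebesgue_on Q. u z \<bullet> frechet_derivative \<phi> (at z) (0, 1)) =
        - (LINT z|lebesgue_on Q. w z \<bullet> \<phi> z))"


subsection \<open>The spaces \<open>V\<close> and \<open>V\<^sub>0\<close>\<close>

definition V :: "vec3 set \<Rightarrow> (vec3 \<Rightarrow> vec3) set" where
  "V \<Omega> = {u. \<exists>F. has_weak_curl \<Omega> u F}"

definition inner_V :: "vec3 set \<Rightarrow> (vec3 \<Rightarrow> vec3) \<Rightarrow> (vec3 \<Rightarrow> vec3) \<Rightarrow> real" where
  "inner_V \<Omega> u v =
     (LINT x|lebesgue_on \<Omega>. u x \<bullet> v x + weak_curl \<Omega> u x \<bullet> weak_curl \<Omega> v x)"

definition norm_V :: "vec3 set \<Rightarrow> (vec3 \<Rightarrow> vec3) \<Rightarrow> real" where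
  "norm_V \<Omega> u = sqrt (inner_V \<Omega> u u)"

definition V0 :: "vec3 set \<Rightarrow> (vec3 \<Rightarrow> vec3) set" where
  "V0 \<Omega> = {u\<in>V \<Omega>. \<forall>\<psi>\<in>V \<Omega>. inner_H \<Omega> (weak_curl \<Omega> u) \<psi> = inner_H \<Omega> u (weak_curl \<Omega> \<psi>)}"


subsection \<open>Vector-valued functions of time\<close>

text \<open>
  The Bochner space \<open>L\<^sup>2(0,T;X)\<close> for a space \<open>X\<close> of fields (closed under subtraction) with seminorm
  \<open>N\<close>: strong measurability is approximability by simple \<open>X\<close>-valued functions.
\<close>

definition bochner_L2 ::
    "real \<Rightarrow> (vec3 \<Rightarrow> vec3) set \<Rightarrow> ((vec3 \<Rightarrow> vec3) \<Rightarrow> real) \<Rightarrow> (real \<Rightarrow> vec3 \<Rightarrow> vec3) set" where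
  "bochner_L2 T X N = {u.
     (AE t in lebesgue_on {0<..<T}. u t \<in> X) \<and>
     (\<exists>s. (\<forall>n. simple_function (lebesgue_on {0<..<T}) (s n) \<and> (\<forall>t\<in>{0<..<T}. s n t \<in> X)) \<and>
          (AE t in lebesgue_on {0<..<T}.
             (\<lambda>n::nat. N (\<lambda>x. u t x - s n t x)) \<longlonglongrightarrow> 0)) \<and>
     integrable (lebesgue_on {0<..<T}) (\<lambda>t. (N (u t))\<^sup>2)}"

text \<open>\<open>C([0,T];H)\<close>\<close>

definition C_H :: "vec3 set \<Rightarrow> real \<Rightarrow> (real \<Rightarrow> vec3 \<Rightarrow> vec3) set" where
  "C_H \<Omega> T = {v. (\<forall>t\<in>{0..T}. v t \<in> L2 \<Omega>) \<and>
     (\<forall>t\<in>{0..T}. ((\<lambda>s. norm_H \<Omega> (\<lambda>x. v s x - v t x)) \<longlongrightarrow> 0) (at t within {0..T}))}"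

text \<open>\<open>v\<close> is a representative in \<open>C([0,T];H)\<close> of \<open>u \<in> L\<^sup>2(Q\<^sub>T)\<^sup>3\<close>, the latter being identified with
  \<open>t \<mapsto> u(\<cdot>,t)\<close> in \<open>L\<^sup>2(0,T;H)\<close>.\<close>

definition continuous_rep ::
    "vec3 set \<Rightarrow> real \<Rightarrow> (vec3 \<times> real \<Rightarrow> vec3) \<Rightarrow> (real \<Rightarrow> vec3 \<Rightarrow> vec3) \<Rightarrow> bool" where
  "continuous_rep \<Omega> T u v \<longleftrightarrow> v \<in> C_H \<Omega> T \<and>
     (AE t in lebesgue_on {0<..<T}. AE x in lebesgue_on \<Omega>. v t x = u (x, t))"

text \<open>\<open>G\<close> is the field on \<open>Q\<^sub>T\<close> representing \<open>t \<mapsto> curl (u(\<cdot>,t))\<close> in \<open>L\<^sup>2(0,T;H)\<close>.\<close>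

definition has_curl_field ::
    "vec3 set \<Rightarrow> real \<Rightarrow> (vec3 \<times> real \<Rightarrow> vec3) \<Rightarrow> (vec3 \<times> real \<Rightarrow> vec3) \<Rightarrow> bool" where
  "has_curl_field \<Omega> T u G \<longleftrightarrow> G \<in> L2 (QT \<Omega> T) \<and>
     (AE t in lebesgue_on {0<..<T}. has_weak_curl \<Omega> (\<lambda>x. u (x, t)) (\<lambda>x. G (x, t)))"

text \<open>
  \<open>\<Phi> \<in> L\<^sup>2(0,T;X)\<close>, for \<open>X\<close> one of \<open>V\<close>, \<open>V\<^sub>0\<close>, with \<open>curl \<Phi> = G\<close>, \<open>\<partial>\<^sub>t\<Phi> = W \<in> L\<^sup>2(Q\<^sub>T)\<^sup>3\<close>, continuous
  representative \<open>\<Phi>c\<close>, and \<open>\<Phi>(\<cdot>,T) = 0\<close>.  The data \<open>G\<close>, \<open>W\<close>, \<open>\<Phi>c\<close> are determined by \<open>\<Phi>\<close> up to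
  null sets.
\<close>

definition admissible_test ::
    "vec3 set \<Rightarrow> real \<Rightarrow> (vec3 \<Rightarrow> vec3) set \<Rightarrow> (vec3 \<times> real \<Rightarrow> vec3) \<Rightarrow>
     (vec3 \<times> real \<Rightarrow> vec3) \<Rightarrow> (vec3 \<times> real \<Rightarrow> vec3) \<Rightarrow> (real \<Rightarrow> vec3 \<Rightarrow> vec3) \<Rightarrow> bool" where
  "admissible_test \<Omega> T X \<Phi> G W \<Phi>c \<longleftrightarrow>
     \<Phi> \<in> L2 (QT \<Omega> T) \<and>
     (\<lambda>t x. \<Phi> (x, t)) \<in> bochner_L2 T X (norm_V \<Omega>) \<and>
     has_curl_field \<Omega> T \<Phi> G \<and>
     has_weak_dt (QT \<Omega> T) \<Phi> W \<and>
     continuous_rep \<Omega> T \<Phi> \<Phi>c \<and>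
     (AE x in lebesgue_on \<Omega>. \<Phi>c T x = 0)"


subsection \<open>Maxwell's equations\<close>

definition weak_solution ::
    "vec3 set \<Rightarrow> real \<Rightarrow> (vec3 \<Rightarrow> real^3^3) \<Rightarrow> (vec3 \<Rightarrow> real^3^3) \<Rightarrow>
     (vec3 \<times> real \<Rightarrow> vec3 \<Rightarrow> vec3) \<Rightarrow> (vec3 \<Rightarrow> vec3) \<Rightarrow> (vec3 \<Rightarrow> vec3) \<Rightarrow>
     (vec3 \<times> real \<Rightarrow> vec3) \<Rightarrow> (vec3 \<times> real \<Rightarrow> vec3) \<Rightarrow> bool" where
  "weak_solution \<Omega> T \<epsilon> \<mu> j e0 h0 e h \<longleftrightarrow>
     e \<in> L2 (QT \<Omega> T) \<and> h \<in> L2 (QT \<Omega> T) \<and>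
     (\<forall>\<Phi> G W \<Phi>c. admissible_test \<Omega> T (V0 \<Omega>) \<Phi> G W \<Phi>c \<longrightarrow>
        - (LINT z|lebesgue_on (QT \<Omega> T). (\<epsilon> (fst z) *v e z) \<bullet> W z)
        + (LINT z|lebesgue_on (QT \<Omega> T). - (h z \<bullet> G z) + j z (e z) \<bullet> \<Phi> z)
        = (LINT x|lebesgue_on \<Omega>. (\<epsilon> x *v e0 x) \<bullet> \<Phi>c 0 x)) \<and>
     (\<forall>\<Psi> G W \<Psi>c. admissible_test \<Omega> T (V \<Omega>) \<Psi> G W \<Psi>c \<longrightarrow>
        - (LINT z|lebesgue_on (QT \<Omega> T). (\<mu> (fst z) *v h z) \<bullet> W z)
        + (LINT z|lebesgue_on (QT \<Omega> T). e z \<bullet> G z)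
        = (LINT x|lebesgue_on \<Omega>. (\<mu> x *v h0 x) \<bullet> \<Psi>c 0 x))"

definition material_field :: "vec3 set \<Rightarrow> (vec3 \<Rightarrow> real^3^3) \<Rightarrow> bool" where
  "material_field \<Omega> w \<longleftrightarrow>
     (\<forall>i k. (\<lambda>x. w x $ i $ k) \<in> borel_measurable (lebesgue_on \<Omega>) \<and>
            bounded ((\<lambda>x. w x $ i $ k) ` \<Omega>)) \<and>
     (\<forall>x\<in>\<Omega>. transpose (w x) = w x) \<and>
     (\<exists>c>0. \<forall>x\<in>\<Omega>. \<forall>\<xi>. (w x *v \<xi>) \<bullet> \<xi> \<ge> c * (norm \<xi>)\<^sup>2)"

definition caratheodory :: "(vec3 \<times> real) set \<Rightarrow> (vec3 \<times> real \<Rightarrow> vec3 \<Rightarrow> vec3) \<Rightarrow> bool" where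
  "caratheodory Q f \<longleftrightarrow>
     (\<forall>\<xi>. (\<lambda>z. f z \<xi>) \<in> borel_measurable (lebesgue_on Q)) \<and>
     (AE z in lebesgue_on Q. continuous_on UNIV (f z))"

end

theory Submission
  imports Defs
begin

text \<open>
  The formal reason for the identity is that testing the first equation with \<open>e\<close> and the second
  with \<open>h\<close> makes the curl terms cancel.  A weak solution is too irregular for that: \<open>e\<close> and \<open>h\<close> need
  not have curls or time derivatives.  The proof therefore works with the equations integrated
  in time.

  Testing with products \<open>\<eta>(t) \<phi>(x)\<close>, where \<open>\<eta>\<close> is a piecewise linear cutoff in time, expresses
  \<open>(\<epsilon> e(t), \<phi>)\<close> and \<open>(\<mu> h(t), \<psi>)\<close> for the continuous representatives as integrals over \<open>[0, t]\<close>
  (\<open>weak_equation_integrated\<close>).  Consequently, for \<open>0 \<le> a < b < T\<close>, the integrals \<open>E\<close>, \<open>H\<close> and \<open>J\<close> of \<open>e\<close>,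
  \<open>h\<close> and \<open>j(e)\<close> over \<open>[a, b]\<close> satisfy \<open>E \<in> V\<^sub>0\<close>, \<open>curl E = - \<mu> (h(b) - h(a))\<close>, \<open>H \<in> V\<close> and
  \<open>curl H = \<epsilon> (e(b) - e(a)) + J\<close>.  For these fields \<open>(curl E, H) = (E, curl H)\<close> is legitimate.  With
  \<open>f(r, s) = (\<epsilon> e(r), e(s)) + (\<mu> h(r), h(s))\<close> it reads
  \<open>\<integral>\<^sub>a\<^sup>b (f(b, s) - f(a, s)) ds + (J, E) = 0\<close> (\<open>energy_increment\<close>).

  Here all regularity questions have become questions on scalar functions.  Since \<open>e\<close> is uniformly
  continuous in time, \<open>(J, E)\<close> differs from \<open>(b - a) \<integral>\<^sub>a\<^sup>b (j(e), e) ds\<close> by a small multiple of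
  \<open>(b - a) \<integral>\<^sub>a\<^sup>b \<parallel>j(e)\<parallel> ds\<close>.  As \<open>f\<close> is continuous and symmetric, a lemma on functions of two real variables
  (\<open>energy_balance_from_increments\<close>) turns this into the constancy of
  \<open>f(t, t) / 2 + \<integral>\<^sub>0\<^sup>t (j(e), e) ds\<close> for \<open>t < T\<close>, and continuity gives \<open>t = T\<close>.

  Two facts on test functions enter.  They separate the points of \<open>L\<^sup>2\<close>
  (\<open>fundamental_lemma_calculus_of_variations\<close>, proved with explicit smooth bump functions); this makes
  weak curls unique and identifies the initial energy.  And they belong to \<open>V\<^sub>0\<close>
  (\<open>test_function_V0\<close>, by integration by parts), so that \<open>H \<in> V\<close> follows from testing with \<open>V\<^sub>0\<close>.
\<close>

section \<open>Square-integrable fields\<close>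

text \<open>
  The discriminant of the nonnegative quadratic polynomial \<open>l \<mapsto> \<integral> (f + l g)\<^sup>2\<close> is not positive.
\<close>

lemma integral_Cauchy_Schwarz:
  fixes f g :: "'a \<Rightarrow> real"
  assumes [measurable]: "f \<in> borel_measurable M" "g \<in> borel_measurable M"
    and f2: "integrable M (\<lambda>x. (f x)\<^sup>2)" and g2: "integrable M (\<lambda>x. (g x)\<^sup>2)"
  shows "integrable M (\<lambda>x. f x * g x)"
    and "(LINT x|M. f x * g x)\<^sup>2 \<le> (LINT x|M. (f x)\<^sup>2) * (LINT x|M. (g x)\<^sup>2)"
proof -
  show fg: "integrable M (\<lambda>x. f x * g x)"
  proof (rule Bochner_Integration.integrable_bound[OF Bochner_Integration.integrable_add[OF f2 g2]])
    show "AE x in M. norm (f x * g x) \<le> norm ((f x)\<^sup>2 + (g x)\<^sup>2)"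
    proof (rule AE_I2)
      fix x
      have "2 * \<bar>f x\<bar> * \<bar>g x\<bar> \<le> \<bar>f x\<bar>\<^sup>2 + \<bar>g x\<bar>\<^sup>2"
        by (rule sum_squares_bound)
      moreover have "0 \<le> \<bar>f x\<bar> * \<bar>g x\<bar>" by simp
      ultimately have "\<bar>f x\<bar> * \<bar>g x\<bar> \<le> (f x)\<^sup>2 + (g x)\<^sup>2"
        by (simp only: power2_abs)
      then show "norm (f x * g x) \<le> norm ((f x)\<^sup>2 + (g x)\<^sup>2)"
        by (simp add: abs_mult)
    qed
  qed simp
  define A B C where "A = (LINT x|M. (f x)\<^sup>2)" and "B = (LINT x|M. f x * g x)"
    and "C = (LINT x|M. (g x)\<^sup>2)"
  have quad: "0 \<le> A + 2 * l * B + l\<^sup>2 * C" for l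
  proof -
    have "0 \<le> (LINT x|M. (f x + l * g x)\<^sup>2)"
      by (rule Bochner_Integration.integral_nonneg) simp
    also have "(\<lambda>x. (f x + l * g x)\<^sup>2) = (\<lambda>x. (f x)\<^sup>2 + (2 * l) * (f x * g x) + l\<^sup>2 * (g x)\<^sup>2)"
      by (auto simp: power2_eq_square algebra_simps)
    also have "(LINT x|M. (f x)\<^sup>2 + (2 * l) * (f x * g x) + l\<^sup>2 * (g x)\<^sup>2) = A + 2 * l * B + l\<^sup>2 * C"
      using f2 g2 fg by (simp add: A_def B_def C_def)
    finally show ?thesis .
  qed
  have C0: "0 \<le> C" unfolding C_def by (rule Bochner_Integration.integral_nonneg) simp
  have "B\<^sup>2 \<le> A * C"
  proof (cases "C = 0")
    case True
    have "B = 0"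
    proof (rule ccontr)
      assume "B \<noteq> 0"
      have "0 \<le> A + 2 * (- (A + 1) / (2 * B)) * B" using quad[of "- (A + 1) / (2 * B)"] True by simp
      then show False using \<open>B \<noteq> 0\<close> by (simp add: field_simps)
    qed
    then show ?thesis using True by simp
  next
    case False
    then have "C > 0" using C0 by simp
    have "0 \<le> A + 2 * (- B / C) * B + (- B / C)\<^sup>2 * C" by (rule quad)
    also have "\<dots> = A - B\<^sup>2 / C" using False by (simp add: field_simps power2_eq_square)
    finally have "B\<^sup>2 / C \<le> A" by simp
    then show ?thesis using \<open>C > 0\<close> by (simp add: pos_divide_le_eq)
  qed
  then show "(LINT x|M. f x * g x)\<^sup>2 \<le> (LINT x|M. (f x)\<^sup>2) * (LINT x|M. (g x)\<^sup>2)"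
    by (simp add: A_def B_def C_def)
qed

lemma L2_measurable: "u \<in> L2 S \<Longrightarrow> u \<in> borel_measurable (lebesgue_on S)"
  by (simp add: L2_def)

lemma L2_square_integrable: "u \<in> L2 S \<Longrightarrow> integrable (lebesgue_on S) (\<lambda>x. (norm (u x))\<^sup>2)"
  by (simp add: L2_def)

lemma L2_inner_integrable:
  assumes "u \<in> L2 S" "v \<in> L2 S"
  shows "integrable (lebesgue_on S) (\<lambda>x. u x \<bullet> v x)"
proof -
  have [measurable]: "u \<in> borel_measurable (lebesgue_on S)" "v \<in> borel_measurable (lebesgue_on S)"
    using assms by (auto simp: L2_def)
  have "integrable (lebesgue_on S) (\<lambda>x. norm (u x) * norm (v x))"
    by (rule integral_Cauchy_Schwarz(1)) (use assms in \<open>auto simp: L2_def\<close>)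
  then show ?thesis
    by (rule Bochner_Integration.integrable_bound) (auto simp: Cauchy_Schwarz_ineq2)
qed

lemma L2_dominated:
  assumes u: "u \<in> L2 S" and v: "v \<in> borel_measurable (lebesgue_on S)"
    and le: "AE x in lebesgue_on S. norm (v x) \<le> c * norm (u x)"
  shows "v \<in> L2 S"
proof -
  note [measurable] = v
  have "integrable (lebesgue_on S) (\<lambda>x. c\<^sup>2 * (norm (u x))\<^sup>2)"
    using L2_square_integrable[OF u] by simp
  then have "integrable (lebesgue_on S) (\<lambda>x. (norm (v x))\<^sup>2)"
  proof (rule Bochner_Integration.integrable_bound)
    show "AE x in lebesgue_on S. norm ((norm (v x))\<^sup>2) \<le> norm (c\<^sup>2 * (norm (u x))\<^sup>2)"
      using le
    proof eventually_elim
      case (elim x)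
      then have "(norm (v x))\<^sup>2 \<le> (c * norm (u x))\<^sup>2" by (intro power_mono) auto
      then show ?case by (simp add: power_mult_distrib)
    qed
  qed simp
  with v show ?thesis by (simp add: L2_def)
qed

lemma L2_scaleR: "u \<in> L2 S \<Longrightarrow> (\<lambda>x. c *\<^sub>R u x) \<in> L2 S"
  by (rule L2_dominated[where c = "\<bar>c\<bar>"]) (auto simp: L2_def)

lemma L2_zero: "(\<lambda>x. 0) \<in> L2 S"
  by (simp add: L2_def)

lemma L2_uminus: "u \<in> L2 S \<Longrightarrow> (\<lambda>x. - u x) \<in> L2 S"
  using L2_scaleR[of u S "-1"] by simp

lemma L2_add:
  assumes "u \<in> L2 S" "v \<in> L2 S"
  shows "(\<lambda>x. u x + v x) \<in> L2 S"
proof -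
  have [measurable]: "u \<in> borel_measurable (lebesgue_on S)" "v \<in> borel_measurable (lebesgue_on S)"
    using assms by (auto simp: L2_def)
  have "integrable (lebesgue_on S) (\<lambda>x. (norm (u x))\<^sup>2 + 2 * (u x \<bullet> v x) + (norm (v x))\<^sup>2)"
    using assms L2_inner_integrable[OF assms]
    by (intro Bochner_Integration.integrable_add integrable_mult_right L2_square_integrable)
  also have "(\<lambda>x. (norm (u x))\<^sup>2 + 2 * (u x \<bullet> v x) + (norm (v x))\<^sup>2) = (\<lambda>x. (norm (u x + v x))\<^sup>2)"
    by (auto simp: power2_norm_eq_inner algebra_simps inner_commute)
  finally show ?thesis by (simp add: L2_def)
qed

lemma L2_diff: "u \<in> L2 S \<Longrightarrow> v \<in> L2 S \<Longrightarrow> (\<lambda>x. u x - v x) \<in> L2 S"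
  using L2_add[OF _ L2_uminus, of u S v] by simp

lemma inner_H_commute: "inner_H \<Omega> u v = inner_H \<Omega> v u"
  by (simp add: inner_H_def inner_commute)

lemma inner_H_add_left:
  "u \<in> L2 \<Omega> \<Longrightarrow> v \<in> L2 \<Omega> \<Longrightarrow> w \<in> L2 \<Omega> \<Longrightarrow>
    inner_H \<Omega> (\<lambda>x. u x + v x) w = inner_H \<Omega> u w + inner_H \<Omega> v w"
  unfolding inner_H_def by (simp add: inner_add_left L2_inner_integrable)

lemma inner_H_diff_left:
  "u \<in> L2 \<Omega> \<Longrightarrow> v \<in> L2 \<Omega> \<Longrightarrow> w \<in> L2 \<Omega> \<Longrightarrow>
    inner_H \<Omega> (\<lambda>x. u x - v x) w = inner_H \<Omega> u w - inner_H \<Omega> v w"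
  unfolding inner_H_def by (simp add: inner_diff_left L2_inner_integrable)

lemma inner_H_add_right:
  "u \<in> L2 \<Omega> \<Longrightarrow> v \<in> L2 \<Omega> \<Longrightarrow> w \<in> L2 \<Omega> \<Longrightarrow>
    inner_H \<Omega> w (\<lambda>x. u x + v x) = inner_H \<Omega> w u + inner_H \<Omega> w v"
  using inner_H_add_left[of u \<Omega> v w] by (simp only: inner_H_commute[of \<Omega> w])

lemma inner_H_diff_right:
  "u \<in> L2 \<Omega> \<Longrightarrow> v \<in> L2 \<Omega> \<Longrightarrow> w \<in> L2 \<Omega> \<Longrightarrow>
    inner_H \<Omega> w (\<lambda>x. u x - v x) = inner_H \<Omega> w u - inner_H \<Omega> w v"
  using inner_H_diff_left[of u \<Omega> v w] by (simp only: inner_H_commute[of \<Omega> w])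

lemma inner_H_scaleR_left: "inner_H \<Omega> (\<lambda>x. c *\<^sub>R u x) v = c * inner_H \<Omega> u v"
  by (simp add: inner_H_def)

lemma inner_H_scaleR_right: "inner_H \<Omega> u (\<lambda>x. c *\<^sub>R v x) = c * inner_H \<Omega> u v"
  by (simp add: inner_H_def)

lemma inner_H_uminus_left: "inner_H \<Omega> (\<lambda>x. - u x) v = - inner_H \<Omega> u v"
  by (simp add: inner_H_def)

lemma inner_H_nonneg: "0 \<le> inner_H \<Omega> u u"
  unfolding inner_H_def by (rule Bochner_Integration.integral_nonneg) simp

lemma norm_H_nonneg: "0 \<le> norm_H \<Omega> u"
  by (simp add: norm_H_def inner_H_nonneg)

lemma norm_H_power2: "(norm_H \<Omega> u)\<^sup>2 = inner_H \<Omega> u u"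
  by (simp add: norm_H_def inner_H_nonneg)

lemma norm_H_scaleR: "norm_H \<Omega> (\<lambda>x. c *\<^sub>R u x) = \<bar>c\<bar> * norm_H \<Omega> u"
  by (simp add: norm_H_def inner_H_scaleR_left inner_H_scaleR_right real_sqrt_mult
      flip: mult.assoc)

lemma inner_H_Cauchy_Schwarz:
  assumes "u \<in> L2 \<Omega>" "v \<in> L2 \<Omega>"
  shows "\<bar>inner_H \<Omega> u v\<bar> \<le> norm_H \<Omega> u * norm_H \<Omega> v"
proof -
  have [measurable]: "u \<in> borel_measurable (lebesgue_on \<Omega>)" "v \<in> borel_measurable (lebesgue_on \<Omega>)"
    using assms by (auto simp: L2_def)
  note CS = integral_Cauchy_Schwarz[of "\<lambda>x. norm (u x)" "lebesgue_on \<Omega>" "\<lambda>x. norm (v x)"]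
  have le: "\<bar>inner_H \<Omega> u v\<bar> \<le> (LINT x|lebesgue_on \<Omega>. norm (u x) * norm (v x))"
    unfolding inner_H_def
    by (intro order_trans[OF integral_abs_bound] integral_mono
        CS(1) integrable_abs L2_inner_integrable assms)
       (use assms in \<open>auto simp: L2_def Cauchy_Schwarz_ineq2\<close>)
  have "(inner_H \<Omega> u v)\<^sup>2 \<le> (LINT x|lebesgue_on \<Omega>. norm (u x) * norm (v x))\<^sup>2"
    using power_mono[OF le, of 2] by simp
  also have "\<dots> \<le> (norm_H \<Omega> u * norm_H \<Omega> v)\<^sup>2"
    using CS(2) assms by (simp add: power_mult_distrib norm_H_power2 L2_def)
      (simp add: inner_H_def power2_norm_eq_inner)
  finally show ?thesis
    by (metis abs_of_nonneg abs_le_square_iff norm_H_nonneg mult_nonneg_nonneg)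
qed

lemma inner_H_cong_AE:
  assumes "u \<in> L2 \<Omega>" "u' \<in> L2 \<Omega>" "v \<in> L2 \<Omega>" and "AE x in lebesgue_on \<Omega>. u x = u' x"
  shows "inner_H \<Omega> u v = inner_H \<Omega> u' v"
  unfolding inner_H_def
  by (rule integral_cong_AE)
     (use assms L2_inner_integrable[of u \<Omega> v] L2_inner_integrable[of u' \<Omega> v] in auto)

lemma matrix_mult_measurable:
  fixes w :: "'a::euclidean_space \<Rightarrow> real^3^3" and u :: "'a \<Rightarrow> vec3"
  assumes [measurable]: "\<And>i k. (\<lambda>x. w x $ i $ k) \<in> borel_measurable M" "u \<in> borel_measurable M"
  shows "(\<lambda>x. w x *v u x) \<in> borel_measurable M"
proof (subst borel_measurable_euclidean_space, intro ballI)
  have uk [measurable]: "(\<lambda>x. u x $ k) \<in> borel_measurable M" for k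
    by (simp add: cart_eq_inner_axis)
  fix b :: vec3 assume "b \<in> Basis"
  then obtain i where b: "b = axis i 1" by (auto simp: Basis_vec_def)
  show "(\<lambda>x. (w x *v u x) \<bullet> b) \<in> borel_measurable M"
    unfolding b inner_axis by (simp add: matrix_vector_mult_def)
qed

lemma material_field_bound:
  assumes w: "material_field \<Omega> w"
  obtains C where "0 \<le> C" "\<And>x \<xi>. x \<in> \<Omega> \<Longrightarrow> norm (w x *v \<xi>) \<le> C * norm \<xi>"
proof -
  have "\<forall>i k. \<exists>B. \<forall>x\<in>\<Omega>. \<bar>w x $ i $ k\<bar> \<le> B"
    using w unfolding material_field_def bounded_iff by auto
  then obtain B where B: "\<And>i k x. x \<in> \<Omega> \<Longrightarrow> \<bar>w x $ i $ k\<bar> \<le> B i k" by metis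
  define C where "C = (\<Sum>i\<in>UNIV. \<Sum>k\<in>UNIV. \<bar>B i k\<bar>)"
  have C0: "0 \<le> C" unfolding C_def by (intro sum_nonneg) auto
  have bound: "norm (w x *v \<xi>) \<le> C * norm \<xi>" if x: "x \<in> \<Omega>" for x \<xi>
  proof -
    have "norm (w x *v \<xi>) \<le> (\<Sum>i\<in>UNIV. \<bar>(w x *v \<xi>) $ i\<bar>)" by (rule norm_le_l1_cart)
    also have "\<dots> \<le> (\<Sum>i\<in>UNIV. \<Sum>k\<in>UNIV. \<bar>B i k\<bar> * norm \<xi>)"
    proof (rule sum_mono)
      fix i
      have "\<bar>(w x *v \<xi>) $ i\<bar> \<le> (\<Sum>k\<in>UNIV. \<bar>w x $ i $ k * \<xi> $ k\<bar>)"
        unfolding matrix_vector_mult_def by simp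
      also have "\<dots> \<le> (\<Sum>k\<in>UNIV. \<bar>B i k\<bar> * norm \<xi>)"
      proof (rule sum_mono)
        fix k show "\<bar>w x $ i $ k * \<xi> $ k\<bar> \<le> \<bar>B i k\<bar> * norm \<xi>"
          using B[OF x, of i k] component_le_norm_cart[of \<xi> k]
          by (auto simp: abs_mult intro!: mult_mono)
      qed
      finally show "\<bar>(w x *v \<xi>) $ i\<bar> \<le> (\<Sum>k\<in>UNIV. \<bar>B i k\<bar> * norm \<xi>)" .
    qed
    also have "\<dots> = C * norm \<xi>" by (simp add: C_def sum_distrib_right)
    finally show ?thesis .
  qed
  with C0 that show ?thesis by blast
qed

lemma material_field_mult_L2:
  assumes w: "material_field \<Omega> w" and u: "u \<in> L2 \<Omega>"
  shows "(\<lambda>x. w x *v u x) \<in> L2 \<Omega>"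
proof -
  obtain C where C: "\<And>x \<xi>. x \<in> \<Omega> \<Longrightarrow> norm (w x *v \<xi>) \<le> C * norm \<xi>"
    using material_field_bound[OF w] by metis
  show ?thesis
  proof (rule L2_dominated[OF u])
    show "(\<lambda>x. w x *v u x) \<in> borel_measurable (lebesgue_on \<Omega>)"
      using w u by (intro matrix_mult_measurable) (auto simp: material_field_def L2_def)
    show "AE x in lebesgue_on \<Omega>. norm (w x *v u x) \<le> C * norm (u x)"
      by (rule AE_I2) (simp add: C)
  qed
qed

lemma material_field_symmetric:
  assumes "material_field \<Omega> w"
  shows "inner_H \<Omega> (\<lambda>x. w x *v u x) v = inner_H \<Omega> (\<lambda>x. w x *v v x) u"
  unfolding inner_H_def
proof (rule Bochner_Integration.integral_cong)
  fix x assume "x \<in> space (lebesgue_on \<Omega>)"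
  then have "transpose (w x) = w x" using assms by (auto simp: material_field_def)
  then show "(w x *v u x) \<bullet> v x = (w x *v v x) \<bullet> u x"
    by (metis dot_lmul_matrix inner_commute transpose_matrix_vector)
qed simp

lemma material_field_norm:
  assumes "material_field \<Omega> w"
  shows "(norm_Hw \<Omega> w u)\<^sup>2 = inner_H \<Omega> (\<lambda>x. w x *v u x) u"
proof -
  obtain c where c: "c > 0" "\<And>x \<xi>. x \<in> \<Omega> \<Longrightarrow> (w x *v \<xi>) \<bullet> \<xi> \<ge> c * (norm \<xi>)\<^sup>2"
    using assms unfolding material_field_def by auto
  have "0 \<le> (w x *v \<xi>) \<bullet> \<xi>" if "x \<in> \<Omega>" for x \<xi>
    using c(2)[OF that, of \<xi>] c(1) by (smt (verit) mult_nonneg_nonneg zero_le_power2)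
  then have "0 \<le> inner_Hw \<Omega> w u u"
    unfolding inner_Hw_def by (intro Bochner_Integration.integral_nonneg) auto
  then show ?thesis by (simp add: norm_Hw_def inner_Hw_def inner_H_def)
qed

section \<open>Iterated Lebesgue integrals\<close>

text \<open>
  The Lebesgue \<open>\<sigma>\<close>-algebra of a product is larger than the product of the two Lebesgue
  \<open>\<sigma>\<close>-algebras, so the abstract Fubini theorem does not apply to it directly.  All statements on
  sections and iterated integrals are therefore reduced to Borel functions: a Lebesgue measurable
  function has a Borel representative, and the exceptional null set has null sections at almost
  every point.
\<close>

lemma lebesgue_ex_borel_measurable:
  fixes f :: "'a::euclidean_space \<Rightarrow> 'b::euclidean_space"
  assumes f: "f \<in> borel_measurable lebesgue"
  obtains f' where "f' \<in> borel_measurable borel" "AE x in lborel. f x = f' x"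
proof -
  have "\<forall>b\<in>Basis. \<exists>g. g \<in> borel_measurable lborel \<and> (AE x in lborel. f x \<bullet> b = g x)"
  proof
    fix b :: 'b assume "b \<in> Basis"
    have "(\<lambda>x. f x \<bullet> b) \<in> borel_measurable lebesgue" using f by simp
    then show "\<exists>g. g \<in> borel_measurable lborel \<and> (AE x in lborel. f x \<bullet> b = g x)"
      by (auto dest!: completion_ex_borel_measurable_real)
  qed
  then obtain g where g: "\<And>b. b \<in> Basis \<Longrightarrow> g b \<in> borel_measurable lborel"
    "\<And>b. b \<in> Basis \<Longrightarrow> AE x in lborel. f x \<bullet> b = g b x"
    by metis
  have "AE x in lborel. \<forall>b\<in>Basis. f x \<bullet> b = g b x"
    using g(2) by (simp add: AE_ball_countable countable_finite)
  then have "AE x in lborel. f x = (\<Sum>b\<in>Basis. g b x *\<^sub>R b)"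
  proof eventually_elim
    case (elim x)
    then show ?case by (subst euclidean_representation[of "f x", symmetric]) simp
  qed
  moreover have "(\<lambda>x. \<Sum>b\<in>Basis. g b x *\<^sub>R b) \<in> borel_measurable borel"
    using g(1) by (intro borel_measurable_sum borel_measurable_scaleR) auto
  ultimately show ?thesis using that by blast
qed

lemma AE_lborel_null_set:
  assumes "AE x in lborel. P x"
  obtains N where "N \<in> null_sets lborel" "\<And>x. x \<notin> N \<Longrightarrow> P x"
  using assms by (rule AE_E3) auto

lemma AE_lborel_prod:
  fixes P :: "'a::euclidean_space \<times> 'b::euclidean_space \<Rightarrow> bool"
  assumes "AE z in lborel. P z"
  shows "AE x in lborel. AE y in lborel. P (x, y)" and "AE y in lborel. AE x in lborel. P (x, y)"
proof -
  obtain N where N: "N \<in> null_sets lborel" "\<And>x. x \<notin> N \<Longrightarrow> P x"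
    using AE_lborel_null_set[OF assms] by blast
  have "AE z in lborel \<Otimes>\<^sub>M lborel. z \<notin> N"
    using N(1) by (simp add: lborel_prod AE_not_in)
  then have 1: "AE x in lborel. AE y in lborel. (x, y) \<notin> N"
    by (rule lborel_pair.AE_pair)
  then show "AE x in lborel. AE y in lborel. P (x, y)"
    by eventually_elim (auto elim!: eventually_mono intro: N(2))
  have "N \<in> sets borel" using N(1) by auto
  then have Nm: "N \<in> sets (borel \<Otimes>\<^sub>M borel)" unfolding borel_prod .
  have "AE y in lborel. AE x in lborel. (x, y) \<notin> N"
  proof (subst lborel_pair.AE_commute[symmetric])
    note [measurable] = Nm
    show "{x \<in> space (lborel \<Otimes>\<^sub>M lborel). (fst x, snd x) \<notin> N} \<in> sets (lborel \<Otimes>\<^sub>M lborel)"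
      by measurable
  qed (use 1 in auto)
  then show "AE y in lborel. AE x in lborel. P (x, y)"
    by eventually_elim (auto elim!: eventually_mono intro: N(2))
qed

lemma AE_lborel_fst_snd:
  assumes "AE x in lborel. P x"
  shows "AE z in (lborel :: ('a::euclidean_space \<times> 'b::euclidean_space) measure). P (fst z)"
    and "AE z in (lborel :: ('b \<times> 'a) measure). P (snd z)"
proof -
  obtain N where N: "N \<in> null_sets lborel" "\<And>x. x \<notin> N \<Longrightarrow> P x"
    using AE_lborel_null_set[OF assms] by blast
  have [measurable]: "N \<in> sets borel" using N(1) by auto
  have AEN: "AE x in lborel. x \<notin> N" using N(1) by (rule AE_not_in)
  have "AE z in (lborel \<Otimes>\<^sub>M lborel :: ('a \<times> 'b) measure). fst z \<notin> N"
  proof (rule lborel_pair.AE_pair_measure)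
    show "{z \<in> space (lborel \<Otimes>\<^sub>M lborel :: ('a \<times> 'b) measure). fst z \<notin> N} \<in> sets (lborel \<Otimes>\<^sub>M lborel)"
      by measurable
  qed (use AEN in auto)
  then show "AE z in (lborel :: ('a \<times> 'b) measure). P (fst z)"
    unfolding lborel_prod by (auto elim!: eventually_mono intro: N(2))
  have "AE z in (lborel \<Otimes>\<^sub>M lborel :: ('b \<times> 'a) measure). snd z \<notin> N"
  proof (rule lborel_pair.AE_pair_measure)
    show "{z \<in> space (lborel \<Otimes>\<^sub>M lborel :: ('b \<times> 'a) measure). snd z \<notin> N} \<in> sets (lborel \<Otimes>\<^sub>M lborel)"
      by measurable
  qed (use AEN in auto)
  then show "AE z in (lborel :: ('b \<times> 'a) measure). P (snd z)"
    unfolding lborel_prod by (auto elim!: eventually_mono intro: N(2))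
qed

lemma integrable_lebesgue_cong_AE:
  fixes f g :: "'a::euclidean_space \<Rightarrow> 'b::euclidean_space"
  assumes "integrable lborel g" "AE x in lborel. f x = g x"
  shows "integrable lebesgue f" and "integral\<^sup>L lebesgue f = integral\<^sup>L lborel g"
proof -
  have g: "integrable lebesgue g" and gm: "g \<in> borel_measurable lborel"
    using assms(1) by (auto simp: integrable_completion)
  have AE: "AE x in lebesgue. g x = f x"
    using assms(2) by (intro AE_completion) (auto elim: eventually_mono)
  have fm: "f \<in> borel_measurable lebesgue"
    using borel_measurable_AE[OF borel_measurable_integrable[OF g] AE] .
  show "integrable lebesgue f"
    using Bochner_Integration.integrable_cong_AE[OF borel_measurable_integrable[OF g] fm AE] g by blast
  have "integral\<^sup>L lebesgue f = integral\<^sup>L lebesgue g"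
    using integral_cong_AE[OF borel_measurable_integrable[OF g] fm AE] by simp
  then show "integral\<^sup>L lebesgue f = integral\<^sup>L lborel g"
    using gm by (simp add: integral_completion)
qed

lemma integrable_lebesgue_ex_lborel:
  fixes f :: "'a::euclidean_space \<Rightarrow> 'b::euclidean_space"
  assumes f: "integrable lebesgue f"
  obtains g where "g \<in> borel_measurable borel" "integrable lborel g" "AE x in lborel. f x = g x"
proof -
  obtain g where gm: "g \<in> borel_measurable borel" and fg: "AE x in lborel. f x = g x"
    using lebesgue_ex_borel_measurable[OF borel_measurable_integrable[OF f]] by blast
  have gm': "g \<in> borel_measurable lebesgue" using gm by (simp add: measurable_completion)
  have "integrable lebesgue g"
    using f Bochner_Integration.integrable_cong_AE[OF borel_measurable_integrable[OF f] gm' AE_completion[OF fg]]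
    by blast
  then have "integrable lborel g" using gm by (simp add: integrable_completion)
  with gm fg that show ?thesis by blast
qed

text \<open>
  Transfers one order of integration from a Borel representative \<open>g\<close> to \<open>f\<close>; the two orders of
  Fubini's theorem are two instances.
\<close>

lemma lebesgue_iterated_cong:
  fixes f g :: "'b::euclidean_space \<Rightarrow> 'a::euclidean_space \<Rightarrow> 'c::euclidean_space"
  assumes fg: "AE y in lborel. AE x in lborel. f y x = g y x"
    and g: "AE y in lborel. integrable lborel (g y)" "integrable lborel (\<lambda>y. LINT x|lborel. g y x)"
  shows "AE y in lebesgue. integrable lebesgue (f y)"
    and "integrable lebesgue (\<lambda>y. LINT x|lebesgue. f y x)"
    and "(LINT y|lebesgue. LINT x|lebesgue. f y x) = (LINT y|lborel. LINT x|lborel. g y x)"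
proof -
  have *: "AE y in lborel. integrable lebesgue (f y) \<and> (LINT x|lebesgue. f y x) = (LINT x|lborel. g y x)"
    using g(1) fg by eventually_elim (auto intro: integrable_lebesgue_cong_AE)
  then show "AE y in lebesgue. integrable lebesgue (f y)"
    by (intro AE_completion) (auto elim: eventually_mono)
  have "AE y in lborel. (LINT x|lebesgue. f y x) = (LINT x|lborel. g y x)"
    using * by (auto elim: eventually_mono)
  from integrable_lebesgue_cong_AE[OF g(2) this]
  show "integrable lebesgue (\<lambda>y. LINT x|lebesgue. f y x)"
    and "(LINT y|lebesgue. LINT x|lebesgue. f y x) = (LINT y|lborel. LINT x|lborel. g y x)" .
qed

lemma lebesgue_Fubini:
  fixes f :: "'a::euclidean_space \<times> 'b::euclidean_space \<Rightarrow> 'c::euclidean_space"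
  assumes f: "integrable lebesgue f"
  shows "AE y in lebesgue. integrable lebesgue (\<lambda>x. f (x, y))"
    and "integrable lebesgue (\<lambda>y. LINT x|lebesgue. f (x, y))"
    and "(LINT y|lebesgue. LINT x|lebesgue. f (x, y)) = integral\<^sup>L lebesgue f"
    and "AE x in lebesgue. integrable lebesgue (\<lambda>y. f (x, y))"
    and "integrable lebesgue (\<lambda>x. LINT y|lebesgue. f (x, y))"
    and "(LINT x|lebesgue. LINT y|lebesgue. f (x, y)) = integral\<^sup>L lebesgue f"
proof -
  obtain g where g: "integrable lborel g" and fg: "AE x in lborel. f x = g x"
    using integrable_lebesgue_ex_lborel[OF f] by blast
  have gp: "integrable (lborel \<Otimes>\<^sub>M lborel) (\<lambda>(x, y). g (x, y))" using g by (simp add: lborel_prod)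
  have I: "integral\<^sup>L lebesgue f = integral\<^sup>L lborel g"
    by (rule integrable_lebesgue_cong_AE(2)[OF g fg])
  note s = lebesgue_iterated_cong[OF AE_lborel_prod(2)[OF fg] lborel_pair.AE_integrable_snd[OF gp] lborel_pair.integrable_snd[OF gp]]
  note t = lebesgue_iterated_cong[OF AE_lborel_prod(1)[OF fg] lborel_pair.AE_integrable_fst[OF gp] lborel_pair.integrable_fst[OF gp]]
  show "AE y in lebesgue. integrable lebesgue (\<lambda>x. f (x, y))"
    "integrable lebesgue (\<lambda>y. LINT x|lebesgue. f (x, y))"
    "(LINT y|lebesgue. LINT x|lebesgue. f (x, y)) = integral\<^sup>L lebesgue f"
    using s lborel_pair.integral_snd[OF gp] by (simp_all add: I lborel_prod)
  show "AE x in lebesgue. integrable lebesgue (\<lambda>y. f (x, y))"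
    "integrable lebesgue (\<lambda>x. LINT y|lebesgue. f (x, y))"
    "(LINT x|lebesgue. LINT y|lebesgue. f (x, y)) = integral\<^sup>L lebesgue f"
    using t lborel_pair.integral_fst[OF gp] by (simp_all add: I lborel_prod)
qed

lemma Times_sets_lebesgue:
  assumes "S \<in> sets borel" "J \<in> sets borel"
  shows "S \<times> J \<in> sets lebesgue"
  using borel_Times[OF assms] by simp

lemma lebesgue_on_Fubini:
  fixes f :: "'a::euclidean_space \<times> 'b::euclidean_space \<Rightarrow> 'c::euclidean_space"
  assumes S: "S \<in> sets borel" and J: "J \<in> sets borel"
    and f: "integrable (lebesgue_on (S \<times> J)) f"
  shows "AE y in lebesgue_on J. integrable (lebesgue_on S) (\<lambda>x. f (x, y))"
    and "integrable (lebesgue_on J) (\<lambda>y. LINT x|lebesgue_on S. f (x, y))"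
    and "(LINT y|lebesgue_on J. LINT x|lebesgue_on S. f (x, y)) = integral\<^sup>L (lebesgue_on (S \<times> J)) f"
    and "AE x in lebesgue_on S. integrable (lebesgue_on J) (\<lambda>y. f (x, y))"
    and "integrable (lebesgue_on S) (\<lambda>x. LINT y|lebesgue_on J. f (x, y))"
    and "(LINT x|lebesgue_on S. LINT y|lebesgue_on J. f (x, y)) = integral\<^sup>L (lebesgue_on (S \<times> J)) f"
proof -
  define F where "F z = (if z \<in> S \<times> J then f z else 0)" for z
  have SJ: "S \<times> J \<in> sets lebesgue" by (rule Times_sets_lebesgue[OF S J])
  have S': "S \<in> sets lebesgue" and J': "J \<in> sets lebesgue" using S J by auto
  have F: "integrable lebesgue F"
    unfolding F_def using f SJ by (simp add: Lebesgue_Measure.integrable_restrict_UNIV)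
  have FI: "integral\<^sup>L lebesgue F = integral\<^sup>L (lebesgue_on (S \<times> J)) f"
    unfolding F_def by (rule Lebesgue_Measure.integral_restrict_UNIV[OF SJ])
  note Fub = lebesgue_Fubini[OF F]
  have Fy: "(\<lambda>x. F (x, y)) = (if y \<in> J then (\<lambda>x. if x \<in> S then f (x, y) else 0) else (\<lambda>x. 0))" for y
    by (auto simp: F_def)
  have Fx: "(\<lambda>y. F (x, y)) = (if x \<in> S then (\<lambda>y. if y \<in> J then f (x, y) else 0) else (\<lambda>x. 0))" for x
    by (auto simp: F_def)
  have Iy: "(LINT x|lebesgue. F (x, y)) = (if y \<in> J then LINT x|lebesgue_on S. f (x, y) else 0)" for y
    unfolding Fy by (simp add: Lebesgue_Measure.integral_restrict_UNIV[OF S'])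
  have Ix: "(LINT y|lebesgue. F (x, y)) = (if x \<in> S then LINT y|lebesgue_on J. f (x, y) else 0)" for x
    unfolding Fx by (simp add: Lebesgue_Measure.integral_restrict_UNIV[OF J'])
  show "AE y in lebesgue_on J. integrable (lebesgue_on S) (\<lambda>x. f (x, y))"
    using Fub(1) J' unfolding Fy
    by (auto simp: AE_restrict_space_iff Lebesgue_Measure.integrable_restrict_UNIV[OF S'] elim!: eventually_mono)
  show "integrable (lebesgue_on J) (\<lambda>y. LINT x|lebesgue_on S. f (x, y))"
    using Fub(2) unfolding Iy by (simp add: Lebesgue_Measure.integrable_restrict_UNIV[OF J'])
  show "(LINT y|lebesgue_on J. LINT x|lebesgue_on S. f (x, y)) = integral\<^sup>L (lebesgue_on (S \<times> J)) f"
    using Fub(3) unfolding Iy by (simp add: Lebesgue_Measure.integral_restrict_UNIV[OF J'] FI)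
  show "AE x in lebesgue_on S. integrable (lebesgue_on J) (\<lambda>y. f (x, y))"
    using Fub(4) S' unfolding Fx
    by (auto simp: AE_restrict_space_iff Lebesgue_Measure.integrable_restrict_UNIV[OF J'] elim!: eventually_mono)
  show "integrable (lebesgue_on S) (\<lambda>x. LINT y|lebesgue_on J. f (x, y))"
    using Fub(5) unfolding Ix by (simp add: Lebesgue_Measure.integrable_restrict_UNIV[OF S'])
  show "(LINT x|lebesgue_on S. LINT y|lebesgue_on J. f (x, y)) = integral\<^sup>L (lebesgue_on (S \<times> J)) f"
    using Fub(6) unfolding Ix by (simp add: Lebesgue_Measure.integral_restrict_UNIV[OF S'] FI)
qed

lemma lebesgue_on_ex_borel_measurable:
  fixes f :: "'a::euclidean_space \<Rightarrow> 'b::euclidean_space"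
  assumes "f \<in> borel_measurable (lebesgue_on S)" and S: "S \<in> sets borel"
  obtains f' where "f' \<in> borel_measurable borel" "AE x in lborel. x \<in> S \<longrightarrow> f x = f' x"
proof -
  have "(\<lambda>x. if x \<in> S then f x else 0) \<in> borel_measurable lebesgue"
    using assms by (intro borel_measurable_if_I) auto
  from lebesgue_ex_borel_measurable[OF this] obtain f' where
    f': "f' \<in> borel_measurable borel" "AE x in lborel. (if x \<in> S then f x else 0) = f' x" by blast
  have "AE x in lborel. x \<in> S \<longrightarrow> f x = f' x"
    using f'(2) by eventually_elim auto
  with f' that show ?thesis by blast
qed

lemma borel_measurable_lebesgue_on_AE:
  fixes f :: "'a::euclidean_space \<Rightarrow> 'b::euclidean_space"
  assumes "f \<in> borel_measurable (lebesgue_on S)" and S: "S \<in> sets borel"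
    and "AE x in lebesgue_on S. f x = g x"
  shows "g \<in> borel_measurable (lebesgue_on S)"
proof -
  have S': "S \<in> sets lebesgue" using S by auto
  have "(\<lambda>x. if x \<in> S then f x else 0) \<in> borel_measurable lebesgue"
    using assms by (intro borel_measurable_if_I) auto
  moreover have "AE x in lebesgue. (if x \<in> S then f x else 0) = (if x \<in> S then g x else 0)"
    using assms(3) S' by (auto simp: AE_restrict_space_iff elim!: eventually_mono)
  ultimately have "(\<lambda>x. if x \<in> S then g x else 0) \<in> borel_measurable lebesgue"
    by (rule borel_measurable_AE)
  then show ?thesis by (rule borel_measurable_if_D)
qed

lemma lebesgue_on_AE_eq_imp_measurable:
  fixes f :: "'a::euclidean_space \<Rightarrow> 'b::euclidean_space"
  assumes "f' \<in> borel_measurable borel" and S: "S \<in> sets borel"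
    and "AE x in lborel. x \<in> S \<longrightarrow> f x = f' x"
  shows "f \<in> borel_measurable (lebesgue_on S)"
proof (rule borel_measurable_lebesgue_on_AE[OF _ S])
  show "f' \<in> borel_measurable (lebesgue_on S)"
    using assms(1) by (simp add: measurable_completion measurable_restrict_space1)
  have "AE x in lebesgue. x \<in> S \<longrightarrow> f x = f' x" using assms(3) by (rule AE_completion)
  then show "AE x in lebesgue_on S. f' x = f x"
    using S by (auto simp: AE_restrict_space_iff elim!: eventually_mono)
qed

lemma lebesgue_on_Times_measurable:
  fixes f :: "'a::euclidean_space \<Rightarrow> 'c::euclidean_space" and g :: "'b::euclidean_space \<Rightarrow> 'c"
  assumes S: "S \<in> sets borel" and J: "J \<in> sets borel"
  shows "f \<in> borel_measurable (lebesgue_on S) \<Longrightarrow>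
      (\<lambda>z. f (fst z)) \<in> borel_measurable (lebesgue_on (S \<times> J))"
    and "g \<in> borel_measurable (lebesgue_on J) \<Longrightarrow>
      (\<lambda>z. g (snd z)) \<in> borel_measurable (lebesgue_on (S \<times> J))"
proof -
  have SJ: "S \<times> J \<in> sets borel" by (rule borel_Times[OF S J])
  show "(\<lambda>z. f (fst z)) \<in> borel_measurable (lebesgue_on (S \<times> J))"
    if fm: "f \<in> borel_measurable (lebesgue_on S)"
  proof -
    obtain f' where f': "f' \<in> borel_measurable borel" "AE x in lborel. x \<in> S \<longrightarrow> f x = f' x"
      using lebesgue_on_ex_borel_measurable[OF fm S] by blast
    have "AE z in (lborel :: ('a \<times> 'b) measure). fst z \<in> S \<longrightarrow> f (fst z) = f' (fst z)"
      by (rule AE_lborel_fst_snd(1)[OF f'(2)])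
    then have AE: "AE z in (lborel :: ('a \<times> 'b) measure). z \<in> S \<times> J \<longrightarrow> f (fst z) = f' (fst z)"
      by eventually_elim auto
    show ?thesis
      by (rule lebesgue_on_AE_eq_imp_measurable[OF _ SJ AE])
         (rule measurable_compose[OF _ f'(1)],
          intro borel_measurable_continuous_onI continuous_intros)
  qed
  show "(\<lambda>z. g (snd z)) \<in> borel_measurable (lebesgue_on (S \<times> J))"
    if gm: "g \<in> borel_measurable (lebesgue_on J)"
  proof -
    obtain f' where f': "f' \<in> borel_measurable borel" "AE x in lborel. x \<in> J \<longrightarrow> g x = f' x"
      using lebesgue_on_ex_borel_measurable[OF gm J] by blast
    have "AE z in (lborel :: ('a \<times> 'b) measure). snd z \<in> J \<longrightarrow> g (snd z) = f' (snd z)"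
      by (rule AE_lborel_fst_snd(2)[OF f'(2)])
    then have AE: "AE z in (lborel :: ('a \<times> 'b) measure). z \<in> S \<times> J \<longrightarrow> g (snd z) = f' (snd z)"
      by eventually_elim auto
    show ?thesis
      by (rule lebesgue_on_AE_eq_imp_measurable[OF _ SJ AE])
         (rule measurable_compose[OF _ f'(1)],
          intro borel_measurable_continuous_onI continuous_intros)
  qed
qed

section \<open>Square-integrable fields on products\<close>

lemma integrable_lebesgue_on_Times_product:
  fixes p :: "'a::euclidean_space \<Rightarrow> real" and q :: "'b::euclidean_space \<Rightarrow> real"
  assumes S: "S \<in> sets borel" and J: "J \<in> sets borel"
    and p: "integrable (lebesgue_on S) p" and q: "integrable (lebesgue_on J) q"
  shows "integrable (lebesgue_on (S \<times> J)) (\<lambda>z. p (fst z) * q (snd z))"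
proof -
  define P where "P x = (if x \<in> S then p x else 0)" for x
  define Q where "Q x = (if x \<in> J then q x else 0)" for x
  have P: "integrable lebesgue P" unfolding P_def using p S by (simp add: Lebesgue_Measure.integrable_restrict_UNIV)
  have Q: "integrable lebesgue Q" unfolding Q_def using q J by (simp add: Lebesgue_Measure.integrable_restrict_UNIV)
  obtain P' where P'm: "P' \<in> borel_measurable borel" and P'i: "integrable lborel P'"
    and P': "AE x in lborel. P x = P' x"
    using integrable_lebesgue_ex_lborel[OF P] by blast
  obtain Q' where Q'm: "Q' \<in> borel_measurable borel" and Q'i: "integrable lborel Q'"
    and Q': "AE x in lborel. Q x = Q' x"
    using integrable_lebesgue_ex_lborel[OF Q] by blast
  have "integrable (lborel \<Otimes>\<^sub>M lborel) (\<lambda>z. P' (fst z) * Q' (snd z))"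
  proof (rule lborel_pair.Fubini_integrable)
    show "(\<lambda>z. P' (fst z) * Q' (snd z)) \<in> borel_measurable (lborel \<Otimes>\<^sub>M lborel)"
      using P'm Q'm by measurable
    show "integrable lborel (\<lambda>x. LINT y|lborel. norm (P' (fst (x, y)) * Q' (snd (x, y))))"
      using P'i by (simp add: abs_mult)
    show "AE x in lborel. integrable lborel (\<lambda>y. P' (fst (x, y)) * Q' (snd (x, y)))"
      using Q'i by simp
  qed
  then have I: "integrable lborel (\<lambda>z. P' (fst z) * Q' (snd z))" by (simp add: lborel_prod)
  have AE: "AE z in (lborel :: ('a \<times> 'b) measure). P (fst z) * Q (snd z) = P' (fst z) * Q' (snd z)"
    using AE_lborel_fst_snd(1)[OF P', where 'b = 'b] AE_lborel_fst_snd(2)[OF Q', where 'b = 'a]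
    by eventually_elim simp
  have "integrable lebesgue (\<lambda>z::'a \<times> 'b. P (fst z) * Q (snd z))"
    by (rule integrable_lebesgue_cong_AE(1)[OF I AE])
  also have "(\<lambda>z. P (fst z) * Q (snd z)) = (\<lambda>z. if z \<in> S \<times> J then p (fst z) * q (snd z) else 0)"
    by (auto simp: P_def Q_def fun_eq_iff)
  finally show ?thesis
    using Times_sets_lebesgue[OF S J] by (simp add: Lebesgue_Measure.integrable_restrict_UNIV)
qed

lemma L2_product:
  fixes S :: "'a::euclidean_space set" and J :: "'b::euclidean_space set"
  assumes S: "S \<in> sets borel" and J: "J \<in> sets borel"
    and u: "u \<in> L2 S" and k: "k \<in> borel_measurable (lebesgue_on J)"
    and k2: "integrable (lebesgue_on J) (\<lambda>t. (k t)\<^sup>2)"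
  shows "(\<lambda>z. k (snd z) *\<^sub>R u (fst z)) \<in> L2 (S \<times> J)"
proof -
  have [measurable]: "(\<lambda>z. k (snd z)) \<in> borel_measurable (lebesgue_on (S \<times> J))"
    by (rule lebesgue_on_Times_measurable(2)[OF S J k])
  have [measurable]: "(\<lambda>z. u (fst z)) \<in> borel_measurable (lebesgue_on (S \<times> J))"
    by (rule lebesgue_on_Times_measurable(1)[OF S J L2_measurable[OF u]])
  have "integrable (lebesgue_on (S \<times> J)) (\<lambda>z. (norm (u (fst z)))\<^sup>2 * (k (snd z))\<^sup>2)"
    by (rule integrable_lebesgue_on_Times_product[OF S J L2_square_integrable[OF u] k2])
  then show ?thesis
    by (simp add: L2_def power_mult_distrib mult.commute)
qed

lemma L2_AE_eq:
  assumes u: "u \<in> L2 S" and S: "S \<in> sets borel" and AE: "AE x in lebesgue_on S. u x = v x"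
  shows "v \<in> L2 S"
  by (rule L2_dominated[OF u borel_measurable_lebesgue_on_AE[OF L2_measurable[OF u] S AE], of 1])
     (use AE in \<open>auto elim: eventually_mono\<close>)

lemma lebesgue_on_Times_slice_measurable:
  fixes u :: "'a::euclidean_space \<times> 'b::euclidean_space \<Rightarrow> 'c::euclidean_space"
  assumes S: "S \<in> sets borel" and J: "J \<in> sets borel"
    and u: "u \<in> borel_measurable (lebesgue_on (S \<times> J))"
  shows "AE t in lebesgue_on J. (\<lambda>x. u (x, t)) \<in> borel_measurable (lebesgue_on S)"
    and "AE x in lebesgue_on S. (\<lambda>t. u (x, t)) \<in> borel_measurable (lebesgue_on J)"
proof -
  have SJ: "S \<times> J \<in> sets borel" by (rule borel_Times[OF S J])
  obtain u' where u'm: "u' \<in> borel_measurable borel"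
    and u': "AE z in lborel. z \<in> S \<times> J \<longrightarrow> u z = u' z"
    using lebesgue_on_ex_borel_measurable[OF u SJ] by blast
  have u'm: "u' \<in> borel_measurable (borel \<Otimes>\<^sub>M borel)" using u'm by (simp add: borel_prod)
  have "AE t in lborel. t \<in> J \<longrightarrow> (\<lambda>x. u (x, t)) \<in> borel_measurable (lebesgue_on S)"
    using AE_lborel_prod(2)[OF u']
  proof eventually_elim
    case (elim t)
    show ?case
    proof
      assume "t \<in> J"
      with elim have "AE x in lborel. x \<in> S \<longrightarrow> u (x, t) = u' (x, t)"
        by (auto elim!: eventually_mono)
      then show "(\<lambda>x. u (x, t)) \<in> borel_measurable (lebesgue_on S)"
        by (rule lebesgue_on_AE_eq_imp_measurable[OF _ S, rotated]) (use u'm in measurable)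
    qed
  qed
  then show "AE t in lebesgue_on J. (\<lambda>x. u (x, t)) \<in> borel_measurable (lebesgue_on S)"
    using J by (simp add: AE_restrict_space_iff AE_completion_iff)
  have "AE x in lborel. x \<in> S \<longrightarrow> (\<lambda>t. u (x, t)) \<in> borel_measurable (lebesgue_on J)"
    using AE_lborel_prod(1)[OF u']
  proof eventually_elim
    case (elim x)
    show ?case
    proof
      assume "x \<in> S"
      with elim have "AE t in lborel. t \<in> J \<longrightarrow> u (x, t) = u' (x, t)"
        by (auto elim!: eventually_mono)
      then show "(\<lambda>t. u (x, t)) \<in> borel_measurable (lebesgue_on J)"
        by (rule lebesgue_on_AE_eq_imp_measurable[OF _ J, rotated]) (use u'm in measurable)
    qed
  qed
  then show "AE x in lebesgue_on S. (\<lambda>t. u (x, t)) \<in> borel_measurable (lebesgue_on J)"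
    using S by (simp add: AE_restrict_space_iff AE_completion_iff)
qed

lemma L2_slices:
  assumes S: "S \<in> sets borel" and J: "J \<in> sets borel" and u: "u \<in> L2 (S \<times> J)"
  shows "AE t in lebesgue_on J. (\<lambda>x. u (x, t)) \<in> L2 S"
    and "AE x in lebesgue_on S. (\<lambda>t. u (x, t)) \<in> L2 J"
proof -
  note u2 = L2_square_integrable[OF u]
  show "AE t in lebesgue_on J. (\<lambda>x. u (x, t)) \<in> L2 S"
    using lebesgue_on_Times_slice_measurable(1)[OF S J L2_measurable[OF u]]
      lebesgue_on_Fubini(1)[OF S J u2]
    by eventually_elim (simp add: L2_def)
  show "AE x in lebesgue_on S. (\<lambda>t. u (x, t)) \<in> L2 J"
    using lebesgue_on_Times_slice_measurable(2)[OF S J L2_measurable[OF u]]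
      lebesgue_on_Fubini(4)[OF S J u2]
    by eventually_elim (simp add: L2_def)
qed

text \<open>
  A square-integrable field need not be integrable when the spatial domain has infinite measure,
  so the measurability of its time integral cannot come from Fubini's theorem.  It holds for every
  measurable field because the integral of a Borel function over sections is Borel, with value
  zero at sections that are not integrable.
\<close>

lemma lebesgue_on_Times_integral_measurable:
  fixes u :: "'a::euclidean_space \<times> 'b::euclidean_space \<Rightarrow> 'c::euclidean_space"
  assumes S: "S \<in> sets borel" and J: "J \<in> sets borel"
    and u: "u \<in> borel_measurable (lebesgue_on (S \<times> J))"
  shows "(\<lambda>x. LINT t|lebesgue_on J. u (x, t)) \<in> borel_measurable (lebesgue_on S)"
proof -
  have SJ: "S \<times> J \<in> sets borel" by (rule borel_Times[OF S J])
  have J': "J \<in> sets lebesgue" using J by auto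
  obtain u' where u'm: "u' \<in> borel_measurable borel"
    and u': "AE z in lborel. z \<in> S \<times> J \<longrightarrow> u z = u' z"
    using lebesgue_on_ex_borel_measurable[OF u SJ] by blast
  have u'm [measurable]: "u' \<in> borel_measurable (borel \<Otimes>\<^sub>M borel)"
    using u'm by (simp add: borel_prod)
  note [measurable] = J
  define E where "E x = (LINT t|lborel. indicator J t *\<^sub>R u' (x, t))" for x
  have "E \<in> borel_measurable borel" unfolding E_def by measurable
  moreover have "AE x in lborel. x \<in> S \<longrightarrow> (LINT t|lebesgue_on J. u (x, t)) = E x"
    using AE_lborel_prod(1)[OF u']
  proof eventually_elim
    case (elim x)
    show ?case
    proof
      assume "x \<in> S"
      with elim have AE: "AE t in lborel. t \<in> J \<longrightarrow> u (x, t) = u' (x, t)"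
        by (auto elim!: eventually_mono)
      have m': "(\<lambda>t. u' (x, t)) \<in> borel_measurable borel" by measurable
      have "(LINT t|lebesgue_on J. u (x, t)) = (LINT t|lebesgue_on J. u' (x, t))"
      proof (rule integral_cong_AE)
        show "(\<lambda>t. u (x, t)) \<in> borel_measurable (lebesgue_on J)"
          by (rule lebesgue_on_AE_eq_imp_measurable[OF m' J AE])
        show "(\<lambda>t. u' (x, t)) \<in> borel_measurable (lebesgue_on J)"
          using m' by (simp add: measurable_completion measurable_restrict_space1)
        show "AE t in lebesgue_on J. u (x, t) = u' (x, t)"
          using AE J by (simp add: AE_restrict_space_iff AE_completion)
      qed
      also have "\<dots> = (LINT t|lebesgue. indicator J t *\<^sub>R u' (x, t))"
        by (rule integral_restrict_space) (use J' in simp)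
      also have "\<dots> = E x" unfolding E_def
        by (rule integral_completion) measurable
      finally show "(LINT t|lebesgue_on J. u (x, t)) = E x" .
    qed
  qed
  ultimately show ?thesis by (rule lebesgue_on_AE_eq_imp_measurable[OF _ S])
qed

lemma integrable_const_lebesgue_on:
  assumes "J \<in> lmeasurable"
  shows "integrable (lebesgue_on J) (\<lambda>t. c :: 'c::{banach, second_countable_topology})"
proof -
  interpret finite_measure "lebesgue_on J" by (rule finite_measure_lebesgue_on[OF assms])
  show ?thesis by simp
qed

text \<open>
  The pointwise time integral of a field in \<open>L\<^sup>2\<close> serves as its Bochner integral: it lies in
  \<open>L\<^sup>2\<close> by the Cauchy-Schwarz inequality in time, and it may be paired with a spatial field before
  or after integrating.
\<close>

lemma L2_time_integral:
  fixes S :: "vec3 set" and J :: "'b::euclidean_space set"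
  assumes S: "S \<in> sets borel" and J: "J \<in> sets borel" and Jf: "J \<in> lmeasurable"
    and u: "u \<in> L2 (S \<times> J)"
  shows "(\<lambda>x. LINT t|lebesgue_on J. u (x, t)) \<in> L2 S"
    and "\<phi> \<in> L2 S \<Longrightarrow> integrable (lebesgue_on J) (\<lambda>t. inner_H S (\<lambda>x. u (x, t)) \<phi>)"
    and "\<phi> \<in> L2 S \<Longrightarrow> inner_H S (\<lambda>x. LINT t|lebesgue_on J. u (x, t)) \<phi> =
           (LINT t|lebesgue_on J. inner_H S (\<lambda>x. u (x, t)) \<phi>)"
proof -
  define E where "E x = (LINT t|lebesgue_on J. u (x, t))" for x
  define m where "m = (LINT t|lebesgue_on J. (1::real)\<^sup>2)"
  have one: "integrable (lebesgue_on J) (\<lambda>t. (1::real)\<^sup>2)"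
    by (rule integrable_const_lebesgue_on[OF Jf])
  have Em [measurable]: "E \<in> borel_measurable (lebesgue_on S)"
    unfolding E_def by (rule lebesgue_on_Times_integral_measurable[OF S J L2_measurable[OF u]])
  note u2 = L2_square_integrable[OF u]
  have uint: "integrable (lebesgue_on J) v \<and> (norm (integral\<^sup>L (lebesgue_on J) v))\<^sup>2
      \<le> m * (LINT t|lebesgue_on J. (norm (v t))\<^sup>2)" if v: "v \<in> L2 J" for v
  proof -
    have vm [measurable]: "v \<in> borel_measurable (lebesgue_on J)" using v by (simp add: L2_def)
    have "integrable (lebesgue_on J) (\<lambda>t. 1 * norm (v t))"
      by (rule integral_Cauchy_Schwarz(1)) (use one L2_square_integrable[OF v] in auto)
    then have vi: "integrable (lebesgue_on J) v" using vm by (simp add: integrable_norm_iff)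
    have "(norm (integral\<^sup>L (lebesgue_on J) v))\<^sup>2 \<le> (LINT t|lebesgue_on J. 1 * norm (v t))\<^sup>2"
      by (rule power_mono) (use vi in \<open>auto\<close>)
    also have "\<dots> \<le> m * (LINT t|lebesgue_on J. (norm (v t))\<^sup>2)"
      unfolding m_def
      by (rule integral_Cauchy_Schwarz(2)) (use one L2_square_integrable[OF v] in auto)
    finally show ?thesis using vi by blast
  qed
  have "integrable (lebesgue_on S) (\<lambda>x. (norm (E x))\<^sup>2)"
  proof (rule Bochner_Integration.integrable_bound)
    show "integrable (lebesgue_on S) (\<lambda>x. m * (LINT t|lebesgue_on J. (norm (u (x, t)))\<^sup>2))"
      using lebesgue_on_Fubini(5)[OF S J u2] by simp
    show "AE x in lebesgue_on S. norm ((norm (E x))\<^sup>2)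
        \<le> norm (m * (LINT t|lebesgue_on J. (norm (u (x, t)))\<^sup>2))"
      using L2_slices(2)[OF S J u]
    proof eventually_elim
      case (elim x)
      then show ?case using uint[OF elim] by (auto simp: E_def intro: order_trans[OF _ abs_ge_self])
    qed
  qed measurable
  then show "(\<lambda>x. LINT t|lebesgue_on J. u (x, t)) \<in> L2 S"
    using Em unfolding L2_def E_def by simp
  {
    assume \<phi>: "\<phi> \<in> L2 S"
    have "(\<lambda>z. 1 *\<^sub>R \<phi> (fst z)) \<in> L2 (S \<times> J)"
      by (rule L2_product[OF S J \<phi>]) (use one in auto)
    then have I: "integrable (lebesgue_on (S \<times> J)) (\<lambda>z. u z \<bullet> \<phi> (fst z))"
      by (intro L2_inner_integrable[OF u]) simp
    show "integrable (lebesgue_on J) (\<lambda>t. inner_H S (\<lambda>x. u (x, t)) \<phi>)"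
      using lebesgue_on_Fubini(2)[OF S J I] by (simp add: inner_H_def)
    have "inner_H S E \<phi> = (LINT x|lebesgue_on S. LINT t|lebesgue_on J. u (x, t) \<bullet> \<phi> x)"
      unfolding inner_H_def
    proof (rule integral_cong_AE)
      show "(\<lambda>x. E x \<bullet> \<phi> x) \<in> borel_measurable (lebesgue_on S)"
        using L2_measurable[OF \<phi>] by measurable
      show "(\<lambda>x. LINT t|lebesgue_on J. u (x, t) \<bullet> \<phi> x) \<in> borel_measurable (lebesgue_on S)"
        using lebesgue_on_Fubini(5)[OF S J I] by auto
      show "AE x in lebesgue_on S. E x \<bullet> \<phi> x = (LINT t|lebesgue_on J. u (x, t) \<bullet> \<phi> x)"
        using L2_slices(2)[OF S J u]
        by eventually_elim (use uint in \<open>simp add: E_def\<close>)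
    qed
    also have "\<dots> = (LINT t|lebesgue_on J. inner_H S (\<lambda>x. u (x, t)) \<phi>)"
      using lebesgue_on_Fubini(3,6)[OF S J I] by (simp add: inner_H_def)
    finally show "inner_H S (\<lambda>x. LINT t|lebesgue_on J. u (x, t)) \<phi> =
           (LINT t|lebesgue_on J. inner_H S (\<lambda>x. u (x, t)) \<phi>)"
      unfolding E_def .
  }
qed

section \<open>Smooth functions supported in a box\<close>

text \<open>
  The functions \<open>exp (- c / t) / t\<^sup>k\<close> for \<open>t > 0\<close>, extended by zero.  The powers of \<open>1 / t\<close> are there to
  make the linear span of the family closed under differentiation.
\<close>

definition flat :: "real \<Rightarrow> nat \<Rightarrow> real \<Rightarrow> real" where
  "flat c k t = (if 0 < t then exp (- c / t) / t ^ k else 0)"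

lemma flat_tendsto_0:
  assumes c: "0 < c"
  shows "(flat c k \<longlongrightarrow> 0) (at 0)"
proof (rule filterlim_split_at)
  show "(flat c k \<longlongrightarrow> 0) (at_left 0)"
    by (rule tendsto_eventually)
       (auto simp: flat_def eventually_at_filter)
  have "((\<lambda>x. (x ^ k / exp x) / c ^ k) \<longlongrightarrow> 0 / c ^ k) at_top"
    by (intro tendsto_intros tendsto_power_div_exp_0) (use c in auto)
  moreover have "filterlim (\<lambda>t. c * inverse t) at_top (at_right 0)"
    using filterlim_inverse_at_top_right c
    by (intro filterlim_tendsto_pos_mult_at_top[OF tendsto_const]) auto
  ultimately have "((\<lambda>t. ((c * inverse t) ^ k / exp (c * inverse t)) / c ^ k) \<longlongrightarrow> 0) (at_right 0)"
    using filterlim_compose by fastforce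
  then show "(flat c k \<longlongrightarrow> 0) (at_right 0)"
  proof (rule Lim_transform_eventually)
    show "\<forall>\<^sub>F t in at_right 0. (c * inverse t) ^ k / exp (c * inverse t) / c ^ k = flat c k t"
      unfolding eventually_at_filter
      by (rule always_eventually) (use c in \<open>auto simp: flat_def exp_minus field_simps\<close>)
  qed
qed

text \<open>
  At \<open>t = 0\<close> the difference quotient of \<open>flat c k\<close> is \<open>flat c (k + 1)\<close>, which tends to zero.
\<close>

lemma flat_has_real_derivative:
  assumes c: "0 < c"
  shows "(flat c k has_real_derivative c * flat c (k + 2) t - real k * flat c (k + 1) t) (at t)"
proof (cases t "0 :: real" rule: linorder_cases)
  case less
  have "((\<lambda>t. 0) has_real_derivative 0) (at t)" by simp
  then have "(flat c k has_real_derivative 0) (at t)"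
    by (rule DERIV_cong_ev[THEN iffD1, rotated -1, OF _ refl _ refl])
       (use less in \<open>auto simp: flat_def intro!: eventually_mono[OF eventually_nhds_in_open[of "{..<0}"]]\<close>)
  then show ?thesis using less by (simp add: flat_def)
next
  case equal
  have "((\<lambda>h. (flat c k (0 + h) - flat c k 0) / h) \<longlongrightarrow> 0) (at 0)"
    using flat_tendsto_0[OF c, of "Suc k"]
  proof (rule Lim_transform_eventually)
    show "\<forall>\<^sub>F h in at 0. flat c (Suc k) h = (flat c k (0 + h) - flat c k 0) / h"
      by (rule always_eventually) (auto simp: flat_def)
  qed
  then have "(flat c k has_real_derivative 0) (at 0)" by (simp add: DERIV_def)
  then show ?thesis using equal by (simp add: flat_def)
next
  case greater
  have "((\<lambda>t. exp (- c / t) / t ^ k) has_real_derivative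
      c * (exp (- c / t) / t ^ (k + 2)) - real k * (exp (- c / t) / t ^ (k + 1))) (at t)"
  proof -
    have 1: "((\<lambda>t. exp (- c / t)) has_real_derivative exp (- c / t) * (c / t\<^sup>2)) (at t)"
      by (auto intro!: derivative_eq_intros simp: greater less_imp_neq[OF greater, symmetric] power2_eq_square)
    have 2: "((\<lambda>t. t ^ k) has_real_derivative real k * t ^ (k - 1)) (at t)"
      using DERIV_pow[of k t UNIV] by simp
    have "((\<lambda>t. exp (- c / t) / t ^ k) has_real_derivative
        (exp (- c / t) * (c / t\<^sup>2) * t ^ k - exp (- c / t) * (real k * t ^ (k - 1))) / (t ^ k * t ^ k)) (at t)"
      by (rule DERIV_divide[OF 1 2]) (use greater in auto)
    also have "(exp (- c / t) * (c / t\<^sup>2) * t ^ k - exp (- c / t) * (real k * t ^ (k - 1))) / (t ^ k * t ^ k)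
        = c * (exp (- c / t) / t ^ (k + 2)) - real k * (exp (- c / t) / t ^ (k + 1))"
      using greater by (cases k) (simp_all add: field_simps power2_eq_square)
    finally show ?thesis .
  qed
  then have "(flat c k has_real_derivative
      c * (exp (- c / t) / t ^ (k + 2)) - real k * (exp (- c / t) / t ^ (k + 1))) (at t)"
    by (rule DERIV_cong_ev[THEN iffD1, rotated -1, OF _ refl _ refl])
       (use greater in \<open>auto simp: flat_def intro!: eventually_mono[OF eventually_nhds_in_open[of "{0<..}"]]\<close>)
  then show ?thesis using greater by (simp add: flat_def)
qed

text \<open>
  An algebra of functions that contains the directional derivatives of its members.  Smoothness of
  all members then needs one induction, and no formula for higher derivatives.
\<close>

inductive flat_polynomial :: "('a::euclidean_space \<Rightarrow> real) \<Rightarrow> bool" where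
  const: "flat_polynomial (\<lambda>x. r)"
| flat: "0 < c \<Longrightarrow> flat_polynomial (\<lambda>x. flat c k (x \<bullet> v + a))"
| add: "flat_polynomial f \<Longrightarrow> flat_polynomial g \<Longrightarrow> flat_polynomial (\<lambda>x. f x + g x)"
| mult: "flat_polynomial f \<Longrightarrow> flat_polynomial g \<Longrightarrow> flat_polynomial (\<lambda>x. f x * g x)"

lemma flat_polynomial_prod:
  "finite I \<Longrightarrow> (\<And>i. i \<in> I \<Longrightarrow> flat_polynomial (f i)) \<Longrightarrow> flat_polynomial (\<lambda>x. \<Prod>i\<in>I. f i x)"
  by (induction rule: finite_induct) (auto intro: flat_polynomial.intros)

lemma flat_polynomial_derivative:
  assumes "flat_polynomial f"
  shows "\<exists>f'. (\<forall>x. (f has_derivative f' x) (at x)) \<and> (\<forall>v. flat_polynomial (\<lambda>x. f' x v))"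
  using assms
proof induction
  case (const r)
  show ?case by (rule exI[of _ "\<lambda>x v. 0"]) (auto intro: flat_polynomial.const)
next
  case (flat c k w a)
  define f' where "f' x v = (c * flat c (k + 2) (x \<bullet> w + a) + (- real k) * flat c (k + 1) (x \<bullet> w + a)) * (v \<bullet> w)"
    for x v :: 'a
  have "((\<lambda>x. flat c k (x \<bullet> w + a)) has_derivative f' x) (at x)" for x
  proof -
    have 1: "((\<lambda>x. x \<bullet> w + a) has_derivative (\<lambda>v. v \<bullet> w)) (at x)"
      by (auto intro!: derivative_eq_intros)
    have 2: "(flat c k has_derivative
        (*) (c * flat c (k + 2) (x \<bullet> w + a) - real k * flat c (k + 1) (x \<bullet> w + a))) (at (x \<bullet> w + a))"
      using flat_has_real_derivative[OF flat, of k "x \<bullet> w + a"] by (simp add: has_field_derivative_def)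
    show ?thesis
      using has_derivative_compose[OF 1 2] by (simp add: f'_def[abs_def])
  qed
  moreover have "flat_polynomial (\<lambda>x. f' x v)" for v
    unfolding f'_def by (intro flat_polynomial.intros flat)
  ultimately show ?case by blast
next
  case (add f g)
  then obtain f' g' where
    "\<And>x. (f has_derivative f' x) (at x)" "\<And>v. flat_polynomial (\<lambda>x. f' x v)"
    "\<And>x. (g has_derivative g' x) (at x)" "\<And>v. flat_polynomial (\<lambda>x. g' x v)" by blast
  then show ?case
    by (intro exI[of _ "\<lambda>x v. f' x v + g' x v"])
       (auto intro: has_derivative_add flat_polynomial.intros)
next
  case (mult f g)
  then obtain f' g' where
    "\<And>x. (f has_derivative f' x) (at x)" "\<And>v. flat_polynomial (\<lambda>x. f' x v)"
    "\<And>x. (g has_derivative g' x) (at x)" "\<And>v. flat_polynomial (\<lambda>x. g' x v)" by blast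
  with mult show ?case
    by (intro exI[of _ "\<lambda>x v. f x * g' x v + f' x v * g x"])
       (auto intro!: has_derivative_mult flat_polynomial.add flat_polynomial.mult)
qed

lemma flat_polynomial_Ck:
  assumes "flat_polynomial f"
  shows "Ck n (\<lambda>x. f x *\<^sub>R w)"
  using assms
proof (induction n arbitrary: f)
  case 0
  obtain f' where "\<And>x. (f has_derivative f' x) (at x)"
    using flat_polynomial_derivative[OF 0] by blast
  then have "continuous_on UNIV f"
    by (meson continuous_at_imp_continuous_on has_derivative_continuous)
  then show ?case by (auto intro!: continuous_intros)
next
  case (Suc n)
  obtain f' where f': "\<And>x. (f has_derivative f' x) (at x)" and f'p: "\<And>v. flat_polynomial (\<lambda>x. f' x v)"
    using flat_polynomial_derivative[OF Suc.prems] by blast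
  have D: "((\<lambda>x. f x *\<^sub>R w) has_derivative (\<lambda>v. f' x v *\<^sub>R w)) (at x)" for x
    using has_derivative_scaleR_left[OF f'] .
  then have "(\<lambda>x. f x *\<^sub>R w) differentiable_on UNIV"
    by (auto simp: differentiable_on_def differentiable_def intro: has_derivative_at_withinI)
  moreover have "frechet_derivative (\<lambda>x. f x *\<^sub>R w) (at x) v = f' x v *\<^sub>R w" for x v
    using frechet_derivative_at[OF D] by metis
  ultimately show ?case using Suc.IH[OF f'p] by simp
qed

text \<open>
  Since \<open>exp (- 1 / (n t))\<close> tends to 1 for every \<open>t > 0\<close>, these smooth functions tend boundedly to
  the indicator of the open box as \<open>n\<close> grows.
\<close>

definition box_bump :: "nat \<Rightarrow> 'a::euclidean_space \<Rightarrow> 'a \<Rightarrow> 'a \<Rightarrow> real" where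
  "box_bump n a b x =
     (\<Prod>i\<in>Basis. flat (1 / Suc n) 0 (x \<bullet> i - a \<bullet> i) * flat (1 / Suc n) 0 (b \<bullet> i - x \<bullet> i))"

lemma flat_0_bounds: "0 < c \<Longrightarrow> 0 \<le> flat c 0 t" "0 < c \<Longrightarrow> flat c 0 t \<le> 1"
  by (auto simp: flat_def)

lemma box_bump_bounds: "0 \<le> box_bump n a b x" "box_bump n a b x \<le> 1"
  unfolding box_bump_def
  by (auto intro!: prod_nonneg prod_le_1 mult_nonneg_nonneg mult_le_one flat_0_bounds)

lemma box_bump_eq_0: "box_bump n a b x = 0 \<longleftrightarrow> x \<notin> box a b"
  by (auto simp: box_bump_def flat_def mem_box)

lemma box_bump_tendsto: "(\<lambda>n. box_bump n a b x) \<longlonglongrightarrow> indicator (box a b) x"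
proof (cases "x \<in> box a b")
  case True
  have "(\<lambda>n. flat (1 / Suc n) 0 t) \<longlonglongrightarrow> 1" if "0 < t" for t
  proof -
    have "(\<lambda>n. exp (- (1 / real (Suc n)) / t)) \<longlonglongrightarrow> exp (- 0 / t)"
      by (intro tendsto_intros LIMSEQ_Suc lim_1_over_n) (use that in auto)
    then show ?thesis using that by (simp add: flat_def)
  qed
  then have "(\<lambda>n. box_bump n a b x) \<longlonglongrightarrow> (\<Prod>i\<in>(Basis :: 'a set). 1 * 1)"
    unfolding box_bump_def using True by (intro tendsto_intros) (auto simp: mem_box)
  then show ?thesis using True by simp
next
  case False
  then show ?thesis by (simp add: box_bump_eq_0[THEN iffD2])
qed

lemma box_bump_test_function:
  assumes "cbox a b \<subseteq> S"
  shows "(\<lambda>x. box_bump n a b x *\<^sub>R w) \<in> test_functions S"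
proof -
  have "flat_polynomial (box_bump n a b)"
  proof -
    have "flat_polynomial (\<lambda>x. flat (1 / Suc n) 0 (x \<bullet> i + (- (a \<bullet> i))) * flat (1 / Suc n) 0 (x \<bullet> (- i) + b \<bullet> i))"
      for i by (intro flat_polynomial.intros) auto
    then have "flat_polynomial (\<lambda>x. \<Prod>i\<in>Basis. flat (1 / Suc n) 0 (x \<bullet> i + (- (a \<bullet> i))) * flat (1 / Suc n) 0 (x \<bullet> (- i) + b \<bullet> i))"
      by (intro flat_polynomial_prod) auto
    then show ?thesis by (simp add: box_bump_def[abs_def])
  qed
  then have "Ck k (\<lambda>x. box_bump n a b x *\<^sub>R w)" for k by (rule flat_polynomial_Ck)
  moreover have "{x. box_bump n a b x *\<^sub>R w \<noteq> 0} \<subseteq> cbox a b"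
    using box_bump_eq_0[of n a b] box_subset_cbox[of a b] by auto
  then have "closure {x. box_bump n a b x *\<^sub>R w \<noteq> 0} \<subseteq> cbox a b"
    by (rule closure_minimal) (rule closed_cbox)
  moreover from this have "compact (closure {x. box_bump n a b x *\<^sub>R w \<noteq> 0})"
    by (metis bounded_cbox bounded_subset closed_closure compact_eq_bounded_closed)
  ultimately show ?thesis using assms by (auto simp: test_functions_def)
qed

section \<open>The fundamental lemma of the calculus of variations\<close>

text \<open>
  Boxes generate the Borel sets and are closed under intersection, so by Dynkin's theorem the
  integral vanishes over every Borel set, in particular over the sets where \<open>g\<close> is positive and
  where it is negative.
\<close>

lemma AE_zero_if_box_integrals_zero:
  fixes g :: "'a::euclidean_space \<Rightarrow> real"
  assumes g: "integrable lborel g" and zero: "\<And>a b. (LINT x|lborel. indicator (box a b) x * g x) = 0"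
  shows "AE x in lborel. g x = 0"
proof -
  have gi: "integrable lborel (\<lambda>x. indicator A x * g x)" if "A \<in> sets borel" for A
    using integrable_mult_indicator[of A lborel g] g that by simp
  have whole: "(LINT x|lborel. g x) = 0"
  proof -
    have "(\<lambda>n. LINT x|lborel. indicator (box (- real n *\<^sub>R One) (real n *\<^sub>R One)) x * g x) \<longlonglongrightarrow> (LINT x|lborel. g x)"
    proof (rule integral_dominated_convergence[where w = "\<lambda>x. norm (g x)"])
      show "AE x in lborel. (\<lambda>n. indicator (box (- real n *\<^sub>R One) (real n *\<^sub>R One)) x * g x) \<longlonglongrightarrow> g x"
      proof (rule AE_I2)
        fix x :: 'a
        obtain N :: nat where N: "norm x < real N" using reals_Archimedean2 by blast
        have inb: "x \<in> box (- real n *\<^sub>R One) (real n *\<^sub>R One)" if "n \<ge> N" for n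
          unfolding mem_box
        proof
          fix i :: 'a assume i: "i \<in> Basis"
          have "\<bar>x \<bullet> i\<bar> < real n" using Basis_le_norm[OF i, of x] N that by linarith
          then show "- real n *\<^sub>R One \<bullet> i < x \<bullet> i \<and> x \<bullet> i < real n *\<^sub>R One \<bullet> i"
            using i by auto
        qed
        have "\<forall>\<^sub>F n in sequentially. indicator (box (- real n *\<^sub>R One) (real n *\<^sub>R One)) x * g x = g x"
          using inb by (intro eventually_sequentiallyI[of N]) (simp only: indicator_simps mult_1)
        then show "(\<lambda>n. indicator (box (- real n *\<^sub>R One) (real n *\<^sub>R One)) x * g x) \<longlonglongrightarrow> g x"
          by (rule tendsto_eventually)
      qed
    qed (use g gi in \<open>auto simp: indicator_def\<close>)
    then show ?thesis using zero by (simp add: LIMSEQ_const_iff)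
  qed
  have all: "(LINT x|lborel. indicator A x * g x) = 0" if A: "A \<in> sets borel" for A
  proof -
    have Int: "Int_stable (range (\<lambda>(a, b). box a b :: 'a set))"
      by (auto simp: Int_stable_def box_Int_box)
    have "A \<in> sigma_sets UNIV (range (\<lambda>(a, b). box a b))"
      using A by (simp add: borel_eq_box)
    note sig = this
    have "range (\<lambda>(a, b). box a b :: 'a set) \<subseteq> Pow UNIV" by simp
    from Int this sig show ?thesis
    proof (induction rule: sigma_sets_induct_disjoint)
      case (basic A)
      then show ?case using zero by auto
    next
      case empty
      then show ?case by simp
    next
      case (compl A)
      then have "A \<in> sets borel" by (simp add: borel_eq_box)
      have "(\<lambda>x. indicator (UNIV - A) x * g x) = (\<lambda>x. g x - indicator A x * g x)"
        by (auto simp: indicator_def)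
      then show ?case using compl(2) whole g gi[OF \<open>A \<in> sets borel\<close>] by simp
    next
      case (union A)
      then have A: "A i \<in> sets borel" for i by (auto simp: borel_eq_box)
      have "(LINT x:(\<Union>i. A i)|lborel. g x) = (\<Sum>i. (LINT x:(A i)|lborel. g x))"
      proof (rule lebesgue_integral_countable_add)
        show "set_integrable lborel (\<Union>i. A i) g"
          using gi[of "\<Union>i. A i"] A by (auto simp: set_integrable_def)
      qed (use A union in \<open>auto simp: disjoint_family_on_def\<close>)
      then show ?case using union by (simp add: set_lebesgue_integral_def)
    qed
  qed
  have gm [measurable]: "g \<in> borel_measurable borel" using g by auto
  have half: "AE x in lborel. \<not> 0 < s * g x" for s
  proof -
    let ?A = "{x. 0 < s * g x}"
    have A: "?A \<in> sets borel" by measurable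
    have "(LINT x|lborel. s * (indicator ?A x * g x)) = 0" using all[OF A] by simp
    moreover have "integrable lborel (\<lambda>x. s * (indicator ?A x * g x))" using gi[OF A] by simp
    moreover have "AE x in lborel. 0 \<le> s * (indicator ?A x * g x)" by (auto simp: indicator_def)
    ultimately have "AE x in lborel. s * (indicator ?A x * g x) = 0"
      using integral_nonneg_eq_0_iff_AE by blast
    then show ?thesis by eventually_elim (auto simp: indicator_def)
  qed
  show ?thesis using half[of 1] half[of "-1"] by eventually_elim auto
qed

lemma L2_indicator:
  fixes A :: "'a::euclidean_space set"
  assumes "A \<in> sets borel" "A \<in> lmeasurable" "S \<in> sets borel"
  shows "(\<lambda>x. indicator A x *\<^sub>R w) \<in> L2 S"
proof -
  have m: "(\<lambda>x. indicat_real A x *\<^sub>R w) \<in> borel_measurable (lebesgue_on S)"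
    by (intro measurable_restrict_space1 measurable_completion) (use assms in measurable)
  have "integrable lebesgue (\<lambda>x. indicat_real A x * (norm w)\<^sup>2)"
    using assms by (intro integrable_mult_left) (auto simp: fmeasurable_def)
  then have "integrable lebesgue (\<lambda>x. indicat_real S x *\<^sub>R (indicat_real A x * (norm w)\<^sup>2))"
    using assms by (intro integrable_mult_indicator) auto
  then have "integrable (lebesgue_on S) (\<lambda>x. indicat_real A x * (norm w)\<^sup>2)"
    using assms by (subst integrable_restrict_space) auto
  moreover have "(\<lambda>x. (norm (indicat_real A x *\<^sub>R w))\<^sup>2) = (\<lambda>x. indicat_real A x * (norm w)\<^sup>2)"
    by (auto simp: indicator_def)
  ultimately show ?thesis using m by (simp add: L2_def)
qed

text \<open>
  For a closed box inside \<open>\<Omega>\<close> the bumps multiplied by a constant vector are test functions, so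
  the integral of every component of \<open>F\<close> over the box is a limit of zeros.  Countably many such boxes
  cover \<open>\<Omega>\<close>.
\<close>

lemma fundamental_lemma_calculus_of_variations:
  assumes \<Omega>: "open \<Omega>" and F: "F \<in> L2 \<Omega>"
    and orth: "\<And>\<phi>. \<phi> \<in> test_functions \<Omega> \<Longrightarrow> inner_H \<Omega> F \<phi> = 0"
  shows "AE x in lebesgue_on \<Omega>. F x = 0"
proof -
  have \<Omega>b: "\<Omega> \<in> sets borel" using \<Omega> by simp
  have \<Omega>': "\<Omega> \<in> sets lebesgue" using \<Omega>b by simp
  have box_L2: "(\<lambda>x. indicator (box a b) x *\<^sub>R w) \<in> L2 \<Omega>" for a b w
    by (rule L2_indicator) (auto simp: \<Omega>b)
  have box0: "(LINT x|lebesgue_on \<Omega>. indicator (box a b) x * (F x \<bullet> w)) = 0"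
    if ab: "cbox a b \<subseteq> \<Omega>" for a b w
  proof -
    note [measurable] = L2_measurable[OF F]
    have "(\<lambda>n. LINT x|lebesgue_on \<Omega>. F x \<bullet> (box_bump n a b x *\<^sub>R w)) \<longlonglongrightarrow>
        (LINT x|lebesgue_on \<Omega>. indicator (box a b) x * (F x \<bullet> w))"
    proof (rule integral_dominated_convergence[where
          w = "\<lambda>x. \<bar>F x \<bullet> (indicator (box a b) x *\<^sub>R w)\<bar>"])
      show "integrable (lebesgue_on \<Omega>) (\<lambda>x. \<bar>F x \<bullet> (indicator (box a b) x *\<^sub>R w)\<bar>)"
        by (intro integrable_abs L2_inner_integrable F box_L2)
      have "(\<lambda>x. F x \<bullet> (indicat_real (box a b) x *\<^sub>R w)) \<in> borel_measurable (lebesgue_on \<Omega>)"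
        using L2_inner_integrable[OF F box_L2[of a b w]] by auto
      then show "(\<lambda>x. indicator (box a b) x * (F x \<bullet> w)) \<in> borel_measurable (lebesgue_on \<Omega>)"
        by simp
      show "(\<lambda>x. F x \<bullet> (box_bump n a b x *\<^sub>R w)) \<in> borel_measurable (lebesgue_on \<Omega>)" for n
      proof -
        have "(\<lambda>x. box_bump n a b x *\<^sub>R w) \<in> borel_measurable (lebesgue_on \<Omega>)"
        proof -
          have "Ck 0 (\<lambda>x. box_bump n a b x *\<^sub>R w)"
            using box_bump_test_function[OF ab, of n w] by (simp add: test_functions_def del: Ck.simps)
          then have "(\<lambda>x. box_bump n a b x *\<^sub>R w) \<in> borel_measurable borel"
            by (simp add: borel_measurable_continuous_onI)
          then show ?thesis by (intro measurable_restrict_space1 measurable_completion) simp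
        qed
        then show ?thesis by measurable
      qed
      show "AE x in lebesgue_on \<Omega>. (\<lambda>n. F x \<bullet> (box_bump n a b x *\<^sub>R w)) \<longlonglongrightarrow> indicator (box a b) x * (F x \<bullet> w)"
        by (rule AE_I2) (auto intro!: tendsto_intros box_bump_tendsto)
      show "AE x in lebesgue_on \<Omega>. norm (F x \<bullet> (box_bump n a b x *\<^sub>R w)) \<le> \<bar>F x \<bullet> (indicator (box a b) x *\<^sub>R w)\<bar>" for n
      proof (rule AE_I2)
        fix x
        show "norm (F x \<bullet> (box_bump n a b x *\<^sub>R w)) \<le> \<bar>F x \<bullet> (indicator (box a b) x *\<^sub>R w)\<bar>"
          using box_bump_bounds[of n a b x] box_bump_eq_0[of n a b x]
          by (cases "x \<in> box a b") (auto simp: abs_mult mult_left_le_one_le)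
      qed
    qed
    moreover have "(LINT x|lebesgue_on \<Omega>. F x \<bullet> (box_bump n a b x *\<^sub>R w)) = 0" for n
      using orth[OF box_bump_test_function[OF ab, of n w]] by (simp add: inner_H_def)
    ultimately show ?thesis by (simp add: LIMSEQ_const_iff)
  qed
  have local0: "AE x in lborel. x \<in> cbox a b \<longrightarrow> F x \<bullet> w = 0" if ab: "cbox a b \<subseteq> \<Omega>" for a b w
  proof -
    define f where "f x = (if x \<in> \<Omega> then indicator (box a b) x * (F x \<bullet> w) else 0)" for x
    have "integrable (lebesgue_on \<Omega>) (\<lambda>x. indicator (box a b) x * (F x \<bullet> w))"
      using L2_inner_integrable[OF F box_L2[of a b w]] by simp
    then have f: "integrable lebesgue f"
      unfolding f_def using \<Omega>' by (simp add: Lebesgue_Measure.integrable_restrict_UNIV)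
    obtain g where gm [measurable]: "g \<in> borel_measurable borel" and g: "integrable lborel g"
      and fg: "AE x in lborel. f x = g x"
      using integrable_lebesgue_ex_lborel[OF f] by blast
    have "AE x in lborel. g x = 0"
    proof (rule AE_zero_if_box_integrals_zero[OF g])
      fix c d :: vec3
      obtain p q where pq: "box a b \<inter> box c d = box p q" using box_Int_box by blast
      have I: "integrable lborel (\<lambda>x. indicator (box c d) x * g x)"
        using integrable_mult_indicator[of "box c d" lborel g] g by simp
      have "(LINT x|lborel. indicator (box c d) x * g x) = (LINT x|lebesgue. indicator (box c d) x * f x)"
        by (rule integrable_lebesgue_cong_AE(2)[OF I, symmetric])
           (use fg in \<open>auto elim!: eventually_mono\<close>)
      also have "(\<lambda>x. indicator (box c d) x * f x) =
          (\<lambda>x. if x \<in> \<Omega> then indicator (box p q) x * (F x \<bullet> w) else 0)"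
        unfolding pq[symmetric] by (auto simp: f_def indicator_def)
      also have "(LINT x|lebesgue. (if x \<in> \<Omega> then indicator (box p q) x * (F x \<bullet> w) else 0)) =
          (LINT x|lebesgue_on \<Omega>. indicator (box p q) x * (F x \<bullet> w))"
        by (rule Lebesgue_Measure.integral_restrict_UNIV[OF \<Omega>'])
      also have "\<dots> = 0"
      proof (cases "box p q = {}")
        case False
        have "box p q \<subseteq> cbox a b" using pq box_subset_cbox[of a b] by blast
        then have "closure (box p q) \<subseteq> cbox a b" by (rule closure_minimal) (rule closed_cbox)
        then have "cbox p q \<subseteq> \<Omega>" using False ab by (simp add: closure_box)
        then show ?thesis by (rule box0)
      qed simp
      finally show "(LINT x|lborel. indicator (box c d) x * g x) = 0" .
    qed
    moreover have "AE x in lborel. x \<notin> cbox a b - box a b"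
    proof -
      have "cbox a b - box a b \<in> null_sets lebesgue"
        using negligible_frontier_interval[of a b] by (simp add: negligible_iff_null_sets)
      then have "AE x in lebesgue. x \<notin> cbox a b - box a b" by (rule AE_not_in)
      then show ?thesis by (simp add: AE_completion_iff)
    qed
    ultimately show ?thesis using fg
      by eventually_elim (use ab in \<open>auto simp: f_def indicator_def split: if_splits\<close>)
  qed
  obtain \<D> where D: "countable \<D>" "\<D> \<subseteq> Pow \<Omega>" "\<And>X. X \<in> \<D> \<Longrightarrow> \<exists>a b. X = cbox a b" "\<Union>\<D> = \<Omega>"
    using open_countable_Union_open_cbox[OF \<Omega>] by metis
  have "AE x in lborel. \<forall>X\<in>\<D>. \<forall>w\<in>Basis. x \<in> X \<longrightarrow> F x \<bullet> w = 0"
  proof (subst AE_ball_countable[OF D(1)], intro ballI)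
    fix X assume X: "X \<in> \<D>"
    then obtain a b where Xab: "X = cbox a b" using D(3) by blast
    then have "cbox a b \<subseteq> \<Omega>" using X D(2) by auto
    then show "AE x in lborel. \<forall>w\<in>Basis. x \<in> X \<longrightarrow> F x \<bullet> w = 0"
      unfolding Xab by (subst AE_ball_countable) (auto intro: local0 countable_finite)
  qed
  then have "AE x in lborel. x \<in> \<Omega> \<longrightarrow> F x = 0"
  proof eventually_elim
    case (elim x)
    show ?case
    proof
      assume "x \<in> \<Omega>"
      then obtain X where "X \<in> \<D>" "x \<in> X" using D(4) by blast
      then have "\<forall>w\<in>Basis. F x \<bullet> w = 0" using elim by blast
      then show "F x = 0" by (simp add: euclidean_all_zero_iff)
    qed
  qed
  then show ?thesis using \<Omega>' by (simp add: AE_restrict_space_iff AE_completion_iff)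
qed

section \<open>Integration by parts for the curl\<close>

lemma continuous_compact_support_L2:
  fixes f :: "'a::euclidean_space \<Rightarrow> vec3"
  assumes f: "continuous_on UNIV f" and K: "compact K" and f0: "\<And>x. x \<notin> K \<Longrightarrow> f x = 0"
    and S: "S \<in> sets borel"
  shows "f \<in> L2 S"
proof -
  have "bounded (f ` K)"
    using K f by (meson compact_continuous_image compact_imp_bounded continuous_on_subset subset_UNIV)
  then obtain B where B: "\<And>x. x \<in> K \<Longrightarrow> norm (f x) \<le> B" by (auto simp: bounded_iff)
  have "(\<lambda>x. indicator K x *\<^sub>R axis (1::3) (1::real)) \<in> L2 S"
    by (rule L2_indicator) (use K S in \<open>auto simp: lmeasurable_compact borel_compact\<close>)
  then show ?thesis
  proof (rule L2_dominated)
    show "f \<in> borel_measurable (lebesgue_on S)"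
      by (intro measurable_restrict_space1 measurable_completion) (use f in \<open>simp add: borel_measurable_continuous_onI\<close>)
    show "AE x in lebesgue_on S. norm (f x) \<le> B * norm (indicator K x *\<^sub>R axis (1::3) (1::real))"
      by (rule AE_I2) (use B f0 in \<open>auto simp: indicator_def\<close>)
  qed
qed

text \<open>
  By translation invariance \<open>\<integral> g (x + t v) dx\<close> does not depend on \<open>t\<close>; the claim is that its
  derivative at \<open>t = 0\<close> is zero.
\<close>

lemma integral_directional_derivative_zero:
  fixes g :: "'a::euclidean_space \<Rightarrow> real"
  assumes g: "\<And>x. (g has_derivative g' x) (at x)" and g'c: "continuous_on UNIV (\<lambda>x. g' x v)"
    and K: "compact K" and g0: "\<And>x. x \<notin> K \<Longrightarrow> g x = 0" "\<And>x. x \<notin> K \<Longrightarrow> g' x v = 0"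
  shows "integrable lborel (\<lambda>x. g' x v)" and "(LINT x|lborel. g' x v) = 0"
proof -
  have gc: "continuous_on UNIV g"
    by (meson g continuous_at_imp_continuous_on has_derivative_continuous)
  have int: "integrable lborel h" if "continuous_on UNIV h" "\<And>x. x \<notin> C \<Longrightarrow> h x = 0" "compact C"
    for h :: "'a \<Rightarrow> real" and C
  proof -
    have "integrable lborel (\<lambda>x. indicator C x *\<^sub>R h x)"
      using that by (intro borel_integrable_compact) (auto intro: continuous_on_subset)
    moreover have "(\<lambda>x. indicator C x *\<^sub>R h x) = h" using that(2) by (force simp: indicator_def)
    ultimately show ?thesis by simp
  qed
  show g'i: "integrable lborel (\<lambda>x. g' x v)" by (rule int[OF g'c g0(2) K])
  obtain R where R: "\<And>x. x \<in> K \<Longrightarrow> norm x \<le> R"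
    using compact_imp_bounded[OF K] by (auto simp: bounded_iff)
  \<comment> \<open>A box that contains the support of all translates with \<open>\<bar>t\<bar> \<le> 1\<close>.\<close>
  obtain a where a: "cball 0 (R + norm v) \<subseteq> cbox (- a) (a :: 'a)"
    using bounded_subset_cbox_symmetric[OF bounded_cball] by metis
  have out: "x + t *\<^sub>R v \<notin> K" if x: "x \<notin> cbox (- a) a" and t: "t \<in> {-1..1}" for x t
  proof
    assume "x + t *\<^sub>R v \<in> K"
    then have "norm (x + t *\<^sub>R v) \<le> R" by (rule R)
    moreover have "norm x \<le> norm (x + t *\<^sub>R v) + norm (t *\<^sub>R v)"
      by (metis add_diff_cancel_right' norm_triangle_ineq4)
    moreover have "norm (t *\<^sub>R v) \<le> norm v" using t by (simp add: mult_left_le_one_le abs_le_iff)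
    ultimately have "x \<in> cball 0 (R + norm v)" unfolding mem_cball_0 by linarith
    then show False using a x by blast
  qed
  have box: "integral (cbox (- a) a) h = (LINT x|lborel. h x)"
    if "integrable lborel h" "\<And>x. x \<notin> cbox (- a) a \<Longrightarrow> h x = 0" for h :: "'a \<Rightarrow> real"
  proof -
    have "(\<lambda>x. if x \<in> cbox (- a) a then h x else 0) = h" using that(2) by auto
    then have "integral (cbox (- a) a) h = integral UNIV h"
      using Henstock_Kurzweil_Integration.integral_restrict_UNIV[of "cbox (- a) a" h] by simp
    then show ?thesis using integral_lborel[OF that(1)] by simp
  qed
  have const: "integral (cbox (- a) a) (\<lambda>x. g (x + t *\<^sub>R v)) = (LINT x|lborel. g x)" if t: "t \<in> {-1..1}" for t
  proof -
    have [measurable]: "g \<in> borel_measurable borel" using gc by (rule borel_measurable_continuous_onI)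
    have "(LINT x|lborel. g x) = (LINT x|distr lborel borel ((+) (t *\<^sub>R v)). g x)"
      by (simp add: lborel_distr_plus)
    also have "\<dots> = (LINT x|lborel. g (x + t *\<^sub>R v))"
      by (subst integral_distr) (auto simp: add.commute)
    also have "\<dots> = integral (cbox (- a) a) (\<lambda>x. g (x + t *\<^sub>R v))"
    proof (rule box[symmetric])
      show "integrable lborel (\<lambda>x. g (x + t *\<^sub>R v))"
        by (rule int[OF continuous_on_compose2[OF gc] _ compact_cbox[of "- a" a]])
           (use out[OF _ t] g0(1) in \<open>auto intro!: continuous_intros\<close>)
    qed (use out[OF _ t] g0(1) in auto)
    finally show ?thesis ..
  qed
  have deriv: "((\<lambda>t. g (x + t *\<^sub>R v)) has_field_derivative g' (x + t *\<^sub>R v) v) (at t within {-1..1})" for x t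
  proof -
    have 1: "((\<lambda>t. x + t *\<^sub>R v) has_derivative (\<lambda>s. s *\<^sub>R v)) (at t)"
      by (auto intro!: derivative_eq_intros)
    have lin: "g' y (s *\<^sub>R v) = s * g' y v" for y s
      using has_derivative_linear[OF g, of y] by (simp add: linear_cmul)
    show ?thesis
      using has_derivative_compose[OF 1 g]
      by (simp add: has_field_derivative_def lin mult.commute[of _ "g' (x + t *\<^sub>R v) v"] has_derivative_at_withinI)
  qed
  have *: "((\<lambda>t. integral (cbox (- a) a) (\<lambda>x. g (x + t *\<^sub>R v))) has_field_derivative
      integral (cbox (- a) a) (\<lambda>x. g' (x + 0 *\<^sub>R v) v)) (at 0 within {-1..1})"
  proof (rule leibniz_rule_field_derivative[OF deriv])
    show "(\<lambda>x. g (x + t *\<^sub>R v)) integrable_on cbox (- a) a" for t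
      by (intro integrable_continuous continuous_on_compose2[OF gc]) (auto intro!: continuous_intros)
    show "continuous_on ({-1..1} \<times> cbox (- a) a) (\<lambda>(t, x). g' (x + t *\<^sub>R v) v)"
      unfolding case_prod_beta' by (intro continuous_on_compose2[OF g'c]) (auto intro!: continuous_intros)
  qed auto
  have "((\<lambda>t. LINT x|lborel. g x) has_field_derivative
      integral (cbox (- a) a) (\<lambda>x. g' (x + 0 *\<^sub>R v) v)) (at 0 within {-1..1})"
    by (rule has_field_derivative_transform_within[OF * zero_less_one]) (use const in auto)
  then have "integral (cbox (- a) a) (\<lambda>x. g' x v) = 0"
    using DERIV_unique[OF _ DERIV_const] at_within_Icc_at[of "-1" 0 "1::real"] by simp
  then show "(LINT x|lborel. g' x v) = 0"
    using box[OF g'i] g0(2) out[of _ 0] by auto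
qed

lemma test_function_has_derivative:
  assumes "\<phi> \<in> test_functions S"
  shows "(\<phi> has_derivative frechet_derivative \<phi> (at x)) (at x)"
    and "continuous_on UNIV (\<lambda>x. frechet_derivative \<phi> (at x) v)"
    and "continuous_on UNIV \<phi>"
proof -
  have "Ck (Suc 0) \<phi>" "Ck 0 \<phi>" using assms unfolding test_functions_def by blast+
  then show "(\<phi> has_derivative frechet_derivative \<phi> (at x)) (at x)"
    "continuous_on UNIV (\<lambda>x. frechet_derivative \<phi> (at x) v)" "continuous_on UNIV \<phi>"
    by (auto simp: differentiable_on_def frechet_derivative_works)
qed

lemma test_function_support:
  assumes "\<phi> \<in> test_functions S"
  obtains K where "compact K" "K \<subseteq> S" "\<And>x. x \<notin> K \<Longrightarrow> \<phi> x = 0"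
    "\<And>x v. x \<notin> K \<Longrightarrow> frechet_derivative \<phi> (at x) v = 0"
proof -
  define K where "K = closure {x. \<phi> x \<noteq> 0}"
  have K: "compact K" "K \<subseteq> S" using assms by (auto simp: test_functions_def K_def)
  have 0: "\<phi> x = 0" if "x \<notin> K" for x
    using that closure_subset[of "{x. \<phi> x \<noteq> 0}"] by (auto simp: K_def)
  have "frechet_derivative \<phi> (at x) v = 0" if x: "x \<notin> K" for x v
  proof -
    have "((\<lambda>x. 0) has_derivative frechet_derivative \<phi> (at x)) (at x)"
      by (rule has_derivative_transform_within_open[OF test_function_has_derivative(1)[OF assms], of "- K"])
         (use x 0 K in \<open>auto simp: compact_imp_closed\<close>)
    then have "frechet_derivative \<phi> (at x) = (\<lambda>v. 0)" using has_derivative_unique has_derivative_const by blast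
    then show ?thesis by simp
  qed
  with K 0 that show ?thesis by blast
qed

lemma test_function_L2:
  assumes "\<phi> \<in> test_functions S" "R \<in> sets borel"
  shows "\<phi> \<in> L2 R" and "(\<lambda>x. frechet_derivative \<phi> (at x) v) \<in> L2 R"
proof -
  obtain K where K: "compact K" "\<And>x. x \<notin> K \<Longrightarrow> \<phi> x = 0"
    "\<And>x v. x \<notin> K \<Longrightarrow> frechet_derivative \<phi> (at x) v = 0"
    using test_function_support[OF assms(1)] by metis
  show "\<phi> \<in> L2 R" "(\<lambda>x. frechet_derivative \<phi> (at x) v) \<in> L2 R"
    using continuous_compact_support_L2[OF _ K(1) _ assms(2)] K(2,3) test_function_has_derivative[OF assms(1)]
    by blast+
qed

lemma continuous_on_curl:
  assumes "\<phi> \<in> test_functions S"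
  shows "continuous_on UNIV (curl \<phi>)"
proof -
  note [continuous_intros] = test_function_has_derivative(2)[OF assms]
  have c: "continuous_on UNIV (\<lambda>x. curl \<phi> x $ i)" for i
  proof -
    consider "i = 1" | "i = 2" | "i = 3" using exhaust_3 by blast
    then show ?thesis
      by cases (auto simp: curl_def partial_def intro!: continuous_intros)
  qed
  have "continuous_on UNIV (\<lambda>x. \<chi> i. curl \<phi> x $ i)" by (intro continuous_intros c)
  then show ?thesis by simp
qed

lemma curl_L2:
  assumes \<phi>: "\<phi> \<in> test_functions S" and R: "R \<in> sets borel"
  shows "curl \<phi> \<in> L2 R"
proof -
  obtain K where K: "compact K" "\<And>x v. x \<notin> K \<Longrightarrow> frechet_derivative \<phi> (at x) v = 0"
    using test_function_support[OF \<phi>] by metis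
  show ?thesis
    by (rule continuous_compact_support_L2[OF continuous_on_curl[OF \<phi>] K(1) _ R])
       (use K(2) in \<open>auto simp: curl_def partial_def vec_eq_iff forall_3\<close>)
qed

text \<open>
  The difference of the two integrands is the divergence of \<open>\<zeta> \<times> \<phi>\<close>, a combination of derivatives
  of products of components, each of which has integral zero.
\<close>

lemma curl_integration_by_parts:
  assumes \<Omega>: "open \<Omega>" and \<phi>: "\<phi> \<in> test_functions \<Omega>" and \<zeta>: "\<zeta> \<in> test_functions \<Omega>"
  shows "inner_H \<Omega> \<phi> (curl \<zeta>) = inner_H \<Omega> (curl \<phi>) \<zeta>"
proof -
  obtain K where K: "compact K" "K \<subseteq> \<Omega>" "\<And>x. x \<notin> K \<Longrightarrow> \<phi> x = 0"
    "\<And>x v. x \<notin> K \<Longrightarrow> frechet_derivative \<phi> (at x) v = 0"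
    using test_function_support[OF \<phi>] by metis
  define P where "P i j k x = partial i \<phi> x $ j * \<zeta> x $ k + \<phi> x $ j * partial i \<zeta> x $ k" for i j k x
  have P: "integrable lborel (P i j k) \<and> (LINT x|lborel. P i j k x) = 0" for i j k
  proof -
    define g' where "g' x v = \<phi> x $ j * frechet_derivative \<zeta> (at x) v $ k + frechet_derivative \<phi> (at x) v $ j * \<zeta> x $ k" for x v
    have g: "((\<lambda>x. \<phi> x $ j * \<zeta> x $ k) has_derivative g' x) (at x)" for x
      unfolding g'_def
      by (intro has_derivative_mult bounded_linear.has_derivative[OF bounded_linear_vec_nth]
          test_function_has_derivative(1)[OF \<phi>] test_function_has_derivative(1)[OF \<zeta>])
    have g': "continuous_on UNIV (\<lambda>x. g' x (axis i 1))"
      unfolding g'_def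
      by (intro continuous_intros test_function_has_derivative[OF \<phi>] test_function_has_derivative[OF \<zeta>])
    have "(\<lambda>x. g' x (axis i 1)) = P i j k" by (auto simp: P_def g'_def partial_def)
    then show ?thesis
      using integral_directional_derivative_zero[OF g g' K(1)] K(3,4) by (auto simp: g'_def)
  qed
  define d where "d x = \<phi> x \<bullet> curl \<zeta> x - curl \<phi> x \<bullet> \<zeta> x" for x
  have d: "d x = P 2 1 3 x - P 3 1 2 x + P 3 2 1 x - P 1 2 3 x + P 1 3 2 x - P 2 3 1 x" for x
    by (simp add: d_def P_def curl_def inner_vec_def sum_3 algebra_simps)
  have di: "integrable lborel d" "(LINT x|lborel. d x) = 0"
    unfolding d[abs_def] using P by simp_all
  have dm: "d \<in> borel_measurable lborel" using di by auto
  have "(LINT x|lebesgue_on \<Omega>. d x) = (LINT x|lebesgue. (if x \<in> \<Omega> then d x else 0))"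
    by (rule Lebesgue_Measure.integral_restrict_UNIV[symmetric]) (use \<Omega> in auto)
  also have "(\<lambda>x. if x \<in> \<Omega> then d x else 0) = d"
  proof -
    have "d x = 0" if "x \<notin> \<Omega>" for x
    proof -
      have "x \<notin> K" using that K(2) by blast
      then show ?thesis
        by (simp add: d_def curl_def partial_def inner_vec_def sum_3 K(3,4))
    qed
    then show ?thesis by auto
  qed
  also have "(LINT x|lebesgue. d x) = 0" using di dm by (simp add: integral_completion)
  finally have 0: "(LINT x|lebesgue_on \<Omega>. d x) = 0" .
  have \<Omega>b: "\<Omega> \<in> sets borel" using \<Omega> by simp
  show ?thesis
    using 0 L2_inner_integrable[OF test_function_L2(1)[OF \<phi> \<Omega>b] curl_L2[OF \<zeta> \<Omega>b]]
      L2_inner_integrable[OF curl_L2[OF \<phi> \<Omega>b] test_function_L2(1)[OF \<zeta> \<Omega>b]]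
    by (simp add: inner_H_def d_def)
qed

section \<open>Weak curls and the spaces \<open>V\<close> and \<open>V\<^sub>0\<close>\<close>

lemma has_weak_curl_L2: "has_weak_curl \<Omega> u F \<Longrightarrow> u \<in> L2 \<Omega>" "has_weak_curl \<Omega> u F \<Longrightarrow> F \<in> L2 \<Omega>"
  by (auto simp: has_weak_curl_def)

text \<open>
  \<^const>\<open>weak_curl\<close> is an arbitrary choice among all weak curls.  Uniqueness up to null sets makes
  the choice irrelevant under integrals.
\<close>

lemma has_weak_curl_unique:
  assumes \<Omega>: "open \<Omega>" and F: "has_weak_curl \<Omega> u F" and G: "has_weak_curl \<Omega> u G"
  shows "AE x in lebesgue_on \<Omega>. F x = G x"
proof -
  have \<Omega>b: "\<Omega> \<in> sets borel" using \<Omega> by simp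
  note L = has_weak_curl_L2(2)[OF F] has_weak_curl_L2(2)[OF G]
  have "AE x in lebesgue_on \<Omega>. F x - G x = 0"
  proof (rule fundamental_lemma_calculus_of_variations[OF \<Omega>])
    show "(\<lambda>x. F x - G x) \<in> L2 \<Omega>" by (rule L2_diff[OF L])
    fix \<phi> assume \<phi>: "\<phi> \<in> test_functions \<Omega>"
    show "inner_H \<Omega> (\<lambda>x. F x - G x) \<phi> = 0"
      using F G \<phi> inner_H_diff_left[OF L test_function_L2(1)[OF \<phi> \<Omega>b]]
      by (simp add: has_weak_curl_def)
  qed
  then show ?thesis by eventually_elim simp
qed

lemma has_weak_curl_weak_curl: "u \<in> V \<Omega> \<Longrightarrow> has_weak_curl \<Omega> u (weak_curl \<Omega> u)"
  using someI_ex[of "has_weak_curl \<Omega> u"] by (simp add: V_def weak_curl_def)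

lemma weak_curl_AE:
  assumes "open \<Omega>" and F: "has_weak_curl \<Omega> u F"
  shows "AE x in lebesgue_on \<Omega>. weak_curl \<Omega> u x = F x"
proof -
  have "u \<in> V \<Omega>" using F by (auto simp: V_def)
  from has_weak_curl_unique[OF assms(1) has_weak_curl_weak_curl[OF this] F] show ?thesis .
qed

lemma inner_H_weak_curl:
  assumes "open \<Omega>" and F: "has_weak_curl \<Omega> u F" and v: "v \<in> L2 \<Omega>"
  shows "inner_H \<Omega> (weak_curl \<Omega> u) v = inner_H \<Omega> F v"
proof (rule inner_H_cong_AE[OF _ _ v weak_curl_AE[OF assms(1) F]])
  have "u \<in> V \<Omega>" using F by (auto simp: V_def)
  then show "weak_curl \<Omega> u \<in> L2 \<Omega>" using has_weak_curl_weak_curl has_weak_curl_L2(2) by blast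
qed (rule has_weak_curl_L2(2)[OF F])

text \<open>
  Membership in \<open>V\<^sub>0\<close> without reference to the chosen representatives of the weak curls: \<open>V\<^sub>0\<close> is the
  domain of the adjoint of the curl on \<open>V\<close>.
\<close>

lemma V0_iff:
  assumes "open \<Omega>" and F: "has_weak_curl \<Omega> u F"
  shows "u \<in> V0 \<Omega> \<longleftrightarrow> (\<forall>\<psi> G. has_weak_curl \<Omega> \<psi> G \<longrightarrow> inner_H \<Omega> F \<psi> = inner_H \<Omega> u G)"
proof -
  have uV: "u \<in> V \<Omega>" using F by (auto simp: V_def)
  have swap: "inner_H \<Omega> u (weak_curl \<Omega> \<psi>) = inner_H \<Omega> u G" if G: "has_weak_curl \<Omega> \<psi> G" for \<psi> G
    using inner_H_weak_curl[OF assms(1) G has_weak_curl_L2(1)[OF F]] by (simp add: inner_H_commute)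
  have left: "inner_H \<Omega> (weak_curl \<Omega> u) \<psi> = inner_H \<Omega> F \<psi>" if G: "has_weak_curl \<Omega> \<psi> G" for \<psi> G
    by (rule inner_H_weak_curl[OF assms(1) F has_weak_curl_L2(1)[OF G]])
  show ?thesis
  proof
    assume u: "u \<in> V0 \<Omega>"
    show "\<forall>\<psi> G. has_weak_curl \<Omega> \<psi> G \<longrightarrow> inner_H \<Omega> F \<psi> = inner_H \<Omega> u G"
    proof (intro allI impI)
      fix \<psi> G assume G: "has_weak_curl \<Omega> \<psi> G"
      then have "\<psi> \<in> V \<Omega>" by (auto simp: V_def)
      with u have "inner_H \<Omega> (weak_curl \<Omega> u) \<psi> = inner_H \<Omega> u (weak_curl \<Omega> \<psi>)" by (auto simp: V0_def)
      then show "inner_H \<Omega> F \<psi> = inner_H \<Omega> u G" using swap[OF G] left[OF G] by simp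
    qed
  next
    assume R: "\<forall>\<psi> G. has_weak_curl \<Omega> \<psi> G \<longrightarrow> inner_H \<Omega> F \<psi> = inner_H \<Omega> u G"
    have "inner_H \<Omega> (weak_curl \<Omega> u) \<psi> = inner_H \<Omega> u (weak_curl \<Omega> \<psi>)" if "\<psi> \<in> V \<Omega>" for \<psi>
      using left[OF has_weak_curl_weak_curl[OF that]] R has_weak_curl_weak_curl[OF that] by auto
    then show "u \<in> V0 \<Omega>" using uV by (simp add: V0_def)
  qed
qed

lemma test_function_V0:
  assumes \<Omega>: "open \<Omega>" and \<phi>: "\<phi> \<in> test_functions \<Omega>"
  shows "has_weak_curl \<Omega> \<phi> (curl \<phi>)" and "\<phi> \<in> V0 \<Omega>"
proof -
  have \<Omega>b: "\<Omega> \<in> sets borel" using \<Omega> by simp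
  show *: "has_weak_curl \<Omega> \<phi> (curl \<phi>)"
    unfolding has_weak_curl_def
    using test_function_L2(1)[OF \<phi> \<Omega>b] curl_L2[OF \<phi> \<Omega>b] curl_integration_by_parts[OF \<Omega> \<phi>] by blast
  have "inner_H \<Omega> (curl \<phi>) \<psi> = inner_H \<Omega> \<phi> G" if "has_weak_curl \<Omega> \<psi> G" for \<psi> G
    using that \<phi> by (metis has_weak_curl_def inner_H_commute)
  then show "\<phi> \<in> V0 \<Omega>" using V0_iff[OF \<Omega> *] by blast
qed

text \<open>
  The curl on \<open>V\<close> is the adjoint of the curl on \<open>V\<^sub>0\<close>, because \<open>V\<^sub>0\<close> contains the test functions
  that define weak curls.
\<close>

lemma curl_of_V0_adjoint:
  assumes \<Omega>: "open \<Omega>" and u: "u \<in> L2 \<Omega>" and F: "F \<in> L2 \<Omega>"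
    and adj: "\<And>\<phi> C. \<phi> \<in> V0 \<Omega> \<Longrightarrow> has_weak_curl \<Omega> \<phi> C \<Longrightarrow> inner_H \<Omega> u C = inner_H \<Omega> F \<phi>"
  shows "has_weak_curl \<Omega> u F"
  using u F adj test_function_V0[OF \<Omega>] by (auto simp: has_weak_curl_def)

text \<open>
  Conversely, a field that is paired correctly with all curls of fields in \<open>V\<close> satisfies the
  boundary condition encoded in \<open>V\<^sub>0\<close>.
\<close>

lemma V0_of_V_adjoint:
  assumes \<Omega>: "open \<Omega>" and u: "u \<in> L2 \<Omega>" and F: "F \<in> L2 \<Omega>"
    and adj: "\<And>\<psi> C. has_weak_curl \<Omega> \<psi> C \<Longrightarrow> inner_H \<Omega> u C = inner_H \<Omega> F \<psi>"
  shows "has_weak_curl \<Omega> u F" and "u \<in> V0 \<Omega>"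
proof -
  show *: "has_weak_curl \<Omega> u F"
    by (rule curl_of_V0_adjoint[OF \<Omega> u F]) (rule adj)
  show "u \<in> V0 \<Omega>" using V0_iff[OF \<Omega> *] adj by simp
qed

lemma has_weak_curl_scaleR:
  assumes "has_weak_curl \<Omega> u F"
  shows "has_weak_curl \<Omega> (\<lambda>x. c *\<^sub>R u x) (\<lambda>x. c *\<^sub>R F x)"
  using assms by (auto simp: has_weak_curl_def inner_H_scaleR_left L2_scaleR)

lemma V_scaleR: "u \<in> V \<Omega> \<Longrightarrow> (\<lambda>x. c *\<^sub>R u x) \<in> V \<Omega>"
  unfolding V_def using has_weak_curl_scaleR by blast

lemma V0_scaleR:
  assumes "open \<Omega>" "u \<in> V0 \<Omega>"
  shows "(\<lambda>x. c *\<^sub>R u x) \<in> V0 \<Omega>"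
proof -
  have *: "has_weak_curl \<Omega> u (weak_curl \<Omega> u)"
    using assms by (auto simp: V0_def intro: has_weak_curl_weak_curl)
  show ?thesis
    using assms(2) V0_iff[OF assms(1) *] V0_iff[OF assms(1) has_weak_curl_scaleR[OF *]]
    by (simp add: inner_H_scaleR_left)
qed

lemma norm_V_scaleR:
  assumes "open \<Omega>" and u: "u \<in> V \<Omega>"
  shows "norm_V \<Omega> (\<lambda>x. c *\<^sub>R u x) = \<bar>c\<bar> * norm_V \<Omega> u"
proof -
  define F where "F = weak_curl \<Omega> u"
  have F: "has_weak_curl \<Omega> u F" unfolding F_def by (rule has_weak_curl_weak_curl[OF u])
  define G where "G = weak_curl \<Omega> (\<lambda>x. c *\<^sub>R u x)"
  have G: "has_weak_curl \<Omega> (\<lambda>x. c *\<^sub>R u x) G"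
    unfolding G_def by (rule has_weak_curl_weak_curl[OF V_scaleR[OF u]])
  have [measurable]: "u \<in> borel_measurable (lebesgue_on \<Omega>)" "F \<in> borel_measurable (lebesgue_on \<Omega>)"
    "G \<in> borel_measurable (lebesgue_on \<Omega>)"
    using has_weak_curl_L2[OF F] has_weak_curl_L2[OF G] by (auto simp: L2_def)
  have "inner_V \<Omega> (\<lambda>x. c *\<^sub>R u x) (\<lambda>x. c *\<^sub>R u x) = (LINT x|lebesgue_on \<Omega>. c\<^sup>2 * (u x \<bullet> u x + F x \<bullet> F x))"
    unfolding inner_V_def G_def[symmetric]
  proof (rule integral_cong_AE)
    show "AE x in lebesgue_on \<Omega>. c *\<^sub>R u x \<bullet> c *\<^sub>R u x + G x \<bullet> G x = c\<^sup>2 * (u x \<bullet> u x + F x \<bullet> F x)"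
      using has_weak_curl_unique[OF assms(1) G has_weak_curl_scaleR[OF F]]
      by eventually_elim (simp add: power2_eq_square algebra_simps)
  qed measurable
  also have "\<dots> = c\<^sup>2 * inner_V \<Omega> u u" by (simp add: inner_V_def F_def)
  finally show ?thesis by (simp add: norm_V_def real_sqrt_mult)
qed

section \<open>Products of a spatial field and a function of time as test fields\<close>

lemma bounded_interval_integrable:
  fixes f :: "real \<Rightarrow> real"
  assumes "f \<in> borel_measurable (lebesgue_on {a<..<b})" "\<And>t. t \<in> {a<..<b} \<Longrightarrow> \<bar>f t\<bar> \<le> B"
  shows "integrable (lebesgue_on {a<..<b}) f"
proof (rule Bochner_Integration.integrable_bound[OF _ assms(1)])
  show "integrable (lebesgue_on {a<..<b}) (\<lambda>t. B)"
    by (rule integrable_const_lebesgue_on) simp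
  show "AE t in lebesgue_on {a<..<b}. norm (f t) \<le> norm B"
    by (rule AE_I2) (use assms(2) in \<open>force\<close>)
qed

lemma continuous_on_Icc_bound:
  fixes f :: "real \<Rightarrow> real"
  assumes "continuous_on {a..b} f"
  obtains M where "\<And>t. t \<in> {a..b} \<Longrightarrow> \<bar>f t\<bar> \<le> M"
proof -
  have "bounded (f ` {a..b})"
    by (rule compact_imp_bounded[OF compact_continuous_image[OF assms compact_Icc]])
  then obtain M where "\<forall>x\<in>f ` {a..b}. norm x \<le> M" unfolding bounded_iff by blast
  then have "\<And>t. t \<in> {a..b} \<Longrightarrow> \<bar>f t\<bar> \<le> M" by auto
  then show ?thesis by (rule that)
qed

text \<open>
  On almost every line \<open>x = const\<close> this is integration by parts in time.  No boundary terms occur,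
  since a test function on the cylinder vanishes at times 0 and \<open>T\<close>; the finite set \<open>N\<close> contains the
  kinks of \<open>\<eta>\<close>.
\<close>

lemma product_has_weak_dt:
  fixes \<eta> \<eta>' :: "real \<Rightarrow> real"
  assumes \<Omega>: "open \<Omega>" and T: "0 < T" and \<phi>: "\<phi> \<in> L2 \<Omega>"
    and \<eta>: "continuous_on {0..T} \<eta>"
    and N: "finite N" and der: "\<And>t. t \<in> {0<..<T} - N \<Longrightarrow> (\<eta> has_real_derivative \<eta>' t) (at t)"
    and \<eta>'m: "\<eta>' \<in> borel_measurable (lebesgue_on {0<..<T})" and \<eta>'B: "\<And>t. \<bar>\<eta>' t\<bar> \<le> B"
  shows "has_weak_dt (QT \<Omega> T) (\<lambda>z. \<eta> (snd z) *\<^sub>R \<phi> (fst z)) (\<lambda>z. \<eta>' (snd z) *\<^sub>R \<phi> (fst z))"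
proof -
  have \<Omega>b: "\<Omega> \<in> sets borel" and Jb: "{0<..<T} \<in> sets borel" using \<Omega> by auto
  have Qb: "QT \<Omega> T \<in> sets borel" unfolding QT_def by (rule borel_Times[OF \<Omega>b Jb])
  have \<eta>m: "\<eta> \<in> borel_measurable (lebesgue_on {0<..<T})"
    by (rule continuous_imp_measurable_on_sets_lebesgue)
       (auto intro: continuous_on_subset[OF \<eta>])
  obtain M where M: "\<And>t. t \<in> {0..T} \<Longrightarrow> \<bar>\<eta> t\<bar> \<le> M"
    using continuous_on_Icc_bound[OF \<eta>] by blast
  have u: "(\<lambda>z. \<eta> (snd z) *\<^sub>R \<phi> (fst z)) \<in> L2 (QT \<Omega> T)" unfolding QT_def
  proof (rule L2_product[OF \<Omega>b Jb \<phi> \<eta>m])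
    show "integrable (lebesgue_on {0<..<T}) (\<lambda>t. (\<eta> t)\<^sup>2)"
      by (rule bounded_interval_integrable[of _ _ _ "M\<^sup>2"])
         (use \<eta>m M in \<open>auto simp: abs_le_square_iff[symmetric] intro: order_trans[OF _ abs_ge_self]\<close>)
  qed
  have w: "(\<lambda>z. \<eta>' (snd z) *\<^sub>R \<phi> (fst z)) \<in> L2 (QT \<Omega> T)" unfolding QT_def
  proof (rule L2_product[OF \<Omega>b Jb \<phi> \<eta>'m])
    show "integrable (lebesgue_on {0<..<T}) (\<lambda>t. (\<eta>' t)\<^sup>2)"
      by (rule bounded_interval_integrable[of _ _ _ "B\<^sup>2"])
         (use \<eta>'m \<eta>'B in \<open>auto simp: abs_le_square_iff[symmetric] intro: order_trans[OF _ abs_ge_self]\<close>)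
  qed
  have "(LINT z|lebesgue_on (QT \<Omega> T). (\<eta> (snd z) *\<^sub>R \<phi> (fst z)) \<bullet> frechet_derivative \<zeta> (at z) (0, 1)) =
        - (LINT z|lebesgue_on (QT \<Omega> T). (\<eta>' (snd z) *\<^sub>R \<phi> (fst z)) \<bullet> \<zeta> z)"
    if \<zeta>: "\<zeta> \<in> test_functions (QT \<Omega> T)" for \<zeta>
  proof -
    define D where "D z = frechet_derivative \<zeta> (at z) (0, 1)" for z
    have \<zeta>L: "\<zeta> \<in> L2 (QT \<Omega> T)" and DL: "D \<in> L2 (QT \<Omega> T)"
      unfolding D_def using test_function_L2[OF \<zeta> Qb] by auto
    obtain K where K: "K \<subseteq> QT \<Omega> T" "\<And>z. z \<notin> K \<Longrightarrow> \<zeta> z = 0"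
      using test_function_support[OF \<zeta>] by metis
    have \<zeta>0: "\<zeta> (x, t) = 0" if "t \<notin> {0<..<T}" for x t
    proof -
      have "(x, t) \<notin> K" using K(1) that by (auto simp: QT_def)
      then show ?thesis by (rule K(2))
    qed
    define f where "f z = (\<eta> (snd z) *\<^sub>R \<phi> (fst z)) \<bullet> D z + (\<eta>' (snd z) *\<^sub>R \<phi> (fst z)) \<bullet> \<zeta> z" for z
    have fi: "integrable (lebesgue_on (QT \<Omega> T)) f" unfolding f_def
      by (intro Bochner_Integration.integrable_add L2_inner_integrable u w \<zeta>L DL)
    note fi' = fi[unfolded QT_def]
    have slice: "(LINT t|lebesgue_on {0<..<T}. f (x, t)) = 0"
      if i: "integrable (lebesgue_on {0<..<T}) (\<lambda>t. f (x, t))" for x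
    proof -
      have \<zeta>t: "((\<lambda>t. \<zeta> (x, t)) has_vector_derivative D (x, t)) (at t)" for t
      proof -
        have 1: "((\<lambda>t. (x, t)) has_derivative (\<lambda>s. (0, s))) (at t)"
          by (auto intro!: derivative_eq_intros)
        have lin: "frechet_derivative \<zeta> (at z) (0, s) = s *\<^sub>R D z" for z s
          using linear_cmul[OF has_derivative_linear[OF test_function_has_derivative(1)[OF \<zeta>, of z]], of s "(0, 1)"]
          by (simp add: D_def)
        show ?thesis
          using has_derivative_compose[OF 1 test_function_has_derivative(1)[OF \<zeta>]]
          by (simp add: has_vector_derivative_def lin)
      qed
      have "((\<lambda>t. f (x, t)) has_integral (\<eta> T *\<^sub>R \<phi> x) \<bullet> \<zeta> (x, T) - (\<eta> 0 *\<^sub>R \<phi> x) \<bullet> \<zeta> (x, 0)) {0..T}"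
      proof (rule fundamental_theorem_of_calculus_interior_strong[OF N])
        show "0 \<le> T" using T by simp
        show "continuous_on {0..T} (\<lambda>t. (\<eta> t *\<^sub>R \<phi> x) \<bullet> \<zeta> (x, t))"
        proof (intro continuous_intros \<eta>)
          show "continuous_on {0..T} (\<lambda>t. \<zeta> (x, t))"
            using \<zeta>t has_vector_derivative_continuous by (intro continuous_at_imp_continuous_on) blast
        qed
        fix t assume t: "t \<in> {0<..<T} - N"
        have e: "(\<eta> has_derivative (\<lambda>s. s * \<eta>' t)) (at t)"
          using der[OF t] by (simp add: has_field_derivative_def mult.commute[of _ "\<eta>' t"])
        have c: "((\<lambda>t. \<zeta> (x, t)) has_derivative (\<lambda>s. s *\<^sub>R D (x, t))) (at t)"
          using \<zeta>t by (simp add: has_vector_derivative_def)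
        have "((\<lambda>t. (\<eta> t *\<^sub>R \<phi> x) \<bullet> \<zeta> (x, t)) has_derivative (\<lambda>s. s *\<^sub>R f (x, t))) (at t)"
          by (rule derivative_eq_intros e c refl)+ (simp add: f_def fun_eq_iff algebra_simps)
        then show "((\<lambda>t. (\<eta> t *\<^sub>R \<phi> x) \<bullet> \<zeta> (x, t)) has_vector_derivative f (x, t)) (at t)"
          by (simp add: has_vector_derivative_def)
      qed
      then have "integral {0..T} (\<lambda>t. f (x, t)) = 0"
        using \<zeta>0[of 0 x] \<zeta>0[of T x] by (simp add: integral_unique)
      then show ?thesis
        using lebesgue_integral_eq_integral[OF i] by (simp add: integral_open_interval_real)
    qed
    have "(LINT x|lebesgue_on \<Omega>. LINT t|lebesgue_on {0<..<T}. f (x, t)) = 0"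
      by (rule integral_eq_zero_AE)
         (use lebesgue_on_Fubini(4)[OF \<Omega>b Jb fi'] slice in \<open>auto elim!: eventually_mono\<close>)
    then have "(LINT z|lebesgue_on (QT \<Omega> T). f z) = 0"
      using lebesgue_on_Fubini(6)[OF \<Omega>b Jb fi'] by (simp add: QT_def)
    then show ?thesis
      using L2_inner_integrable[OF u DL] L2_inner_integrable[OF w \<zeta>L]
      by (simp add: f_def D_def[symmetric] Bochner_Integration.integral_add del: inner_scaleR_left)
  qed
  then show ?thesis using u w by (simp add: has_weak_dt_def del: inner_scaleR_left)
qed

text \<open>
  It suffices to approximate the scalar factor by simple functions, as \<^const>\<open>norm_V\<close> is homogeneous.
\<close>

lemma product_bochner_L2:
  assumes \<Omega>: "open \<Omega>" and T: "0 < T" and \<eta>: "continuous_on {0..T} \<eta>"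
    and \<phi>: "\<phi> \<in> V \<Omega>" and X: "\<And>c. (\<lambda>x. c *\<^sub>R \<phi> x) \<in> X"
  shows "(\<lambda>t x. \<eta> t *\<^sub>R \<phi> x) \<in> bochner_L2 T X (norm_V \<Omega>)"
proof -
  define M where "M = lebesgue_on {0<..<T}"
  have \<eta>m [measurable]: "\<eta> \<in> borel_measurable M" unfolding M_def
    by (rule continuous_imp_measurable_on_sets_lebesgue)
       (auto intro: continuous_on_subset[OF \<eta>])
  obtain B where B: "\<And>t. t \<in> {0..T} \<Longrightarrow> \<bar>\<eta> t\<bar> \<le> B"
    using continuous_on_Icc_bound[OF \<eta>] by blast
  obtain q where q: "\<And>n. simple_function M (q n)"
    and q_lim: "\<And>t. t \<in> space M \<Longrightarrow> (\<lambda>n. q n t) \<longlonglongrightarrow> \<eta> t"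
    using borel_measurable_implies_sequence_metric[OF \<eta>m, of 0] by metis
  have s: "simple_function M (\<lambda>t x. q n t *\<^sub>R \<phi> x)" for n
    using simple_function_compose1[OF q, of "\<lambda>c x. c *\<^sub>R \<phi> x" n] .
  have lim: "(\<lambda>n. norm_V \<Omega> (\<lambda>x. \<eta> t *\<^sub>R \<phi> x - q n t *\<^sub>R \<phi> x)) \<longlonglongrightarrow> 0" if "t \<in> {0<..<T}" for t
  proof -
    have "(\<lambda>n. \<bar>\<eta> t - q n t\<bar> * norm_V \<Omega> \<phi>) \<longlonglongrightarrow> \<bar>\<eta> t - \<eta> t\<bar> * norm_V \<Omega> \<phi>"
      by (intro tendsto_intros q_lim) (use that in \<open>simp add: M_def\<close>)
    moreover have "norm_V \<Omega> (\<lambda>x. \<eta> t *\<^sub>R \<phi> x - q n t *\<^sub>R \<phi> x) = \<bar>\<eta> t - q n t\<bar> * norm_V \<Omega> \<phi>" for n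
      using norm_V_scaleR[OF \<Omega> \<phi>, of "\<eta> t - q n t"] by (simp add: scaleR_diff_left)
    ultimately show ?thesis by simp
  qed
  have "integrable M (\<lambda>t. (norm_V \<Omega> (\<lambda>x. \<eta> t *\<^sub>R \<phi> x))\<^sup>2)"
    unfolding norm_V_scaleR[OF \<Omega> \<phi>] M_def
  proof (rule bounded_interval_integrable)
    show "(\<lambda>t. (\<bar>\<eta> t\<bar> * norm_V \<Omega> \<phi>)\<^sup>2) \<in> borel_measurable (lebesgue_on {0<..<T})"
      using \<eta>m unfolding M_def by measurable
    fix t assume "t \<in> {0<..<T}"
    then have "\<bar>\<eta> t\<bar> \<le> B" using B[of t] by auto
    then have "\<bar>\<eta> t\<bar> * \<bar>norm_V \<Omega> \<phi>\<bar> \<le> B * \<bar>norm_V \<Omega> \<phi>\<bar>" by (intro mult_right_mono) auto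
    then have "(\<bar>\<eta> t\<bar> * \<bar>norm_V \<Omega> \<phi>\<bar>)\<^sup>2 \<le> (B * \<bar>norm_V \<Omega> \<phi>\<bar>)\<^sup>2" by (intro power_mono) auto
    then show "\<bar>(\<bar>\<eta> t\<bar> * norm_V \<Omega> \<phi>)\<^sup>2\<bar> \<le> (B * norm_V \<Omega> \<phi>)\<^sup>2"
      by (simp add: power_mult_distrib)
  qed
  moreover have "AE t in M. (\<lambda>n. norm_V \<Omega> (\<lambda>x. \<eta> t *\<^sub>R \<phi> x - q n t *\<^sub>R \<phi> x)) \<longlonglongrightarrow> 0"
    using lim by (intro AE_I2) (simp add: M_def)
  ultimately show ?thesis
    unfolding bochner_L2_def M_def[symmetric] mem_Collect_eq
    using X s by (intro conjI exI[of _ "\<lambda>n t x. q n t *\<^sub>R \<phi> x"]) auto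
qed

lemma product_admissible_test:
  fixes \<eta> \<eta>' :: "real \<Rightarrow> real"
  assumes \<Omega>: "open \<Omega>" and T: "0 < T" and C: "has_weak_curl \<Omega> \<phi> C"
    and X: "\<And>c. (\<lambda>x. c *\<^sub>R \<phi> x) \<in> X"
    and \<eta>: "continuous_on {0..T} \<eta>" and \<eta>T: "\<eta> T = 0"
    and N: "finite N" and der: "\<And>t. t \<in> {0<..<T} - N \<Longrightarrow> (\<eta> has_real_derivative \<eta>' t) (at t)"
    and \<eta>'m: "\<eta>' \<in> borel_measurable (lebesgue_on {0<..<T})" and \<eta>'B: "\<And>t. \<bar>\<eta>' t\<bar> \<le> B"
  shows "admissible_test \<Omega> T X (\<lambda>z. \<eta> (snd z) *\<^sub>R \<phi> (fst z)) (\<lambda>z. \<eta> (snd z) *\<^sub>R C (fst z))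
      (\<lambda>z. \<eta>' (snd z) *\<^sub>R \<phi> (fst z)) (\<lambda>t x. \<eta> t *\<^sub>R \<phi> x)"
proof -
  have \<phi>V: "\<phi> \<in> V \<Omega>" using C by (auto simp: V_def)
  note \<phi> = has_weak_curl_L2(1)[OF C] and CL = has_weak_curl_L2(2)[OF C]
  have \<Omega>b: "\<Omega> \<in> sets borel" and Jb: "{0<..<T} \<in> sets borel" using \<Omega> by auto
  have dt: "has_weak_dt (QT \<Omega> T) (\<lambda>z. \<eta> (snd z) *\<^sub>R \<phi> (fst z)) (\<lambda>z. \<eta>' (snd z) *\<^sub>R \<phi> (fst z))"
    by (rule product_has_weak_dt[OF \<Omega> T \<phi> \<eta> N der \<eta>'m \<eta>'B])
  have \<eta>m: "\<eta> \<in> borel_measurable (lebesgue_on {0<..<T})"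
    by (rule continuous_imp_measurable_on_sets_lebesgue)
       (auto intro: continuous_on_subset[OF \<eta>])
  obtain M where M: "\<And>t. t \<in> {0..T} \<Longrightarrow> \<bar>\<eta> t\<bar> \<le> M"
    using continuous_on_Icc_bound[OF \<eta>] by blast
  have "(\<lambda>z. \<eta> (snd z) *\<^sub>R C (fst z)) \<in> L2 (QT \<Omega> T)" unfolding QT_def
  proof (rule L2_product[OF \<Omega>b Jb CL \<eta>m])
    show "integrable (lebesgue_on {0<..<T}) (\<lambda>t. (\<eta> t)\<^sup>2)"
      by (rule bounded_interval_integrable[of _ _ _ "M\<^sup>2"])
         (use \<eta>m M in \<open>auto simp: abs_le_square_iff[symmetric] intro: order_trans[OF _ abs_ge_self]\<close>)
  qed
  then have curl: "has_curl_field \<Omega> T (\<lambda>z. \<eta> (snd z) *\<^sub>R \<phi> (fst z)) (\<lambda>z. \<eta> (snd z) *\<^sub>R C (fst z))"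
    by (simp add: has_curl_field_def has_weak_curl_scaleR[OF C])
  have CH: "(\<lambda>t x. \<eta> t *\<^sub>R \<phi> x) \<in> C_H \<Omega> T"
    unfolding C_H_def mem_Collect_eq
  proof (intro conjI ballI)
    show "(\<lambda>x. \<eta> t *\<^sub>R \<phi> x) \<in> L2 \<Omega>" for t by (rule L2_scaleR[OF \<phi>])
    fix t assume t: "t \<in> {0..T}"
    have "(\<eta> \<longlongrightarrow> \<eta> t) (at t within {0..T})" using \<eta> t by (auto simp: continuous_on_def)
    then have "((\<lambda>s. \<bar>\<eta> s - \<eta> t\<bar> * norm_H \<Omega> \<phi>) \<longlongrightarrow> \<bar>\<eta> t - \<eta> t\<bar> * norm_H \<Omega> \<phi>) (at t within {0..T})"
      by (intro tendsto_intros)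
    moreover have "norm_H \<Omega> (\<lambda>x. \<eta> s *\<^sub>R \<phi> x - \<eta> t *\<^sub>R \<phi> x) = \<bar>\<eta> s - \<eta> t\<bar> * norm_H \<Omega> \<phi>" for s
      using norm_H_scaleR[of \<Omega> "\<eta> s - \<eta> t" \<phi>] by (simp add: scaleR_diff_left)
    ultimately show "((\<lambda>s. norm_H \<Omega> (\<lambda>x. \<eta> s *\<^sub>R \<phi> x - \<eta> t *\<^sub>R \<phi> x)) \<longlongrightarrow> 0) (at t within {0..T})"
      by simp
  qed
  show ?thesis
    unfolding admissible_test_def continuous_rep_def
    using dt curl CH product_bochner_L2[OF \<Omega> T \<eta> \<phi>V X] \<eta>T
    by (simp add: has_weak_dt_def)
qed

text \<open>
  The cutoff is 1 up to time \<open>\<tau>\<close> and 0 after \<open>\<tau> + \<delta>\<close>.  Integration against \<open>- \<eta>'\<close> is the mean value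
  over \<open>[\<tau>, \<tau> + \<delta>]\<close>, so as \<open>\<delta>\<close> tends to zero a weak equation tested with \<open>\<eta>\<close> yields the value at \<open>\<tau>\<close>.
\<close>

lemma piecewise_linear_cutoff:
  fixes \<tau> \<delta> T :: real
  assumes "0 \<le> \<tau>" "0 < \<delta>" "\<tau> + \<delta> \<le> T"
  defines "\<eta> \<equiv> \<lambda>t. max 0 (min 1 ((\<tau> + \<delta> - t) / \<delta>))"
    and "\<eta>' \<equiv> \<lambda>t. if t \<in> {\<tau><..<\<tau> + \<delta>} then - 1 / \<delta> else 0"
  shows "continuous_on {0..T} \<eta>" "\<eta> T = 0" "\<eta> 0 = 1"
    "t \<notin> {\<tau>, \<tau> + \<delta>} \<Longrightarrow> (\<eta> has_real_derivative \<eta>' t) (at t)"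
    "\<eta>' \<in> borel_measurable (lebesgue_on {0<..<T})" "\<bar>\<eta>' t\<bar> \<le> 1 / \<delta>"
    "\<bar>\<eta> t\<bar> \<le> 1" "t \<le> \<tau> \<Longrightarrow> \<eta> t = 1" "\<tau> + \<delta> \<le> t \<Longrightarrow> \<eta> t = 0"
proof -
  show "continuous_on {0..T} \<eta>" unfolding \<eta>_def using assms by (intro continuous_intros) auto
  show "\<eta> T = 0" "\<eta> 0 = 1" "\<bar>\<eta> t\<bar> \<le> 1" using assms by (auto simp: \<eta>_def field_simps min_def max_def)
  have one: "\<eta> t = 1" if "t \<le> \<tau>" for t using that assms by (auto simp: \<eta>_def field_simps min_def max_def)
  have zero: "\<eta> t = 0" if "\<tau> + \<delta> \<le> t" for t using that assms by (auto simp: \<eta>_def field_simps min_def max_def)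
  show "t \<le> \<tau> \<Longrightarrow> \<eta> t = 1" "\<tau> + \<delta> \<le> t \<Longrightarrow> \<eta> t = 0" using one zero by auto
  have lin: "\<eta> t = (\<tau> + \<delta> - t) / \<delta>" if "t \<in> {\<tau><..<\<tau> + \<delta>}" for t
    using that assms by (auto simp: \<eta>_def field_simps min_def max_def)
  show "\<eta>' \<in> borel_measurable (lebesgue_on {0<..<T})"
    unfolding \<eta>'_def by (intro measurable_restrict_space1 measurable_completion) measurable
  show "\<bar>\<eta>' t\<bar> \<le> 1 / \<delta>" using assms by (auto simp: \<eta>'_def)
  show "(\<eta> has_real_derivative \<eta>' t) (at t)" if t: "t \<notin> {\<tau>, \<tau> + \<delta>}"
  proof -
    consider "t < \<tau>" | "t \<in> {\<tau><..<\<tau> + \<delta>}" | "\<tau> + \<delta> < t" using t by force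
    then show ?thesis
    proof cases
      case 1
      have "((\<lambda>t. 1) has_real_derivative 0) (at t)" by simp
      then have "(\<eta> has_real_derivative 0) (at t)"
        by (rule has_field_derivative_transform_within_open[of _ _ _ "{..<\<tau>}"]) (use 1 one in auto)
      then show ?thesis using 1 by (simp add: \<eta>'_def)
    next
      case 2
      have "((\<lambda>t. (\<tau> + \<delta> - t) / \<delta>) has_real_derivative - 1 / \<delta>) (at t)"
        using assms by (auto intro!: derivative_eq_intros)
      then have "(\<eta> has_real_derivative - 1 / \<delta>) (at t)"
        by (rule has_field_derivative_transform_within_open[of _ _ _ "{\<tau><..<\<tau> + \<delta>}"]) (use 2 lin in auto)
      then show ?thesis using 2 by (simp add: \<eta>'_def)
    next
      case 3
      have "((\<lambda>t. 0) has_real_derivative 0) (at t)" by simp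
      then have "(\<eta> has_real_derivative 0) (at t)"
        by (rule has_field_derivative_transform_within_open[of _ _ _ "{\<tau> + \<delta><..}"]) (use 3 zero in auto)
      then show ?thesis using 3 by (simp add: \<eta>'_def)
    qed
  qed
qed

section \<open>A weak ordinary differential equation\<close>

lemma integrable_lebesgue_on_subset:
  fixes f :: "'a::euclidean_space \<Rightarrow> 'b::euclidean_space"
  assumes "integrable (lebesgue_on S) f" "R \<subseteq> S" "R \<in> sets lebesgue" "S \<in> sets lebesgue"
  shows "integrable (lebesgue_on R) f"
proof -
  have "integrable lebesgue (\<lambda>x. indicat_real S x *\<^sub>R f x)"
    using assms by (simp add: integrable_restrict_space)
  then have "integrable lebesgue (\<lambda>x. indicat_real R x *\<^sub>R (indicat_real S x *\<^sub>R f x))"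
    by (rule integrable_mult_indicator[OF assms(3)])
  also have "(\<lambda>x. indicat_real R x *\<^sub>R (indicat_real S x *\<^sub>R f x)) = (\<lambda>x. indicat_real R x *\<^sub>R f x)"
    using assms(2) by (auto simp: indicator_def fun_eq_iff)
  finally show ?thesis using assms by (simp add: integrable_restrict_space)
qed

lemma lebesgue_integral_interval:
  fixes f :: "real \<Rightarrow> real"
  assumes "integrable (lebesgue_on {0<..<T}) f" "0 \<le> a" "b \<le> T"
  shows "integrable (lebesgue_on {a<..<b}) f" "f integrable_on {a..b}"
    "(LINT t|lebesgue_on {a<..<b}. f t) = integral {a..b} f"
proof -
  show *: "integrable (lebesgue_on {a<..<b}) f"
    by (rule integrable_lebesgue_on_subset[OF assms(1)]) (use assms in auto)
  have "f integrable_on {a<..<b}" by (rule integrable_on_lebesgue_on[OF *]) auto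
  then show "f integrable_on {a..b}" by (simp add: integrable_on_open_interval_real)
  show "(LINT t|lebesgue_on {a<..<b}. f t) = integral {a..b} f"
    using lebesgue_integral_eq_integral[OF *] by (simp add: integral_open_interval_real)
qed

text \<open>
  The hypothesis is the weak form of \<open>A' = - B\<close>, \<open>A(0) = A0\<close>, tested only with the cutoffs
  above.
\<close>

lemma weak_ode:
  fixes A B :: "real \<Rightarrow> real" and A0 :: real
  assumes T: "0 < T" and A: "continuous_on {0..T} A" and B: "integrable (lebesgue_on {0<..<T}) B"
    and eq: "\<And>\<tau> \<delta> \<eta> \<eta>'. \<lbrakk>0 \<le> \<tau>; 0 < \<delta>; \<tau> + \<delta> \<le> T;
        \<eta> = (\<lambda>t. max 0 (min 1 ((\<tau> + \<delta> - t) / \<delta>)));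
        \<eta>' = (\<lambda>t. if t \<in> {\<tau><..<\<tau> + \<delta>} then - 1 / \<delta> else 0)\<rbrakk> \<Longrightarrow>
      - (LINT t|lebesgue_on {0<..<T}. \<eta>' t * A t) + (LINT t|lebesgue_on {0<..<T}. \<eta> t * B t) = A0"
    and \<tau>: "0 \<le> \<tau>" "\<tau> < T"
  shows "A \<tau> = A0 - integral {0..\<tau>} B"
proof -
  \<comment> \<open>The widths of the cutoffs tend to zero, and the cutoffs end before \<open>T\<close>.\<close>
  define d where "d n = (T - \<tau>) / real (Suc n)" for n
  have d: "0 < d n" "\<tau> + d n \<le> T" for n
  proof -
    show "0 < d n" using \<tau> by (simp add: d_def)
    have "(T - \<tau>) / real (Suc n) \<le> (T - \<tau>) / 1" using \<tau> by (intro divide_left_mono) auto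
    then show "\<tau> + d n \<le> T" by (simp add: d_def)
  qed
  have d0: "d \<longlonglongrightarrow> 0"
    unfolding d_def using tendsto_mult[OF tendsto_const LIMSEQ_Suc[OF lim_1_over_n], of "T - \<tau>"] by simp
  define \<eta> where "\<eta> n t = max 0 (min 1 ((\<tau> + d n - t) / d n))" for n t
  note cut = piecewise_linear_cutoff[OF \<tau>(1) d, folded \<eta>_def]
  define I where "I t = integral {0..t} A" for t
  have Ai: "integrable (lebesgue_on {0<..<T}) A"
    by (rule integrable_lebesgue_on_subset[OF continuous_imp_integrable_real[OF A]]) auto
  have IA: "(LINT t|lebesgue_on {0<..<T}. (if t \<in> {\<tau><..<\<tau> + d n} then - 1 / d n else 0) * A t)
      = - ((I (\<tau> + d n) - I \<tau>) / d n)" for n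
  proof -
    have sub: "{\<tau><..<\<tau> + d n} \<subseteq> {0<..<T}" using \<tau>(1) d(2)[of n] by auto
    have io: "A integrable_on {0..\<tau> + d n}"
      by (rule integrable_continuous_real, rule continuous_on_subset[OF A]) (use d(2)[of n] in auto)
    have "(LINT t|lebesgue_on {0<..<T}. (if t \<in> {\<tau><..<\<tau> + d n} then - 1 / d n else 0) * A t)
        = (LINT t|lebesgue_on {0<..<T}. (if t \<in> {\<tau><..<\<tau> + d n} then - 1 / d n * A t else 0))"
      by (intro Bochner_Integration.integral_cong) auto
    also have "\<dots> = (LINT t|lebesgue_on {\<tau><..<\<tau> + d n}. - 1 / d n * A t)"
      by (rule integral_restrict[OF sub]) auto
    also have "\<dots> = - 1 / d n * integral {\<tau>..\<tau> + d n} A"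
      using lebesgue_integral_interval(3)[OF Ai \<tau>(1) d(2), of n] by simp
    also have "integral {\<tau>..\<tau> + d n} A = I (\<tau> + d n) - I \<tau>"
      using Henstock_Kurzweil_Integration.integral_combine[OF \<tau>(1) _ io] d(1)[of n] by (simp add: I_def)
    finally show ?thesis by simp
  qed
  have lim1: "(\<lambda>n. (I (\<tau> + d n) - I \<tau>) / d n) \<longlonglongrightarrow> A \<tau>"
  proof -
    have "(I has_real_derivative A \<tau>) (at \<tau> within {0..T})"
      unfolding I_def by (rule integral_has_real_derivative[OF A]) (use \<tau> in auto)
    then have D: "((\<lambda>y. (I y - I \<tau>) / (y - \<tau>)) \<longlongrightarrow> A \<tau>) (at \<tau> within {0..T})"
      by (simp add: has_field_derivative_iff)
    have "filterlim (\<lambda>n. \<tau> + d n) (at \<tau> within {0..T}) sequentially"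
      unfolding filterlim_at
      using d \<tau> tendsto_add[OF tendsto_const d0, of \<tau>]
      by (auto intro!: always_eventually simp: less_imp_neq[symmetric] less_imp_le add_nonneg_nonneg)
    from filterlim_compose[OF D this] show ?thesis by simp
  qed
  have Bm [measurable]: "B \<in> borel_measurable (lebesgue_on {0<..<T})" using B by auto
  have lim2: "(\<lambda>n. LINT t|lebesgue_on {0<..<T}. \<eta> n t * B t) \<longlonglongrightarrow>
      (LINT t|lebesgue_on {0<..<T}. (if t \<in> {0<..<\<tau>} then B t else 0))"
  proof (rule integral_dominated_convergence[where w = "\<lambda>t. \<bar>B t\<bar>"])
    show "(\<lambda>t. if t \<in> {0<..<\<tau>} then B t else 0) \<in> borel_measurable (lebesgue_on {0<..<T})"
    proof -
      have "(\<lambda>t. indicat_real {0<..<\<tau>} t) \<in> borel_measurable (lebesgue_on {0<..<T})"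
        by (intro measurable_restrict_space1 measurable_completion) measurable
      then have "(\<lambda>t. indicat_real {0<..<\<tau>} t * B t) \<in> borel_measurable (lebesgue_on {0<..<T})" by measurable
      also have "(\<lambda>t. indicat_real {0<..<\<tau>} t * B t) = (\<lambda>t. if t \<in> {0<..<\<tau>} then B t else 0)"
        by (auto simp: indicator_def)
      finally show ?thesis .
    qed
    show "(\<lambda>t. \<eta> n t * B t) \<in> borel_measurable (lebesgue_on {0<..<T})" for n
    proof -
      have "\<eta> n \<in> borel_measurable (lebesgue_on {0<..<T})"
        by (rule continuous_imp_measurable_on_sets_lebesgue)
           (auto intro: continuous_on_subset[OF cut(1)])
      then show ?thesis by measurable
    qed
    show "integrable (lebesgue_on {0<..<T}) (\<lambda>t. \<bar>B t\<bar>)" using B by simp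
    show "AE t in lebesgue_on {0<..<T}. norm (\<eta> n t * B t) \<le> \<bar>B t\<bar>" for n
      by (rule AE_I2) (use cut(7) in \<open>auto simp: abs_mult mult_left_le_one_le\<close>)
    have "AE t in lebesgue. t \<notin> {\<tau>}" by (rule AE_not_in) simp
    then have "AE t in lebesgue_on {0<..<T}. t \<noteq> \<tau>"
      by (auto simp: AE_restrict_space_iff elim!: eventually_mono)
    with AE_space show "AE t in lebesgue_on {0<..<T}. (\<lambda>n. \<eta> n t * B t) \<longlonglongrightarrow> (if t \<in> {0<..<\<tau>} then B t else 0)"
    proof eventually_elim
      case (elim t)
      show ?case
      proof (cases "t < \<tau>")
        case True
        then show ?thesis using elim cut(8) by simp
      next
        case False
        then have "\<forall>\<^sub>F n in sequentially. d n < t - \<tau>"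
          using elim order_tendstoD(2)[OF d0, of "t - \<tau>"] by simp
        then have "\<forall>\<^sub>F n in sequentially. \<eta> n t * B t = 0"
          by eventually_elim (use cut(9) in auto)
        then show ?thesis using False by (simp add: tendsto_eventually)
      qed
    qed
  qed
  have "(LINT t|lebesgue_on {0<..<T}. (if t \<in> {0<..<\<tau>} then B t else 0)) = (LINT t|lebesgue_on {0<..<\<tau>}. B t)"
    by (rule integral_restrict) (use \<tau> in auto)
  then have I2: "(LINT t|lebesgue_on {0<..<T}. (if t \<in> {0<..<\<tau>} then B t else 0)) = integral {0..\<tau>} B"
    using lebesgue_integral_interval(3)[OF B order_refl, of \<tau>] \<tau> by simp
  have "(\<lambda>n. (I (\<tau> + d n) - I \<tau>) / d n + (LINT t|lebesgue_on {0<..<T}. \<eta> n t * B t)) \<longlonglongrightarrow> A \<tau> + integral {0..\<tau>} B"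
    using tendsto_add[OF lim1 lim2] I2 by simp
  moreover have "(I (\<tau> + d n) - I \<tau>) / d n + (LINT t|lebesgue_on {0<..<T}. \<eta> n t * B t) = A0" for n
    using eq[OF \<tau>(1) d refl refl, of n] IA[of n] by (simp add: \<eta>_def)
  ultimately show ?thesis by (simp add: LIMSEQ_const_iff)
qed

section \<open>The current density\<close>

text \<open>
  If \<open>e\<close> is simple, the composition is a finite sum of measurable functions.  Simple approximations
  of \<open>e\<close> converge pointwise, and so do the compositions wherever \<open>f z\<close> is continuous.
\<close>

lemma caratheodory_measurable:
  fixes Q :: "(vec3 \<times> real) set"
  assumes Q: "Q \<in> sets borel" and f: "caratheodory Q f" and e: "e \<in> borel_measurable (lebesgue_on Q)"
  shows "(\<lambda>z. f z (e z)) \<in> borel_measurable (lebesgue_on Q)"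
proof -
  define M where "M = lebesgue_on Q"
  have sp: "space M = Q" by (simp add: M_def)
  have fm [measurable]: "(\<lambda>z. f z \<xi>) \<in> borel_measurable M" for \<xi>
    using f by (simp add: caratheodory_def M_def)
  obtain s where s: "\<And>i. simple_function M (s i)" "\<And>z. z \<in> space M \<Longrightarrow> (\<lambda>i. s i z) \<longlonglongrightarrow> e z"
    using borel_measurable_implies_sequence_metric[of e M 0] e unfolding M_def by metis
  have fs: "(\<lambda>z. f z (s i z)) \<in> borel_measurable M" for i
  proof -
    have fin: "finite (s i ` space M)" and A [measurable]: "\<And>y. s i -` {y} \<inter> space M \<in> sets M"
      using s(1)[of i] simple_functionD by blast+
    have "(\<lambda>z. \<Sum>y\<in>s i ` space M. indicat_real (s i -` {y} \<inter> space M) z *\<^sub>R f z y) \<in> borel_measurable M"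
      by measurable
    also have "?this \<longleftrightarrow> (\<lambda>z. f z (s i z)) \<in> borel_measurable M"
    proof (rule measurable_cong)
      fix z assume z: "z \<in> space M"
      have "(\<Sum>y\<in>s i ` space M. indicat_real (s i -` {y} \<inter> space M) z *\<^sub>R f z y)
          = (\<Sum>y\<in>s i ` space M. if y = s i z then f z y else 0)"
        using z by (intro sum.cong) (auto simp: indicator_def)
      also have "\<dots> = f z (s i z)" using fin z by simp
      finally show "(\<Sum>y\<in>s i ` space M. indicat_real (s i -` {y} \<inter> space M) z *\<^sub>R f z y) = f z (s i z)" .
    qed
    finally show ?thesis .
  qed
  have "AE z in M. continuous_on UNIV (f z)" using f unfolding caratheodory_def M_def by blast
  then obtain N where N: "N \<in> null_sets M" "\<And>z. z \<in> space M - N \<Longrightarrow> continuous_on UNIV (f z)"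
    by (rule AE_E3) blast
  have [measurable]: "N \<in> sets M" using N(1) by auto
  note [measurable] = fs
  have "(\<lambda>z. indicat_real (space M - N) z *\<^sub>R f z (e z)) \<in> borel_measurable M"
  proof (rule borel_measurable_LIMSEQ_metric)
    show "(\<lambda>z. indicat_real (space M - N) z *\<^sub>R f z (s i z)) \<in> borel_measurable M" for i by measurable
    fix z assume z: "z \<in> space M"
    show "(\<lambda>i. indicat_real (space M - N) z *\<^sub>R f z (s i z)) \<longlonglongrightarrow> indicat_real (space M - N) z *\<^sub>R f z (e z)"
    proof (cases "z \<in> N")
      case False
      then have "isCont (f z) (e z)" using N(2)[of z] z by (simp add: continuous_on_eq_continuous_at)
      then have "(\<lambda>i. f z (s i z)) \<longlonglongrightarrow> f z (e z)" using s(2)[OF z] by (rule isCont_tendsto_compose)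
      then show ?thesis by (intro tendsto_intros)
    qed simp
  qed
  then have "(\<lambda>z. indicat_real (space M - N) z *\<^sub>R f z (e z)) \<in> borel_measurable (lebesgue_on Q)"
    by (simp add: M_def)
  then show ?thesis
  proof (rule borel_measurable_lebesgue_on_AE[OF _ Q])
    have "AE z in M. z \<notin> N" using N(1) by (rule AE_not_in)
    with AE_space have "AE z in M. indicat_real (space M - N) z *\<^sub>R f z (e z) = f z (e z)"
      by eventually_elim auto
    then show "AE z in lebesgue_on Q. indicat_real (space M - N) z *\<^sub>R f z (e z) = f z (e z)"
      unfolding M_def .
  qed
qed

lemma current_L2:
  fixes Q :: "(vec3 \<times> real) set"
  assumes Q: "Q \<in> sets borel" and j: "\<And>z \<xi>. z \<in> Q \<Longrightarrow> j z \<xi> = j0 z + j1 z \<xi>"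
    and j0: "j0 \<in> L2 Q" and j1: "caratheodory Q j1"
    and c1: "\<And>z \<xi>. z \<in> Q \<Longrightarrow> norm (j1 z \<xi>) \<le> c1 * norm \<xi>" and e: "e \<in> L2 Q"
  shows "(\<lambda>z. j z (e z)) \<in> L2 Q"
proof -
  have "(\<lambda>z. j1 z (e z)) \<in> L2 Q"
    by (rule L2_dominated[OF e caratheodory_measurable[OF Q j1 L2_measurable[OF e]], of c1])
       (rule AE_I2, simp add: c1)
  from L2_add[OF j0 this] show ?thesis
    by (rule L2_AE_eq[OF _ Q AE_I2]) (simp add: j)
qed

section \<open>The field equations integrated in time\<close>

lemma material_field_mult_L2_QT:
  assumes \<Omega>: "open \<Omega>" and w: "material_field \<Omega> w" and u: "u \<in> L2 (QT \<Omega> T)"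
  shows "(\<lambda>z. w (fst z) *v u z) \<in> L2 (QT \<Omega> T)"
proof -
  have \<Omega>b: "\<Omega> \<in> sets borel" and Jb: "{0<..<T} \<in> sets borel" using \<Omega> by auto
  obtain C where C: "\<And>x \<xi>. x \<in> \<Omega> \<Longrightarrow> norm (w x *v \<xi>) \<le> C * norm \<xi>"
    using material_field_bound[OF w] by metis
  show ?thesis
  proof (rule L2_dominated[OF u])
    show "(\<lambda>z. w (fst z) *v u z) \<in> borel_measurable (lebesgue_on (QT \<Omega> T))"
    proof (rule matrix_mult_measurable[OF _ L2_measurable[OF u]])
      show "(\<lambda>z. w (fst z) $ i $ k) \<in> borel_measurable (lebesgue_on (QT \<Omega> T))" for i k
        unfolding QT_def by (rule lebesgue_on_Times_measurable(1)[OF \<Omega>b Jb])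
          (use w in \<open>simp add: material_field_def\<close>)
    qed
    show "AE z in lebesgue_on (QT \<Omega> T). norm (w (fst z) *v u z) \<le> C * norm (u z)"
      by (rule AE_I2) (auto simp: C QT_def)
  qed
qed

lemma C_H_L2: "v \<in> C_H \<Omega> T \<Longrightarrow> t \<in> {0..T} \<Longrightarrow> v t \<in> L2 \<Omega>"
  by (simp add: C_H_def)

lemma C_H_inner_continuous:
  assumes v: "v \<in> C_H \<Omega> T" and \<psi>: "\<psi> \<in> L2 \<Omega>"
  shows "continuous_on {0..T} (\<lambda>t. inner_H \<Omega> (v t) \<psi>)"
  unfolding continuous_on_def
proof
  fix t assume t: "t \<in> {0..T}"
  have "((\<lambda>s. inner_H \<Omega> (v s) \<psi> - inner_H \<Omega> (v t) \<psi>) \<longlongrightarrow> 0) (at t within {0..T})"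
  proof (rule Lim_null_comparison)
    show "((\<lambda>s. norm_H \<Omega> (\<lambda>x. v s x - v t x) * norm_H \<Omega> \<psi>) \<longlongrightarrow> 0) (at t within {0..T})"
      using v t by (intro tendsto_mult_left_zero) (auto simp: C_H_def)
    show "\<forall>\<^sub>F s in at t within {0..T}. norm (inner_H \<Omega> (v s) \<psi> - inner_H \<Omega> (v t) \<psi>)
        \<le> norm_H \<Omega> (\<lambda>x. v s x - v t x) * norm_H \<Omega> \<psi>"
      unfolding eventually_at_filter
    proof (rule always_eventually, intro allI impI)
      fix s assume "s \<in> {0..T}"
      note L = C_H_L2[OF v this] C_H_L2[OF v t]
      show "norm (inner_H \<Omega> (v s) \<psi> - inner_H \<Omega> (v t) \<psi>) \<le> norm_H \<Omega> (\<lambda>x. v s x - v t x) * norm_H \<Omega> \<psi>"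
        using inner_H_Cauchy_Schwarz[OF L2_diff[OF L] \<psi>] inner_H_diff_left[OF L \<psi>] by simp
    qed
  qed
  then show "((\<lambda>t. inner_H \<Omega> (v t) \<psi>) \<longlongrightarrow> inner_H \<Omega> (v t) \<psi>) (at t within {0..T})"
    by (rule Lim_null[THEN iffD2])
qed

lemma continuous_rep_AE:
  assumes \<Omega>: "open \<Omega>" and u: "u \<in> L2 (QT \<Omega> T)" and rep: "continuous_rep \<Omega> T u v"
  shows "AE t in lebesgue_on {0<..<T}. (\<lambda>x. u (x, t)) \<in> L2 \<Omega> \<and> v t \<in> L2 \<Omega> \<and>
    (AE x in lebesgue_on \<Omega>. v t x = u (x, t)) \<and>
    (\<forall>\<psi>\<in>L2 \<Omega>. inner_H \<Omega> (\<lambda>x. u (x, t)) \<psi> = inner_H \<Omega> (v t) \<psi>)"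
proof -
  have \<Omega>b: "\<Omega> \<in> sets borel" and Jb: "{0<..<T} \<in> sets borel" using \<Omega> by auto
  have v: "v \<in> C_H \<Omega> T" and AE: "AE t in lebesgue_on {0<..<T}. AE x in lebesgue_on \<Omega>. v t x = u (x, t)"
    using rep by (auto simp: continuous_rep_def)
  show ?thesis
    using L2_slices(1)[OF \<Omega>b Jb u[unfolded QT_def]] AE AE_space
  proof eventually_elim
    case (elim t)
    then have vt: "v t \<in> L2 \<Omega>" by (intro C_H_L2[OF v]) simp
    have "inner_H \<Omega> (\<lambda>x. u (x, t)) \<psi> = inner_H \<Omega> (v t) \<psi>" if "\<psi> \<in> L2 \<Omega>" for \<psi>
      by (rule inner_H_cong_AE[OF elim(1) vt that]) (use elim(2) in \<open>auto elim!: eventually_mono\<close>)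
    with elim vt show ?case by blast
  qed
qed

lemma QT_product_integral:
  assumes \<Omega>: "open \<Omega>" and p: "p \<in> L2 (QT \<Omega> T)" and k: "(\<lambda>z. k (snd z) *\<^sub>R \<psi> (fst z)) \<in> L2 (QT \<Omega> T)"
  shows "integrable (lebesgue_on {0<..<T}) (\<lambda>t. k t * inner_H \<Omega> (\<lambda>x. p (x, t)) \<psi>)"
    and "(LINT z|lebesgue_on (QT \<Omega> T). p z \<bullet> (k (snd z) *\<^sub>R \<psi> (fst z)))
      = (LINT t|lebesgue_on {0<..<T}. k t * inner_H \<Omega> (\<lambda>x. p (x, t)) \<psi>)"
proof -
  have b: "\<Omega> \<in> sets borel" "{0<..<T} \<in> sets borel" using \<Omega> by auto
  note Fub = lebesgue_on_Fubini[OF b L2_inner_integrable[OF p k, unfolded QT_def]]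
  show "integrable (lebesgue_on {0<..<T}) (\<lambda>t. k t * inner_H \<Omega> (\<lambda>x. p (x, t)) \<psi>)"
    using Fub(2) by (simp add: inner_H_def)
  show "(LINT z|lebesgue_on (QT \<Omega> T). p z \<bullet> (k (snd z) *\<^sub>R \<psi> (fst z)))
      = (LINT t|lebesgue_on {0<..<T}. k t * inner_H \<Omega> (\<lambda>x. p (x, t)) \<psi>)"
    using Fub(3) by (simp add: inner_H_def QT_def)
qed

text \<open>
  Both field equations have this form, where \<open>p\<close> is paired with the curl of the test field and \<open>q\<close>
  with the test field itself.  Testing with \<open>\<eta>(t) \<phi>(x)\<close> turns the equation into a weak ordinary
  differential equation for the scalar function \<open>t \<mapsto> \<integral> w v(t) \<bullet> \<phi>\<close>.
\<close>

lemma weak_equation_integrated: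
  fixes p q :: "vec3 \<times> real \<Rightarrow> vec3"
  assumes \<Omega>: "open \<Omega>" and T: "0 < T" and w: "material_field \<Omega> w"
    and u: "u \<in> L2 (QT \<Omega> T)" and rep: "continuous_rep \<Omega> T u v" and u0: "u0 \<in> L2 \<Omega>"
    and C: "has_weak_curl \<Omega> \<phi> C" and X: "\<And>c. (\<lambda>x. c *\<^sub>R \<phi> x) \<in> X"
    and p: "p \<in> L2 (QT \<Omega> T)" and q: "q \<in> L2 (QT \<Omega> T)"
    and eq: "\<And>\<Phi> G W \<Phi>c. admissible_test \<Omega> T X \<Phi> G W \<Phi>c \<Longrightarrow>
        - (LINT z|lebesgue_on (QT \<Omega> T). (w (fst z) *v u z) \<bullet> W z)
        + (LINT z|lebesgue_on (QT \<Omega> T). p z \<bullet> G z + q z \<bullet> \<Phi> z)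
        = (LINT x|lebesgue_on \<Omega>. (w x *v u0 x) \<bullet> \<Phi>c 0 x)"
    and \<tau>: "0 \<le> \<tau>" "\<tau> < T"
  shows "inner_H \<Omega> (\<lambda>x. w x *v v \<tau> x) \<phi> = inner_H \<Omega> (\<lambda>x. w x *v u0 x) \<phi>
      - integral {0..\<tau>} (\<lambda>t. inner_H \<Omega> (\<lambda>x. p (x, t)) C + inner_H \<Omega> (\<lambda>x. q (x, t)) \<phi>)"
proof -
  have \<Omega>b: "\<Omega> \<in> sets borel" and Jb: "{0<..<T} \<in> sets borel" using \<Omega> by auto
  have J: "{0<..<T} \<in> lmeasurable" by simp
  note \<phi> = has_weak_curl_L2(1)[OF C] and CL = has_weak_curl_L2(2)[OF C]
  have w\<phi>: "(\<lambda>x. w x *v \<phi> x) \<in> L2 \<Omega>" by (rule material_field_mult_L2[OF w \<phi>])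
  have v: "v \<in> C_H \<Omega> T" using rep by (simp add: continuous_rep_def)
  define A where "A t = inner_H \<Omega> (v t) (\<lambda>x. w x *v \<phi> x)" for t
  have A: "continuous_on {0..T} A" unfolding A_def by (rule C_H_inner_continuous[OF v w\<phi>])
  have sym: "inner_H \<Omega> (\<lambda>x. w x *v f x) \<phi> = inner_H \<Omega> f (\<lambda>x. w x *v \<phi> x)" for f
    using material_field_symmetric[OF w, of f \<phi>] by (simp add: inner_H_commute)
  define B where "B t = inner_H \<Omega> (\<lambda>x. p (x, t)) C + inner_H \<Omega> (\<lambda>x. q (x, t)) \<phi>" for t
  have B: "integrable (lebesgue_on {0<..<T}) B" unfolding B_def
    by (intro Bochner_Integration.integrable_add L2_time_integral(2)[OF \<Omega>b Jb J] p[unfolded QT_def] q[unfolded QT_def] CL \<phi>)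
  have "A \<tau> = inner_H \<Omega> (\<lambda>x. w x *v u0 x) \<phi> - integral {0..\<tau>} B"
  proof (rule weak_ode[OF T A B _ \<tau>])
    fix \<sigma> \<delta> and \<eta> \<eta>' :: "real \<Rightarrow> real"
    assume \<sigma>: "0 \<le> \<sigma>" "0 < \<delta>" "\<sigma> + \<delta> \<le> T"
      and \<eta>_def: "\<eta> = (\<lambda>t. max 0 (min 1 ((\<sigma> + \<delta> - t) / \<delta>)))"
      and \<eta>'_def: "\<eta>' = (\<lambda>t. if t \<in> {\<sigma><..<\<sigma> + \<delta>} then - 1 / \<delta> else 0)"
    have cut: "continuous_on {0..T} \<eta>" "\<eta> T = 0" "\<eta> 0 = 1"
      "\<And>t. t \<notin> {\<sigma>, \<sigma> + \<delta>} \<Longrightarrow> (\<eta> has_real_derivative \<eta>' t) (at t)"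
      "\<eta>' \<in> borel_measurable (lebesgue_on {0<..<T})" "\<And>t. \<bar>\<eta>' t\<bar> \<le> 1 / \<delta>"
      unfolding \<eta>_def \<eta>'_def by (rule piecewise_linear_cutoff(1-6)[OF \<sigma>]; assumption)+
    have adm: "admissible_test \<Omega> T X (\<lambda>z. \<eta> (snd z) *\<^sub>R \<phi> (fst z)) (\<lambda>z. \<eta> (snd z) *\<^sub>R C (fst z))
      (\<lambda>z. \<eta>' (snd z) *\<^sub>R \<phi> (fst z)) (\<lambda>t x. \<eta> t *\<^sub>R \<phi> x)"
      by (rule product_admissible_test[OF \<Omega> T C X cut(1,2) _ cut(4) cut(5,6), of "{\<sigma>, \<sigma> + \<delta>}"]) auto
    then have \<Phi>L: "(\<lambda>z. \<eta> (snd z) *\<^sub>R \<phi> (fst z)) \<in> L2 (QT \<Omega> T)"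
      and GL: "(\<lambda>z. \<eta> (snd z) *\<^sub>R C (fst z)) \<in> L2 (QT \<Omega> T)"
      and WL: "(\<lambda>z. \<eta>' (snd z) *\<^sub>R \<phi> (fst z)) \<in> L2 (QT \<Omega> T)"
      unfolding admissible_test_def has_curl_field_def has_weak_dt_def by blast+
    have Am: "A \<in> borel_measurable (lebesgue_on {0<..<T})"
      by (rule continuous_imp_measurable_on_sets_lebesgue)
         (auto intro: continuous_on_subset[OF A])
    have I1: "(LINT z|lebesgue_on (QT \<Omega> T). (w (fst z) *v u z) \<bullet> (\<eta>' (snd z) *\<^sub>R \<phi> (fst z)))
        = (LINT t|lebesgue_on {0<..<T}. \<eta>' t * A t)"
    proof -
      note Q = QT_product_integral[OF \<Omega> material_field_mult_L2_QT[OF \<Omega> w u] WL]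
      show ?thesis unfolding Q(2)
      proof (rule integral_cong_AE[OF borel_measurable_integrable[OF Q(1)] borel_measurable_times[OF cut(5) Am]])
        show "AE t in lebesgue_on {0<..<T}. \<eta>' t * inner_H \<Omega> (\<lambda>x. w (fst (x, t)) *v u (x, t)) \<phi> = \<eta>' t * A t"
          using continuous_rep_AE[OF \<Omega> u rep] by eventually_elim (use w\<phi> in \<open>simp add: sym A_def\<close>)
      qed
    qed
    note Qp = QT_product_integral[OF \<Omega> p GL] and Qq = QT_product_integral[OF \<Omega> q \<Phi>L]
    have I2: "(LINT z|lebesgue_on (QT \<Omega> T). p z \<bullet> (\<eta> (snd z) *\<^sub>R C (fst z)) + q z \<bullet> (\<eta> (snd z) *\<^sub>R \<phi> (fst z)))
        = (LINT t|lebesgue_on {0<..<T}. \<eta> t * B t)"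
      unfolding Bochner_Integration.integral_add[OF L2_inner_integrable[OF p GL] L2_inner_integrable[OF q \<Phi>L]]
        Qp(2) Qq(2) Bochner_Integration.integral_add[OF Qp(1) Qq(1), symmetric]
      by (simp add: B_def distrib_left)
    have "(LINT x|lebesgue_on \<Omega>. (w x *v u0 x) \<bullet> (\<eta> 0 *\<^sub>R \<phi> x)) = inner_H \<Omega> (\<lambda>x. w x *v u0 x) \<phi>"
      unfolding cut(3) by (simp add: inner_H_def)
    then show "- (LINT t|lebesgue_on {0<..<T}. \<eta>' t * A t) + (LINT t|lebesgue_on {0<..<T}. \<eta> t * B t)
        = inner_H \<Omega> (\<lambda>x. w x *v u0 x) \<phi>"
      using eq[OF adm] I1 I2 by simp
  qed
  then show ?thesis unfolding A_def B_def[abs_def] sym .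
qed

section \<open>From increments to an energy balance\<close>

lemma integral_near_constant:
  fixes g :: "real \<Rightarrow> real"
  assumes g: "continuous_on {a..b} g" and ab: "a \<le> b" and near: "\<And>t. t \<in> {a..b} \<Longrightarrow> \<bar>g t - c\<bar> \<le> \<kappa>"
  shows "\<bar>integral {a..b} g - (b - a) * c\<bar> \<le> (b - a) * \<kappa>"
proof -
  have gi: "g integrable_on {a..b}" by (rule integrable_continuous_real[OF g])
  have "norm (integral {a..b} (\<lambda>t. g t - c)) \<le> integral {a..b} (\<lambda>t. \<kappa>)"
    by (rule integral_norm_bound_integral) (use near gi in \<open>auto intro!: integrable_diff\<close>)
  moreover have "integral {a..b} (\<lambda>t. g t - c) = integral {a..b} g - (b - a) * c"
    using Henstock_Kurzweil_Integration.integral_diff[OF gi integrable_const_ivl[of c a b]] ab by simp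
  ultimately show ?thesis using ab by simp
qed

lemma integral_increment:
  fixes g :: "real \<Rightarrow> real"
  assumes g: "continuous_on UNIV g" and "0 \<le> \<tau>" "0 \<le> x"
  shows "integral {x..\<tau> + x} g - integral {0..\<tau>} g = integral {\<tau>..\<tau> + x} g - integral {0..x} g"
proof -
  have "g integrable_on {0..\<tau> + x}"
    by (rule integrable_continuous_real[OF continuous_on_subset[OF g]]) auto
  then show ?thesis
    using Henstock_Kurzweil_Integration.integral_combine[of 0 x "\<tau> + x" g]
      Henstock_Kurzweil_Integration.integral_combine[of 0 \<tau> "\<tau> + x" g] assms by simp
qed

text \<open>
  Put \<open>G t = F (t + (\<delta> - x)) t\<close>.  After the substitution \<open>s = t + x\<close> and an exchange of the order of
  integration, the term \<open>F (t + \<delta>) (t + x)\<close> contributes the integral of \<open>G\<close> over \<open>[x, \<tau> + x]\<close>.  By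
  symmetry, and after replacing \<open>x\<close> by \<open>\<delta> - x\<close>, the term \<open>F t (t + x)\<close> contributes the integral of
  the same \<open>G\<close> over \<open>[0, \<tau>]\<close>.  Only the two end pieces survive.
\<close>

lemma symmetric_increment_integral:
  fixes F :: "real \<Rightarrow> real \<Rightarrow> real"
  assumes F: "continuous_on UNIV (\<lambda>(r, s). F r s)" and sym: "\<And>r s. F r s = F s r"
    and \<tau>: "0 \<le> \<tau>" and \<delta>: "0 < \<delta>"
  defines "D \<equiv> \<lambda>x. integral {\<tau>..\<tau> + x} (\<lambda>t. F (t + (\<delta> - x)) t) - integral {0..x} (\<lambda>t. F (t + (\<delta> - x)) t)"
  shows "D integrable_on {0..\<delta>}"
    and "(\<lambda>t. integral {t..t + \<delta>} (\<lambda>s. F (t + \<delta>) s - F t s)) integrable_on {0..\<tau>}"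
    and "integral {0..\<tau>} (\<lambda>t. integral {t..t + \<delta>} (\<lambda>s. F (t + \<delta>) s - F t s)) = integral {0..\<delta>} D"
proof -
  have Fc: "continuous_on S (\<lambda>z. F (f z) (g z))" if "continuous_on S f" "continuous_on S g"
    for S and f g :: "'z::topological_space \<Rightarrow> real"
    using continuous_on_compose2[OF F continuous_on_Pair[OF that]] by simp
  have inner: "integral {t..t + \<delta>} (\<lambda>s. F (t + \<delta>) s - F t s)
      = integral {0..\<delta>} (\<lambda>x. F (t + \<delta>) (t + x) - F t (t + x))" for t
    using integral_shift_real_ivl[of t t "t + \<delta>" "\<lambda>s. F (t + \<delta>) s - F t s"] by (simp add: add.commute)
  have cont2: "continuous_on (cbox (0, 0) (\<tau>, \<delta>)) (\<lambda>(t, x). F (t + \<delta>) (t + x) - F t (t + x))"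
    unfolding case_prod_beta' by (intro continuous_intros Fc)
  have "continuous_on {0..\<tau>} (\<lambda>t. integral (cbox 0 \<delta>) (\<lambda>x. F (t + \<delta>) (t + x) - F t (t + x)))"
    by (rule integral_continuous_on_param) (use cont2 in \<open>simp add: cbox_Pair_eq\<close>)
  then show "(\<lambda>t. integral {t..t + \<delta>} (\<lambda>s. F (t + \<delta>) s - F t s)) integrable_on {0..\<tau>}"
    unfolding inner by (intro integrable_continuous_real) simp
  define A where "A x = integral {0..\<tau>} (\<lambda>t. F (t + \<delta>) (t + x))" for x
  define C where "C x = integral {0..\<tau>} (\<lambda>t. F t (t + x))" for x
  have Ac: "continuous_on {0..\<delta>} A" and Cc: "continuous_on {0..\<delta>} C"
    unfolding A_def C_def
    using integral_continuous_on_param[of "{0..\<delta>}" 0 \<tau> "\<lambda>x t. F (t + \<delta>) (t + x)"]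
      integral_continuous_on_param[of "{0..\<delta>}" 0 \<tau> "\<lambda>x t. F t (t + x)"]
    by (simp_all add: case_prod_beta' Fc continuous_intros)
  have Cr: "continuous_on {0..\<delta>} (\<lambda>x. C (\<delta> - x))"
    by (rule continuous_on_compose2[OF Cc]) (auto intro!: continuous_intros)
  have D: "D x = A x - C (\<delta> - x)" if x: "x \<in> {0..\<delta>}" for x
  proof -
    define G where "G t = F (t + (\<delta> - x)) t" for t
    have "A x = integral {x..\<tau> + x} G"
      unfolding A_def G_def
      using integral_shift_real_ivl[of x x "\<tau> + x" "\<lambda>t. F (t + (\<delta> - x)) t"] by (simp add: algebra_simps)
    moreover have "C (\<delta> - x) = integral {0..\<tau>} G" unfolding C_def G_def by (simp add: sym)
    moreover have "continuous_on UNIV G" unfolding G_def by (intro Fc continuous_intros)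
    ultimately show ?thesis
      using integral_increment[of G \<tau> x] \<tau> x by (simp add: D_def G_def[abs_def])
  qed
  have "(\<lambda>x. A x - C (\<delta> - x)) integrable_on {0..\<delta>}"
    by (intro integrable_continuous_real continuous_intros Ac Cr)
  then show "D integrable_on {0..\<delta>}" by (rule integrable_eq) (simp add: D)
  have "integral {0..\<tau>} (\<lambda>t. integral {t..t + \<delta>} (\<lambda>s. F (t + \<delta>) s - F t s))
      = integral {0..\<delta>} (\<lambda>x. integral {0..\<tau>} (\<lambda>t. F (t + \<delta>) (t + x) - F t (t + x)))"
    unfolding inner using integral_swap_continuous[OF cont2] by simp
  also have "\<dots> = integral {0..\<delta>} (\<lambda>x. A x - C x)"
    unfolding A_def C_def
    by (intro Henstock_Kurzweil_Integration.integral_cong Henstock_Kurzweil_Integration.integral_diff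
        integrable_continuous_real Fc continuous_intros)
  also have "\<dots> = integral {0..\<delta>} A - integral {0..\<delta>} C"
    by (intro Henstock_Kurzweil_Integration.integral_diff integrable_continuous_real Ac Cc)
  also have "integral {0..\<delta>} C = integral {0..\<delta>} (\<lambda>x. C (\<delta> - x))"
    using integral_shift_real_ivl[of "- \<delta>" "- \<delta>" 0 "\<lambda>x. C (- x)"] Henstock_Kurzweil_Integration.integral_reflect_real[of \<delta> 0 C] by simp
  also have "integral {0..\<delta>} A - \<dots> = integral {0..\<delta>} (\<lambda>x. A x - C (\<delta> - x))"
    by (intro Henstock_Kurzweil_Integration.integral_diff[symmetric] integrable_continuous_real Ac Cr)
  also have "\<dots> = integral {0..\<delta>} D"
    by (rule Henstock_Kurzweil_Integration.integral_cong) (simp add: D)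
  finally show "integral {0..\<tau>} (\<lambda>t. integral {t..t + \<delta>} (\<lambda>s. F (t + \<delta>) s - F t s)) = integral {0..\<delta>} D" .
qed

text \<open>
  If \<open>F\<close>, \<open>P\<close> and \<open>N\<close> were differentiable, division by \<open>(b - a)\<^sup>2\<close> and \<open>b \<rightarrow> a\<close> would give
  \<open>d/dt (F t t / 2 + P t) = 0\<close>, because \<open>\<partial>\<^sub>1 F t t\<close> is half the derivative of \<open>F t t\<close> for symmetric \<open>F\<close>.
  For \<open>F\<close> merely continuous the hypothesis is used on \<open>[t, t + \<delta>]\<close> and integrated over \<open>t\<close> in
  \<open>[0, \<tau>]\<close>.  By \<open>symmetric_increment_integral\<close> the first term then is an integral over two
  triangles of area \<open>\<delta>\<^sup>2 / 2\<close> near \<open>(\<tau>, \<tau>)\<close> and \<open>(0, 0)\<close>, so it is close to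
  \<open>\<delta>\<^sup>2 (F \<tau> \<tau> - F 0 0) / 2\<close>; the term with \<open>P\<close> is close to \<open>\<delta>\<^sup>2 (P \<tau> - P 0)\<close>, and the right-hand side is
  at most \<open>\<delta>\<^sup>2 \<kappa> N(T)\<close>.
\<close>

lemma energy_balance_from_increments:
  fixes F :: "real \<Rightarrow> real \<Rightarrow> real" and P N :: "real \<Rightarrow> real"
  assumes F: "continuous_on UNIV (\<lambda>(r, s). F r s)" and sym: "\<And>r s. F r s = F s r"
    and P: "continuous_on UNIV P" and N: "continuous_on UNIV N"
    and Nmono: "\<And>s t. 0 \<le> s \<Longrightarrow> s \<le> t \<Longrightarrow> t \<le> T \<Longrightarrow> N s \<le> N t" and N0: "0 \<le> N 0"
    and incr: "\<And>\<kappa>. 0 < \<kappa> \<Longrightarrow> \<exists>d>0. \<forall>a b. 0 \<le> a \<longrightarrow> a < b \<longrightarrow> b < T \<longrightarrow> b - a < d \<longrightarrow>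
      \<bar>integral {a..b} (\<lambda>s. F b s - F a s) + (b - a) * (P b - P a)\<bar> \<le> (b - a) * \<kappa> * (N b - N a)"
    and \<tau>: "0 \<le> \<tau>" "\<tau> < T"
  shows "F \<tau> \<tau> / 2 + P \<tau> = F 0 0 / 2 + P 0"
proof -
  have local: "\<exists>d>0. (\<forall>r s. \<bar>r - t\<bar> < d \<longrightarrow> \<bar>s - t\<bar> < d \<longrightarrow> \<bar>F r s - F t t\<bar> \<le> \<kappa>) \<and>
      (\<forall>s. \<bar>s - t\<bar> < d \<longrightarrow> \<bar>P s - P t\<bar> \<le> \<kappa>)" if \<kappa>: "0 < \<kappa>" for t \<kappa>
  proof -
    have "isCont (\<lambda>(r, s). F r s) (t, t)" using F by (simp add: continuous_on_eq_continuous_at)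
    then obtain d1 where d1: "0 < d1"
      "\<And>z. dist z (t, t) < d1 \<Longrightarrow> dist (case z of (r, s) \<Rightarrow> F r s) (F t t) < \<kappa>"
      using \<kappa> unfolding continuous_at_eps_delta by (metis case_prod_conv)
    have "isCont P t" using P by (simp add: continuous_on_eq_continuous_at)
    then obtain d2 where d2: "0 < d2" "\<And>s. dist s t < d2 \<Longrightarrow> dist (P s) (P t) < \<kappa>"
      using \<kappa> unfolding continuous_at_eps_delta by metis
    have "\<bar>F r s - F t t\<bar> \<le> \<kappa>" if "\<bar>r - t\<bar> < d1 / 2" "\<bar>s - t\<bar> < d1 / 2" for r s
    proof -
      have "dist (r, s) (t, t) \<le> dist r t + dist s t"
        unfolding dist_Pair_Pair by (rule sqrt_sum_squares_le_sum) auto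
      also have "\<dots> < d1" using that by (simp add: dist_real_def)
      finally show ?thesis using d1(2)[of "(r, s)"] by (simp add: dist_real_def)
    qed
    then show ?thesis using d1(1) d2
      by (intro exI[of _ "min (d1 / 2) d2"]) (auto simp: dist_real_def less_imp_le)
  qed
  have key: "\<bar>(F \<tau> \<tau> / 2 + P \<tau>) - (F 0 0 / 2 + P 0)\<bar> \<le> \<kappa> * (N T + 4)" if \<kappa>: "0 < \<kappa>" for \<kappa>
  proof -
    obtain d where d: "0 < d" and inc: "\<And>a b. 0 \<le> a \<Longrightarrow> a < b \<Longrightarrow> b < T \<Longrightarrow> b - a < d \<Longrightarrow>
      \<bar>integral {a..b} (\<lambda>s. F b s - F a s) + (b - a) * (P b - P a)\<bar> \<le> (b - a) * \<kappa> * (N b - N a)"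
      using incr[OF \<kappa>] by metis
    obtain d1 where d1: "0 < d1" "\<And>r s. \<bar>r - 0\<bar> < d1 \<Longrightarrow> \<bar>s - 0\<bar> < d1 \<Longrightarrow> \<bar>F r s - F 0 0\<bar> \<le> \<kappa>"
      "\<And>s. \<bar>s - 0\<bar> < d1 \<Longrightarrow> \<bar>P s - P 0\<bar> \<le> \<kappa>"
      using local[OF \<kappa>, of 0] by metis
    obtain d2 where d2: "0 < d2" "\<And>r s. \<bar>r - \<tau>\<bar> < d2 \<Longrightarrow> \<bar>s - \<tau>\<bar> < d2 \<Longrightarrow> \<bar>F r s - F \<tau> \<tau>\<bar> \<le> \<kappa>"
      "\<And>s. \<bar>s - \<tau>\<bar> < d2 \<Longrightarrow> \<bar>P s - P \<tau>\<bar> \<le> \<kappa>"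
      using local[OF \<kappa>, of \<tau>] by metis
    \<comment> \<open>The factor 1/2 in the definition of \<open>\<delta>\<close> makes all four bounds strict.\<close>
    define m where "m = min (min d (T - \<tau>)) (min d1 d2)"
    have m: "0 < m" "m \<le> d" "m \<le> T - \<tau>" "m \<le> d1" "m \<le> d2"
      using d d1(1) d2(1) \<tau> by (auto simp: m_def)
    define \<delta> where "\<delta> = m / 2"
    have \<delta>: "0 < \<delta>" "\<delta> < d" "\<tau> + \<delta> < T" "\<delta> < d1" "\<delta> < d2"
      using m unfolding \<delta>_def by linarith+
    define D where "D x = integral {\<tau>..\<tau> + x} (\<lambda>t. F (t + (\<delta> - x)) t) - integral {0..x} (\<lambda>t. F (t + (\<delta> - x)) t)" for x
    define g where "g t = integral {t..t + \<delta>} (\<lambda>s. F (t + \<delta>) s - F t s)" for t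
    note Dg = symmetric_increment_integral[OF F sym \<tau>(1) \<delta>(1), folded D_def[abs_def] g_def[abs_def]]
    have ci: "h integrable_on {a..b}" if "continuous_on UNIV h" for h :: "real \<Rightarrow> real" and a b
      by (rule integrable_continuous_real[OF continuous_on_subset[OF that]]) auto
    have shift: "continuous_on UNIV (\<lambda>t. h (t + \<delta>))"
      and mean: "integral {0..\<tau>} (\<lambda>t. h (t + \<delta>) - h t) = integral {\<tau>..\<tau> + \<delta>} h - integral {0..\<delta>} h"
      if h: "continuous_on UNIV h" for h :: "real \<Rightarrow> real"
    proof -
      show s: "continuous_on UNIV (\<lambda>t. h (t + \<delta>))"
        by (rule continuous_on_compose2[OF h]) (auto intro!: continuous_intros)
      show "integral {0..\<tau>} (\<lambda>t. h (t + \<delta>) - h t) = integral {\<tau>..\<tau> + \<delta>} h - integral {0..\<delta>} h"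
        using Henstock_Kurzweil_Integration.integral_diff[OF ci[OF s] ci[OF h], of 0 \<tau>]
          integral_shift_real_ivl[of \<delta> \<delta> "\<tau> + \<delta>" h] integral_increment[OF h \<tau>(1), of \<delta>] \<delta> by simp
    qed
    have D_near: "\<bar>D x - x * (F \<tau> \<tau> - F 0 0)\<bar> \<le> 2 * \<delta> * \<kappa>" if x: "x \<in> {0..\<delta>}" for x
    proof -
      have Gc: "continuous_on S (\<lambda>t. F (t + (\<delta> - x)) t)" for S
        using continuous_on_compose2[OF F, of S "\<lambda>t. (t + (\<delta> - x), t)"] by (simp add: continuous_intros)
      have "\<bar>integral {\<tau>..\<tau> + x} (\<lambda>t. F (t + (\<delta> - x)) t) - (\<tau> + x - \<tau>) * F \<tau> \<tau>\<bar> \<le> (\<tau> + x - \<tau>) * \<kappa>"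
        by (rule integral_near_constant[OF Gc]) (use x \<delta> in \<open>auto intro!: d2(2)\<close>)
      moreover have "\<bar>integral {0..x} (\<lambda>t. F (t + (\<delta> - x)) t) - (x - 0) * F 0 0\<bar> \<le> (x - 0) * \<kappa>"
        by (rule integral_near_constant[OF Gc]) (use x \<delta> in \<open>auto intro!: d1(2)\<close>)
      moreover have "x * \<kappa> \<le> \<delta> * \<kappa>" using x \<kappa> by (intro mult_right_mono) auto
      ultimately show ?thesis by (simp add: D_def algebra_simps)
    qed
    have "norm (integral {0..\<delta>} (\<lambda>x. D x - x * (F \<tau> \<tau> - F 0 0))) \<le> integral {0..\<delta>} (\<lambda>x. 2 * \<delta> * \<kappa>)"
      by (rule integral_norm_bound_integral)
         (use D_near in \<open>auto intro!: integrable_diff[OF Dg(1) ci] continuous_intros\<close>)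
    moreover have "integral {0..\<delta>} (\<lambda>x. D x - x * (F \<tau> \<tau> - F 0 0)) = integral {0..\<delta>} D - \<delta>\<^sup>2 / 2 * (F \<tau> \<tau> - F 0 0)"
      using Henstock_Kurzweil_Integration.integral_diff[OF Dg(1) ci[of "\<lambda>x. x * (F \<tau> \<tau> - F 0 0)"]]
        ident_has_integral[of 0 \<delta>] \<delta>(1) by (simp add: continuous_intros integral_unique)
    ultimately have 1: "\<bar>integral {0..\<tau>} g - \<delta>\<^sup>2 / 2 * (F \<tau> \<tau> - F 0 0)\<bar> \<le> 2 * (\<delta>\<^sup>2 * \<kappa>)"
      using \<delta>(1) Dg(3) by (simp add: power2_eq_square)
    have "\<bar>integral {\<tau>..\<tau> + \<delta>} P - (\<tau> + \<delta> - \<tau>) * P \<tau>\<bar> \<le> (\<tau> + \<delta> - \<tau>) * \<kappa>"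
      by (rule integral_near_constant[OF continuous_on_subset[OF P]]) (use \<delta> in \<open>auto intro!: d2(3)\<close>)
    moreover have "\<bar>integral {0..\<delta>} P - (\<delta> - 0) * P 0\<bar> \<le> (\<delta> - 0) * \<kappa>"
      by (rule integral_near_constant[OF continuous_on_subset[OF P]]) (use \<delta> in \<open>auto intro!: d1(3)\<close>)
    ultimately have "\<bar>integral {0..\<tau>} (\<lambda>t. P (t + \<delta>) - P t) - \<delta> * (P \<tau> - P 0)\<bar> \<le> 2 * (\<delta> * \<kappa>)"
      unfolding mean[OF P] by (simp add: algebra_simps)
    then have "\<delta> * \<bar>integral {0..\<tau>} (\<lambda>t. P (t + \<delta>) - P t) - \<delta> * (P \<tau> - P 0)\<bar> \<le> \<delta> * (2 * (\<delta> * \<kappa>))"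
      using \<delta>(1) by (intro mult_left_mono) auto
    then have 2: "\<bar>\<delta> * integral {0..\<tau>} (\<lambda>t. P (t + \<delta>) - P t) - \<delta>\<^sup>2 * (P \<tau> - P 0)\<bar> \<le> 2 * (\<delta>\<^sup>2 * \<kappa>)"
      using \<delta>(1) by (simp add: abs_mult_pos' power2_eq_square algebra_simps flip: abs_mult)
    have Pi: "(\<lambda>t. \<delta> * (P (t + \<delta>) - P t)) integrable_on {0..\<tau>}"
      and Ni: "(\<lambda>t. \<delta> * \<kappa> * (N (t + \<delta>) - N t)) integrable_on {0..\<tau>}"
      by (intro ci continuous_intros shift P N)+
    have "norm (integral {0..\<tau>} (\<lambda>t. g t + \<delta> * (P (t + \<delta>) - P t))) \<le> integral {0..\<tau>} (\<lambda>t. \<delta> * \<kappa> * (N (t + \<delta>) - N t))"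
    proof (rule integral_norm_bound_integral[OF integrable_add[OF Dg(2) Pi] Ni])
      fix t assume "t \<in> {0..\<tau>}"
      then show "norm (g t + \<delta> * (P (t + \<delta>) - P t)) \<le> \<delta> * \<kappa> * (N (t + \<delta>) - N t)"
        using inc[of t "t + \<delta>"] \<delta> by (simp add: g_def)
    qed
    also have "\<dots> = \<delta> * \<kappa> * (integral {\<tau>..\<tau> + \<delta>} N - integral {0..\<delta>} N)"
      using mean[OF N] by simp
    also have "\<dots> \<le> \<delta> * \<kappa> * (\<delta> * N T)"
    proof (rule mult_left_mono)
      have "integral {\<tau>..\<tau> + \<delta>} N \<le> integral {\<tau>..\<tau> + \<delta>} (\<lambda>t. N T)"
        by (rule integral_le) (use Nmono \<tau> \<delta> ci[OF N] in auto)
      moreover have "0 \<le> integral {0..\<delta>} N"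
        by (rule integral_nonneg[OF ci[OF N]]) (use N0 Nmono[of 0] \<delta> \<tau> in force)
      ultimately show "integral {\<tau>..\<tau> + \<delta>} N - integral {0..\<delta>} N \<le> \<delta> * N T" using \<delta> by simp
    qed (use \<delta> \<kappa> in simp)
    also have "integral {0..\<tau>} (\<lambda>t. g t + \<delta> * (P (t + \<delta>) - P t))
        = integral {0..\<tau>} g + \<delta> * integral {0..\<tau>} (\<lambda>t. P (t + \<delta>) - P t)"
      using Henstock_Kurzweil_Integration.integral_add[OF Dg(2) Pi] by simp
    finally have 3: "\<bar>integral {0..\<tau>} g + \<delta> * integral {0..\<tau>} (\<lambda>t. P (t + \<delta>) - P t)\<bar> \<le> \<delta>\<^sup>2 * (\<kappa> * N T)"
      by (simp add: power2_eq_square mult_ac)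
    have "\<delta>\<^sup>2 * \<bar>(F \<tau> \<tau> / 2 + P \<tau>) - (F 0 0 / 2 + P 0)\<bar>
        = \<bar>\<delta>\<^sup>2 * ((F \<tau> \<tau> / 2 + P \<tau>) - (F 0 0 / 2 + P 0))\<bar>"
      by (simp add: abs_mult)
    also have "\<delta>\<^sup>2 * ((F \<tau> \<tau> / 2 + P \<tau>) - (F 0 0 / 2 + P 0))
        = \<delta>\<^sup>2 / 2 * (F \<tau> \<tau> - F 0 0) + \<delta>\<^sup>2 * (P \<tau> - P 0)"
      by (simp add: field_simps)
    also have "\<bar>\<delta>\<^sup>2 / 2 * (F \<tau> \<tau> - F 0 0) + \<delta>\<^sup>2 * (P \<tau> - P 0)\<bar>
        \<le> \<delta>\<^sup>2 * (\<kappa> * N T) + 2 * (\<delta>\<^sup>2 * \<kappa>) + 2 * (\<delta>\<^sup>2 * \<kappa>)"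
      using 1 2 3 by linarith
    also have "\<dots> = \<delta>\<^sup>2 * (\<kappa> * (N T + 4))" by (simp add: algebra_simps)
    finally show ?thesis using \<delta>(1) by (simp add: mult_le_cancel_left_pos)
  qed
  have NT: "0 \<le> N T" using N0 Nmono[of 0 T] \<tau> by simp
  have "\<bar>(F \<tau> \<tau> / 2 + P \<tau>) - (F 0 0 / 2 + P 0)\<bar> \<le> 0 + e" if "0 < e" for e
    using key[of "e / (N T + 4)"] that NT by simp
  then have "\<bar>(F \<tau> \<tau> / 2 + P \<tau>) - (F 0 0 / 2 + P 0)\<bar> \<le> 0" by (rule field_le_epsilon)
  then show ?thesis by simp
qed

section \<open>Fields that depend continuously on time\<close>

lemma material_field_norm_H_bound:
  assumes w: "material_field \<Omega> w"
  obtains C where "0 \<le> C" "\<And>u. u \<in> L2 \<Omega> \<Longrightarrow> norm_H \<Omega> (\<lambda>x. w x *v u x) \<le> C * norm_H \<Omega> u"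
proof -
  obtain C where C: "0 \<le> C" "\<And>x \<xi>. x \<in> \<Omega> \<Longrightarrow> norm (w x *v \<xi>) \<le> C * norm \<xi>"
    using material_field_bound[OF w] by metis
  have "norm_H \<Omega> (\<lambda>x. w x *v u x) \<le> C * norm_H \<Omega> u" if u: "u \<in> L2 \<Omega>" for u
  proof (rule power2_le_imp_le)
    have "inner_H \<Omega> (\<lambda>x. w x *v u x) (\<lambda>x. w x *v u x) \<le> (LINT x|lebesgue_on \<Omega>. C\<^sup>2 * (u x \<bullet> u x))"
      unfolding inner_H_def
    proof (rule integral_mono)
      show "integrable (lebesgue_on \<Omega>) (\<lambda>x. (w x *v u x) \<bullet> (w x *v u x))"
        by (intro L2_inner_integrable material_field_mult_L2 w u)
      show "integrable (lebesgue_on \<Omega>) (\<lambda>x. C\<^sup>2 * (u x \<bullet> u x))"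
        by (intro integrable_mult_right L2_inner_integrable u)
      fix x assume "x \<in> space (lebesgue_on \<Omega>)"
      then have "(norm (w x *v u x))\<^sup>2 \<le> (C * norm (u x))\<^sup>2" by (intro power_mono C(2)) auto
      then show "(w x *v u x) \<bullet> (w x *v u x) \<le> C\<^sup>2 * (u x \<bullet> u x)"
        by (simp add: power_mult_distrib power2_norm_eq_inner)
    qed
    then show "(norm_H \<Omega> (\<lambda>x. w x *v u x))\<^sup>2 \<le> (C * norm_H \<Omega> u)\<^sup>2"
      by (simp add: norm_H_power2 power_mult_distrib) (simp add: inner_H_def)
    show "0 \<le> C * norm_H \<Omega> u" using C(1) norm_H_nonneg by simp
  qed
  with C(1) that show ?thesis by blast
qed

lemma inner_Hw_diff:
  assumes "material_field \<Omega> w" "u \<in> L2 \<Omega>" "v \<in> L2 \<Omega>" "\<phi> \<in> L2 \<Omega>"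
  shows "inner_H \<Omega> (\<lambda>x. w x *v (u x - v x)) \<phi>
    = inner_H \<Omega> (\<lambda>x. w x *v u x) \<phi> - inner_H \<Omega> (\<lambda>x. w x *v v x) \<phi>"
  using inner_H_diff_left[OF material_field_mult_L2[OF assms(1,2)] material_field_mult_L2[OF assms(1,3)] assms(4)]
  by (simp add: matrix_vector_mult_diff_distrib)

lemma material_form_continuous:
  assumes w: "material_field \<Omega> w" and v: "v \<in> C_H \<Omega> T"
  shows "continuous_on ({0..T} \<times> {0..T}) (\<lambda>(r, s). inner_H \<Omega> (\<lambda>x. w x *v v r x) (v s))"
  unfolding continuous_on_def
proof
  define B where "B r s = inner_H \<Omega> (\<lambda>x. w x *v v r x) (v s)" for r s
  have Bsym: "B r s = B s r" for r s unfolding B_def by (rule material_field_symmetric[OF w])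
  fix z :: "real \<times> real" assume "z \<in> {0..T} \<times> {0..T}"
  then obtain r0 s0 where z: "z = (r0, s0)" and rs: "r0 \<in> {0..T}" "s0 \<in> {0..T}" by auto
  define \<F> where "\<F> = at (r0, s0) within {0..T} \<times> {0..T}"
  have vL: "v t \<in> L2 \<Omega>" if "t \<in> {0..T}" for t by (rule C_H_L2[OF v that])
  have wL: "(\<lambda>x. w x *v u x) \<in> L2 \<Omega>" if "u \<in> L2 \<Omega>" for u by (rule material_field_mult_L2[OF w that])
  obtain C where C: "0 \<le> C" "\<And>u. u \<in> L2 \<Omega> \<Longrightarrow> norm_H \<Omega> (\<lambda>x. w x *v u x) \<le> C * norm_H \<Omega> u"
    using material_field_norm_H_bound[OF w] by metis
  have in1: "\<forall>\<^sub>F z in \<F>. fst z \<in> {0..T}" and in2: "\<forall>\<^sub>F z in \<F>. snd z \<in> {0..T}"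
    unfolding \<F>_def eventually_at_filter by (auto intro: always_eventually)
  have t1: "(fst \<longlongrightarrow> r0) \<F>" and t2: "(snd \<longlongrightarrow> s0) \<F>"
    unfolding \<F>_def by (auto intro!: tendsto_eq_intros)
  have Bc: "continuous_on {0..T} (\<lambda>r. B r s)" if "s \<in> {0..T}" for s
    unfolding Bsym[of _ s] using C_H_inner_continuous[OF v wL[OF vL[OF that]]]
    by (simp add: B_def inner_H_commute)
  have 1: "((\<lambda>z. B (fst z) s0) \<longlongrightarrow> B r0 s0) \<F>"
    by (rule continuous_on_tendsto_compose[OF Bc[OF rs(2)] t1 rs(1) in1])
  have 2: "((\<lambda>z. B (snd z) r0) \<longlongrightarrow> B s0 r0) \<F>"
    by (rule continuous_on_tendsto_compose[OF Bc[OF rs(1)] t2 rs(2) in2])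
  \<comment> \<open>The distance to the value at a fixed time \<open>t\<close>: a function that is continuous and zero at \<open>t\<close>.\<close>
  define \<rho> where "\<rho> t r = norm_H \<Omega> (\<lambda>x. v r x - v t x)" for t r
  have \<rho>0: "\<rho> t t = 0" for t by (simp add: \<rho>_def norm_H_def inner_H_def)
  have \<rho>: "continuous (at t within {0..T}) (\<rho> t)" if "t \<in> {0..T}" for t
  proof -
    have "\<rho> t = (\<lambda>s. norm_H \<Omega> (\<lambda>x. v s x - v t x))" by (simp add: \<rho>_def fun_eq_iff)
    then show ?thesis using v that unfolding continuous_within \<rho>0 by (simp add: C_H_def)
  qed
  have "((\<lambda>z. \<rho> r0 (fst z)) \<longlongrightarrow> \<rho> r0 r0) \<F>"
    by (rule continuous_within_tendsto_compose[OF \<rho>[OF rs(1)] in1 t1])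
  moreover have "((\<lambda>z. \<rho> s0 (snd z)) \<longlongrightarrow> \<rho> s0 s0) \<F>"
    by (rule continuous_within_tendsto_compose[OF \<rho>[OF rs(2)] in2 t2])
  ultimately have 3: "((\<lambda>z. C * \<rho> r0 (fst z) * \<rho> s0 (snd z)) \<longlongrightarrow> C * 0 * 0) \<F>"
    unfolding \<rho>0 by (intro tendsto_intros)
  \<comment> \<open>The mixed second difference is \<open>(w (v r - v r0), v s - v s0)\<close>, which is a product of two small factors.\<close>
  have 4: "((\<lambda>z. B (fst z) (snd z) - B (fst z) s0 - B (snd z) r0 + B r0 s0) \<longlongrightarrow> 0) \<F>"
  proof (rule Lim_null_comparison)
    show "((\<lambda>z. C * \<rho> r0 (fst z) * \<rho> s0 (snd z)) \<longlongrightarrow> 0) \<F>" using 3 by simp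
    show "\<forall>\<^sub>F z in \<F>. norm (B (fst z) (snd z) - B (fst z) s0 - B (snd z) r0 + B r0 s0) \<le> C * \<rho> r0 (fst z) * \<rho> s0 (snd z)"
      using in1 in2
    proof eventually_elim
      case (elim z)
      note L = vL[OF elim(1)] vL[OF elim(2)] vL[OF rs(1)] vL[OF rs(2)]
      have d1: "(\<lambda>x. v (fst z) x - v r0 x) \<in> L2 \<Omega>" and d2: "(\<lambda>x. v (snd z) x - v s0 x) \<in> L2 \<Omega>"
        using L by (auto intro: L2_diff)
      have "inner_H \<Omega> (\<lambda>x. w x *v (v (fst z) x - v r0 x)) (\<lambda>x. v (snd z) x - v s0 x)
          = B (fst z) (snd z) - B (fst z) s0 - B (snd z) r0 + B r0 s0"
        using inner_Hw_diff[OF w L(1,3) d2] inner_H_diff_right[OF L(2,4) wL[OF L(1)]] inner_H_diff_right[OF L(2,4) wL[OF L(3)]]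
        by (simp add: B_def[symmetric] Bsym[of r0 "snd z"])
      moreover have "\<bar>inner_H \<Omega> (\<lambda>x. w x *v (v (fst z) x - v r0 x)) (\<lambda>x. v (snd z) x - v s0 x)\<bar>
          \<le> norm_H \<Omega> (\<lambda>x. w x *v (v (fst z) x - v r0 x)) * \<rho> s0 (snd z)"
        unfolding \<rho>_def by (rule inner_H_Cauchy_Schwarz[OF wL[OF d1] d2])
      moreover have "norm_H \<Omega> (\<lambda>x. w x *v (v (fst z) x - v r0 x)) * \<rho> s0 (snd z) \<le> C * \<rho> r0 (fst z) * \<rho> s0 (snd z)"
        using C(2)[OF d1] by (intro mult_right_mono) (auto simp: \<rho>_def norm_H_nonneg)
      ultimately show ?case by simp
    qed
  qed
  have "((\<lambda>z. (B (fst z) (snd z) - B (fst z) s0 - B (snd z) r0 + B r0 s0) + B (fst z) s0 + B (snd z) r0 - B r0 s0)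
      \<longlongrightarrow> 0 + B r0 s0 + B s0 r0 - B r0 s0) \<F>"
    by (intro tendsto_intros 1 2 4)
  then have "((\<lambda>z. B (fst z) (snd z)) \<longlongrightarrow> B r0 s0) \<F>" by (simp add: Bsym[of s0 r0])
  then show "((\<lambda>(r, s). inner_H \<Omega> (\<lambda>x. w x *v v r x) (v s)) \<longlongrightarrow> (case z of (r, s) \<Rightarrow> inner_H \<Omega> (\<lambda>x. w x *v v r x) (v s)))
      (at z within {0..T} \<times> {0..T})"
    by (simp add: z B_def \<F>_def case_prod_beta')
qed

text \<open>
  The squared distance of \<open>v r\<close> and \<open>v s\<close> is a combination of values of the form
  \<open>(r, s) \<mapsto> (v r, v s)\<close>, which is continuous on a compact square.
\<close>

lemma C_H_uniformly_continuous:
  assumes v: "v \<in> C_H \<Omega> T" and \<kappa>: "0 < \<kappa>"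
  obtains d where "0 < d" "\<And>r s. r \<in> {0..T} \<Longrightarrow> s \<in> {0..T} \<Longrightarrow> \<bar>r - s\<bar> < d \<Longrightarrow>
    norm_H \<Omega> (\<lambda>x. v s x - v r x) \<le> \<kappa>"
proof -
  \<comment> \<open>With the identity matrix as material field the weighted form is the inner product.\<close>
  have id: "material_field \<Omega> (\<lambda>x. mat 1 :: real^3^3)"
    unfolding material_field_def
  proof (intro conjI allI ballI)
    show "bounded ((\<lambda>x. (mat 1 :: real^3^3) $ i $ k) ` \<Omega>)" for i k
      by (rule bounded_subset[of "{(mat 1 :: real^3^3) $ i $ k}"]) auto
    show "\<exists>c>0. \<forall>x\<in>\<Omega>. \<forall>\<xi>. c * (norm \<xi>)\<^sup>2 \<le> ((mat 1 :: real^3^3) *v \<xi>) \<bullet> \<xi>"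
      by (rule exI[of _ 1]) (simp add: power2_norm_eq_inner)
  qed (simp_all add: transpose_mat)
  define B where "B r s = inner_H \<Omega> (v r) (v s)" for r s
  have "continuous_on ({0..T} \<times> {0..T}) (\<lambda>(r, s). B r s)"
    using material_form_continuous[OF id v] by (simp add: B_def)
  then have "uniformly_continuous_on ({0..T} \<times> {0..T}) (\<lambda>(r, s). B r s)"
    by (rule compact_uniformly_continuous) (intro compact_Times compact_Icc)
  then obtain d where d: "0 < d" "\<And>z z'. z \<in> {0..T} \<times> {0..T} \<Longrightarrow> z' \<in> {0..T} \<times> {0..T} \<Longrightarrow> dist z' z < d \<Longrightarrow>
      dist (case z' of (r, s) \<Rightarrow> B r s) (case z of (r, s) \<Rightarrow> B r s) < \<kappa>\<^sup>2 / 2"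
    unfolding uniformly_continuous_on_def using \<kappa> by (metis half_gt_zero zero_less_power)
  have "norm_H \<Omega> (\<lambda>x. v s x - v r x) \<le> \<kappa>"
    if rs: "r \<in> {0..T}" "s \<in> {0..T}" "\<bar>r - s\<bar> < d" for r s
  proof (rule power2_le_imp_le)
    have L: "v r \<in> L2 \<Omega>" "v s \<in> L2 \<Omega>" using rs by (auto intro: C_H_L2[OF v])
    have "dist (r, s) (r, r) < d" "dist (r, s) (s, s) < d"
      using rs(3) by (auto simp: dist_Pair_Pair dist_real_def abs_minus_commute)
    then have "\<bar>B r s - B r r\<bar> < \<kappa>\<^sup>2 / 2" "\<bar>B r s - B s s\<bar> < \<kappa>\<^sup>2 / 2"
      using d(2)[of "(r, r)" "(r, s)"] d(2)[of "(s, s)" "(r, s)"] rs by (auto simp: dist_real_def)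
    moreover have "(norm_H \<Omega> (\<lambda>x. v s x - v r x))\<^sup>2 = B s s - B r s - (B r s - B r r)"
      unfolding norm_H_power2
      using inner_H_diff_left[OF L(2,1) L2_diff[OF L(2,1)]] inner_H_diff_right[OF L(2,1) L(1)] inner_H_diff_right[OF L(2,1) L(2)]
      by (simp add: B_def inner_H_commute[of \<Omega> "v s" "v r"])
    ultimately show "(norm_H \<Omega> (\<lambda>x. v s x - v r x))\<^sup>2 \<le> \<kappa>\<^sup>2" by linarith
  qed (use \<kappa> in simp)
  with d(1) that show ?thesis by blast
qed

lemma L2_subset:
  assumes u: "u \<in> L2 S" and "R \<subseteq> S" "R \<in> sets borel" "S \<in> sets borel"
  shows "u \<in> L2 R"
proof -
  have "u \<in> borel_measurable (lebesgue_on R)"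
    using measurable_restrict_mono[OF L2_measurable[OF u] assms(2)] .
  moreover have "integrable (lebesgue_on R) (\<lambda>x. (norm (u x))\<^sup>2)"
    by (rule integrable_lebesgue_on_subset[OF L2_square_integrable[OF u] assms(2)]) (use assms in auto)
  ultimately show ?thesis by (simp add: L2_def)
qed

lemma AE_lebesgue_on_subset:
  assumes "AE x in lebesgue_on S. P x" "R \<subseteq> S" "R \<in> sets borel" "S \<in> sets borel"
  shows "AE x in lebesgue_on R. P x"
proof -
  have "AE x in lebesgue. x \<in> S \<longrightarrow> P x" using assms by (simp add: AE_restrict_space_iff)
  then have "AE x in lebesgue. x \<in> R \<longrightarrow> P x" using assms(2) by (auto elim!: eventually_mono)
  then show ?thesis using assms by (simp add: AE_restrict_space_iff)
qed

lemma time_integral_continuous_rep: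
  assumes \<Omega>: "open \<Omega>" and u: "u \<in> L2 (QT \<Omega> T)" and rep: "continuous_rep \<Omega> T u v"
    and ab: "0 \<le> a" "b \<le> T" and \<psi>: "\<psi> \<in> L2 \<Omega>"
  shows "inner_H \<Omega> (\<lambda>x. LINT t|lebesgue_on {a<..<b}. u (x, t)) \<psi> = integral {a..b} (\<lambda>t. inner_H \<Omega> (v t) \<psi>)"
proof -
  have \<Omega>b: "\<Omega> \<in> sets borel" and Jb: "{a<..<b} \<in> sets borel" and J: "{a<..<b} \<in> lmeasurable" using \<Omega> by auto
  have sub: "{a<..<b} \<subseteq> {0<..<T}" using ab by auto
  have uab: "u \<in> L2 (\<Omega> \<times> {a<..<b})"
    by (rule L2_subset[OF u]) (use ab \<Omega>b in \<open>auto simp: QT_def intro!: borel_Times\<close>)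
  have vc: "continuous_on {0..T} (\<lambda>t. inner_H \<Omega> (v t) \<psi>)"
    using rep \<psi> by (intro C_H_inner_continuous) (auto simp: continuous_rep_def)
  have "inner_H \<Omega> (\<lambda>x. LINT t|lebesgue_on {a<..<b}. u (x, t)) \<psi>
      = (LINT t|lebesgue_on {a<..<b}. inner_H \<Omega> (\<lambda>x. u (x, t)) \<psi>)"
    by (rule L2_time_integral(3)[OF \<Omega>b Jb J uab \<psi>])
  also have "\<dots> = (LINT t|lebesgue_on {a<..<b}. inner_H \<Omega> (v t) \<psi>)"
  proof (rule integral_cong_AE)
    show "(\<lambda>t. inner_H \<Omega> (\<lambda>x. u (x, t)) \<psi>) \<in> borel_measurable (lebesgue_on {a<..<b})"
      using L2_time_integral(2)[OF \<Omega>b Jb J uab \<psi>] by auto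
    show "(\<lambda>t. inner_H \<Omega> (v t) \<psi>) \<in> borel_measurable (lebesgue_on {a<..<b})"
      by (rule continuous_imp_measurable_on_sets_lebesgue[OF continuous_on_subset[OF vc]]) (use ab in auto)
    show "AE t in lebesgue_on {a<..<b}. inner_H \<Omega> (\<lambda>x. u (x, t)) \<psi> = inner_H \<Omega> (v t) \<psi>"
      by (rule eventually_mono[OF AE_lebesgue_on_subset[OF continuous_rep_AE[OF \<Omega> u rep] sub]]) (use \<psi> in auto)
  qed
  also have "\<dots> = integral {a..b} (\<lambda>t. inner_H \<Omega> (v t) \<psi>)"
  proof -
    have "integrable (lebesgue_on {0..T}) (\<lambda>t. inner_H \<Omega> (v t) \<psi>)" by (rule continuous_imp_integrable_real[OF vc])
    then have "integrable (lebesgue_on {a<..<b}) (\<lambda>t. inner_H \<Omega> (v t) \<psi>)"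
      by (rule integrable_lebesgue_on_subset) (use ab in auto)
    from lebesgue_integral_eq_integral[OF this] show ?thesis by (simp add: integral_open_interval_real)
  qed
  finally show ?thesis .
qed

text \<open>
  The norm of the difference is estimated by pairing the difference with itself.
\<close>

lemma time_integral_near_rep:
  assumes \<Omega>: "open \<Omega>" and u: "u \<in> L2 (QT \<Omega> T)" and rep: "continuous_rep \<Omega> T u v"
    and ab: "0 \<le> a" "a \<le> b" "b \<le> T" and r: "r \<in> {0..T}"
    and near: "\<And>s. s \<in> {a..b} \<Longrightarrow> norm_H \<Omega> (\<lambda>x. v s x - v r x) \<le> \<kappa>"
  shows "norm_H \<Omega> (\<lambda>x. (LINT t|lebesgue_on {a<..<b}. u (x, t)) - (b - a) *\<^sub>R v r x) \<le> (b - a) * \<kappa>"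
proof -
  have \<Omega>b: "\<Omega> \<in> sets borel" and Jb: "{a<..<b} \<in> sets borel" and J: "{a<..<b} \<in> lmeasurable" using \<Omega> by auto
  have uab: "u \<in> L2 (\<Omega> \<times> {a<..<b})"
    by (rule L2_subset[OF u]) (use ab \<Omega>b in \<open>auto simp: QT_def intro!: borel_Times\<close>)
  have v: "v \<in> C_H \<Omega> T" using rep by (simp add: continuous_rep_def)
  define E where "E x = (LINT t|lebesgue_on {a<..<b}. u (x, t))" for x
  have EL: "E \<in> L2 \<Omega>" unfolding E_def by (rule L2_time_integral(1)[OF \<Omega>b Jb J uab])
  define d where "d x = E x - (b - a) *\<^sub>R v r x" for x
  have vr: "v r \<in> L2 \<Omega>" by (rule C_H_L2[OF v r])
  have dL: "d \<in> L2 \<Omega>" unfolding d_def by (rule L2_diff[OF EL L2_scaleR[OF vr]])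
  have c: "continuous_on {a..b} (\<lambda>s. inner_H \<Omega> (v s) d)"
    by (rule continuous_on_subset[OF C_H_inner_continuous[OF v dL]]) (use ab in auto)
  have "inner_H \<Omega> d d = inner_H \<Omega> E d - (b - a) * inner_H \<Omega> (v r) d"
    using inner_H_diff_left[OF EL L2_scaleR[OF vr] dL] by (simp add: d_def[abs_def] inner_H_scaleR_left)
  also have "inner_H \<Omega> E d = integral {a..b} (\<lambda>s. inner_H \<Omega> (v s) d)"
    unfolding E_def by (rule time_integral_continuous_rep[OF \<Omega> u rep ab(1,3) dL])
  finally have eq: "(norm_H \<Omega> d)\<^sup>2 = integral {a..b} (\<lambda>s. inner_H \<Omega> (v s) d) - (b - a) * inner_H \<Omega> (v r) d"
    by (simp add: norm_H_power2)
  have "\<bar>integral {a..b} (\<lambda>s. inner_H \<Omega> (v s) d) - (b - a) * inner_H \<Omega> (v r) d\<bar> \<le> (b - a) * (\<kappa> * norm_H \<Omega> d)"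
  proof (rule integral_near_constant[OF c ab(2)])
    fix s assume s: "s \<in> {a..b}"
    then have vs: "v s \<in> L2 \<Omega>" using ab by (intro C_H_L2[OF v]) auto
    have "\<bar>inner_H \<Omega> (v s) d - inner_H \<Omega> (v r) d\<bar> \<le> norm_H \<Omega> (\<lambda>x. v s x - v r x) * norm_H \<Omega> d"
      using inner_H_Cauchy_Schwarz[OF L2_diff[OF vs vr] dL] inner_H_diff_left[OF vs vr dL] by simp
    also have "\<dots> \<le> \<kappa> * norm_H \<Omega> d" by (intro mult_right_mono near s norm_H_nonneg)
    finally show "\<bar>inner_H \<Omega> (v s) d - inner_H \<Omega> (v r) d\<bar> \<le> \<kappa> * norm_H \<Omega> d" .
  qed
  then have "norm_H \<Omega> d * norm_H \<Omega> d \<le> ((b - a) * \<kappa>) * norm_H \<Omega> d"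
    using eq by (simp add: power2_eq_square)
  moreover have "0 \<le> \<kappa>" using near[of a] ab norm_H_nonneg[of \<Omega> "\<lambda>x. v a x - v r x"] by simp
  ultimately have "norm_H \<Omega> d \<le> (b - a) * \<kappa>"
    using norm_H_nonneg[of \<Omega> d] ab by (cases "norm_H \<Omega> d = 0") auto
  then show ?thesis unfolding d_def E_def .
qed

section \<open>The energy identity\<close>

lemma weak_solution_electric:
  assumes \<Omega>: "open \<Omega>" and T: "0 < T" and \<epsilon>: "material_field \<Omega> \<epsilon>"
    and jL: "(\<lambda>z. j z (e z)) \<in> L2 (QT \<Omega> T)" and e0: "e0 \<in> L2 \<Omega>"
    and sol: "weak_solution \<Omega> T \<epsilon> \<mu> j e0 h0 e h" and rep: "continuous_rep \<Omega> T e v"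
    and \<phi>: "\<phi> \<in> V0 \<Omega>" and C: "has_weak_curl \<Omega> \<phi> C" and \<tau>: "0 \<le> \<tau>" "\<tau> < T"
  shows "inner_H \<Omega> (\<lambda>x. \<epsilon> x *v v \<tau> x) \<phi> = inner_H \<Omega> (\<lambda>x. \<epsilon> x *v e0 x) \<phi>
      - integral {0..\<tau>} (\<lambda>t. inner_H \<Omega> (\<lambda>x. - h (x, t)) C + inner_H \<Omega> (\<lambda>x. j (x, t) (e (x, t))) \<phi>)"
proof -
  have e: "e \<in> L2 (QT \<Omega> T)" and h: "h \<in> L2 (QT \<Omega> T)"
    using sol by (auto simp: weak_solution_def)
  show ?thesis
  proof (rule weak_equation_integrated[OF \<Omega> T \<epsilon> e rep e0 C, of "V0 \<Omega>" "\<lambda>z. - h z" "\<lambda>z. j z (e z)"])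
    show "(\<lambda>x. c *\<^sub>R \<phi> x) \<in> V0 \<Omega>" for c by (rule V0_scaleR[OF \<Omega> \<phi>])
    show "(\<lambda>z. - h z) \<in> L2 (QT \<Omega> T)" by (rule L2_uminus[OF h])
    show "- (LINT z|lebesgue_on (QT \<Omega> T). (\<epsilon> (fst z) *v e z) \<bullet> W z)
        + (LINT z|lebesgue_on (QT \<Omega> T). (- h z) \<bullet> G z + j z (e z) \<bullet> \<Phi> z)
        = (LINT x|lebesgue_on \<Omega>. (\<epsilon> x *v e0 x) \<bullet> \<Phi>c 0 x)"
      if "admissible_test \<Omega> T (V0 \<Omega>) \<Phi> G W \<Phi>c" for \<Phi> G W \<Phi>c
      using sol that unfolding weak_solution_def inner_minus_left by blast
  qed (use jL \<tau> in auto)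
qed

lemma weak_solution_magnetic:
  assumes \<Omega>: "open \<Omega>" and T: "0 < T" and \<mu>: "material_field \<Omega> \<mu>" and h0: "h0 \<in> L2 \<Omega>"
    and sol: "weak_solution \<Omega> T \<epsilon> \<mu> j e0 h0 e h" and rep: "continuous_rep \<Omega> T h v"
    and C: "has_weak_curl \<Omega> \<psi> C" and \<tau>: "0 \<le> \<tau>" "\<tau> < T"
  shows "inner_H \<Omega> (\<lambda>x. \<mu> x *v v \<tau> x) \<psi> = inner_H \<Omega> (\<lambda>x. \<mu> x *v h0 x) \<psi>
      - integral {0..\<tau>} (\<lambda>t. inner_H \<Omega> (\<lambda>x. e (x, t)) C)"
proof -
  have e: "e \<in> L2 (QT \<Omega> T)" and h: "h \<in> L2 (QT \<Omega> T)"
    using sol by (auto simp: weak_solution_def)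
  have "\<psi> \<in> V \<Omega>" using C by (auto simp: V_def)
  have "inner_H \<Omega> (\<lambda>x. \<mu> x *v v \<tau> x) \<psi> = inner_H \<Omega> (\<lambda>x. \<mu> x *v h0 x) \<psi>
      - integral {0..\<tau>} (\<lambda>t. inner_H \<Omega> (\<lambda>x. e (x, t)) C + inner_H \<Omega> (\<lambda>x. 0) \<psi>)"
  proof (rule weak_equation_integrated[OF \<Omega> T \<mu> h rep h0 C, of "V \<Omega>" "\<lambda>z. e z" "\<lambda>z. 0"])
    show "(\<lambda>x. c *\<^sub>R \<psi> x) \<in> V \<Omega>" for c by (rule V_scaleR[OF \<open>\<psi> \<in> V \<Omega>\<close>])
    show "- (LINT z|lebesgue_on (QT \<Omega> T). (\<mu> (fst z) *v h z) \<bullet> W z)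
        + (LINT z|lebesgue_on (QT \<Omega> T). e z \<bullet> G z + 0 \<bullet> \<Psi> z)
        = (LINT x|lebesgue_on \<Omega>. (\<mu> x *v h0 x) \<bullet> \<Psi>c 0 x)"
      if "admissible_test \<Omega> T (V \<Omega>) \<Psi> G W \<Psi>c" for \<Psi> G W \<Psi>c
      using sol that unfolding weak_solution_def inner_zero_left add_0_right by blast
  qed (use e \<tau> L2_zero in auto)
  then show ?thesis by (simp add: inner_H_def)
qed

text \<open>
  The equation holds for test functions only, whence \<open>w u = w v\<close> almost everywhere; by symmetry of
  \<open>w\<close> this is enough for the energies.
\<close>

lemma initial_energy:
  assumes \<Omega>: "open \<Omega>" and w: "material_field \<Omega> w" and u: "u \<in> L2 \<Omega>" and v: "v \<in> L2 \<Omega>"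
    and eq: "\<And>\<phi>. \<phi> \<in> test_functions \<Omega> \<Longrightarrow> inner_H \<Omega> (\<lambda>x. w x *v u x) \<phi> = inner_H \<Omega> (\<lambda>x. w x *v v x) \<phi>"
  shows "inner_H \<Omega> (\<lambda>x. w x *v u x) u = inner_H \<Omega> (\<lambda>x. w x *v v x) v"
proof -
  have \<Omega>b: "\<Omega> \<in> sets borel" using \<Omega> by simp
  note L = material_field_mult_L2[OF w u] material_field_mult_L2[OF w v]
  have "AE x in lebesgue_on \<Omega>. w x *v u x - w x *v v x = 0"
  proof (rule fundamental_lemma_calculus_of_variations[OF \<Omega> L2_diff[OF L]])
    fix \<phi> assume \<phi>: "\<phi> \<in> test_functions \<Omega>"
    show "inner_H \<Omega> (\<lambda>x. w x *v u x - w x *v v x) \<phi> = 0"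
      using inner_H_diff_left[OF L test_function_L2(1)[OF \<phi> \<Omega>b]] eq[OF \<phi>] by simp
  qed
  then have AE: "AE x in lebesgue_on \<Omega>. w x *v u x = w x *v v x" by eventually_elim simp
  have "inner_H \<Omega> (\<lambda>x. w x *v u x) u = inner_H \<Omega> (\<lambda>x. w x *v v x) u"
    by (rule inner_H_cong_AE[OF L u AE])
  also have "\<dots> = inner_H \<Omega> (\<lambda>x. w x *v u x) v" by (rule material_field_symmetric[OF w])
  also have "\<dots> = inner_H \<Omega> (\<lambda>x. w x *v v x) v" by (rule inner_H_cong_AE[OF L v AE])
  finally show ?thesis .
qed

text \<open>
  The field equations integrated over \<open>[a, b]\<close> say that \<open>E = \<integral>\<^sub>a\<^sup>b e\<close> and \<open>H = \<integral>\<^sub>a\<^sup>b h\<close> have weak curls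
  \<open>curl E = - \<mu> (v(b) - v(a))\<close> and \<open>curl H = \<epsilon> (u(b) - u(a)) + J\<close>, with \<open>E\<close> in \<open>V\<^sub>0\<close> and \<open>H\<close> in \<open>V\<close>.
  The claim is the relation \<open>(curl E, H) = (E, curl H)\<close>, which is what membership of \<open>E\<close> in \<open>V\<^sub>0\<close>
  means, with \<open>E\<close> and \<open>H\<close> written as integrals of the continuous representatives.
\<close>

lemma energy_increment:
  assumes \<Omega>: "open \<Omega>" and T: "0 < T" and \<epsilon>: "material_field \<Omega> \<epsilon>" and \<mu>: "material_field \<Omega> \<mu>"
    and jL: "(\<lambda>z. j z (e z)) \<in> L2 (QT \<Omega> T)" and e0: "e0 \<in> L2 \<Omega>" and h0: "h0 \<in> L2 \<Omega>"
    and sol: "weak_solution \<Omega> T \<epsilon> \<mu> j e0 h0 e h"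
    and rep_e: "continuous_rep \<Omega> T e u" and rep_h: "continuous_rep \<Omega> T h v"
    and ab: "0 \<le> a" "a < b" "b < T"
  defines "E \<equiv> \<lambda>x. LINT t|lebesgue_on {a<..<b}. e (x, t)"
    and "J \<equiv> \<lambda>x. LINT t|lebesgue_on {a<..<b}. j (x, t) (e (x, t))"
  shows "integral {a..b} (\<lambda>s.
      (inner_H \<Omega> (\<lambda>x. \<epsilon> x *v u b x) (u s) + inner_H \<Omega> (\<lambda>x. \<mu> x *v v b x) (v s))
    - (inner_H \<Omega> (\<lambda>x. \<epsilon> x *v u a x) (u s) + inner_H \<Omega> (\<lambda>x. \<mu> x *v v a x) (v s))) = - inner_H \<Omega> J E"
proof -
  define H where "H x = (LINT t|lebesgue_on {a<..<b}. h (x, t))" for x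
  have \<Omega>b: "\<Omega> \<in> sets borel" and Tb: "{0<..<T} \<in> sets borel" and Tf: "{0<..<T} \<in> lmeasurable"
    and Ib: "{a<..<b} \<in> sets borel" and If: "{a<..<b} \<in> lmeasurable" using \<Omega> by auto
  have e: "e \<in> L2 (QT \<Omega> T)" and h: "h \<in> L2 (QT \<Omega> T)"
    using sol by (auto simp: weak_solution_def)
  have u: "u \<in> C_H \<Omega> T" and v: "v \<in> C_H \<Omega> T" using rep_e rep_h by (auto simp: continuous_rep_def)
  have at: "a \<in> {0..T}" and bt: "b \<in> {0..T}" using ab by auto
  note uL = C_H_L2[OF u] and vL = C_H_L2[OF v]
  have restr: "g \<in> L2 (\<Omega> \<times> {a<..<b})" if "g \<in> L2 (QT \<Omega> T)" for g
    by (rule L2_subset[OF that]) (use ab \<Omega>b in \<open>auto simp: QT_def intro!: borel_Times\<close>)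
  have EL: "E \<in> L2 \<Omega>" and JL: "J \<in> L2 \<Omega>" and HL: "H \<in> L2 \<Omega>"
    unfolding E_def J_def H_def
    by (rule L2_time_integral(1)[OF \<Omega>b Ib If], rule restr, (rule e jL h))+
  have mean: "integral {a..b} (\<lambda>t. inner_H \<Omega> (\<lambda>x. g (x, t)) \<phi>)
      = inner_H \<Omega> (\<lambda>x. LINT t|lebesgue_on {a<..<b}. g (x, t)) \<phi>
      \<and> (\<lambda>t. inner_H \<Omega> (\<lambda>x. g (x, t)) \<phi>) integrable_on {c..d}"
    if g: "g \<in> L2 (QT \<Omega> T)" and \<phi>: "\<phi> \<in> L2 \<Omega>" and cd: "0 \<le> c" "d \<le> T" for g \<phi> c d
  proof -
    note i = L2_time_integral(2)[OF \<Omega>b Tb Tf g[unfolded QT_def] \<phi>]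
    show ?thesis
      using lebesgue_integral_interval(3)[OF i, of a b] lebesgue_integral_interval(2)[OF i cd] ab
        L2_time_integral(3)[OF \<Omega>b Ib If restr[OF g] \<phi>] by simp
  qed
  have diff: "integral {0..b} g - integral {0..a} g = integral {a..b} g" if "g integrable_on {0..b}" for g :: "real \<Rightarrow> real"
    using Henstock_Kurzweil_Integration.integral_combine[OF ab(1) less_imp_le[OF ab(2)] that] by simp
  define De where "De x = \<epsilon> x *v (u b x - u a x)" for x
  define Dh where "Dh x = \<mu> x *v (v b x - v a x)" for x
  have DeL: "De \<in> L2 \<Omega>" and DhL: "Dh \<in> L2 \<Omega>" unfolding De_def Dh_def
    by (intro material_field_mult_L2 \<epsilon> \<mu> L2_diff uL vL at bt)+
  have De_eq: "inner_H \<Omega> De \<phi> = inner_H \<Omega> (\<lambda>x. \<epsilon> x *v u b x) \<phi> - inner_H \<Omega> (\<lambda>x. \<epsilon> x *v u a x) \<phi>"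
    if "\<phi> \<in> L2 \<Omega>" for \<phi>
    unfolding De_def by (rule inner_Hw_diff[OF \<epsilon> uL[OF bt] uL[OF at] that])
  have Dh_eq: "inner_H \<Omega> Dh \<phi> = inner_H \<Omega> (\<lambda>x. \<mu> x *v v b x) \<phi> - inner_H \<Omega> (\<lambda>x. \<mu> x *v v a x) \<phi>"
    if "\<phi> \<in> L2 \<Omega>" for \<phi>
    unfolding Dh_def by (rule inner_Hw_diff[OF \<mu> vL[OF bt] vL[OF at] that])
  have curlH: "has_weak_curl \<Omega> H (\<lambda>x. De x + J x)"
  proof (rule curl_of_V0_adjoint[OF \<Omega> HL L2_add[OF DeL JL]])
    fix \<phi> C assume \<phi>: "\<phi> \<in> V0 \<Omega>" and C: "has_weak_curl \<Omega> \<phi> C"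
    note L = has_weak_curl_L2[OF C]
    define B where "B t = inner_H \<Omega> (\<lambda>x. - h (x, t)) C + inner_H \<Omega> (\<lambda>x. j (x, t) (e (x, t))) \<phi>" for t
    note ev = weak_solution_electric[OF \<Omega> T \<epsilon> jL e0 sol rep_e \<phi> C]
    note m1 = mean[OF L2_uminus[OF h] L(2)] and m2 = mean[OF jL L(1)]
    have i: "B integrable_on {0..b}" unfolding B_def[abs_def]
      by (rule integrable_add) (use m1[of 0 b] m2[of 0 b] ab in auto)
    have "inner_H \<Omega> De \<phi> = - integral {a..b} B"
      using ev[of a] ev[of b] ab diff[OF i] De_eq[OF L(1)] by (simp add: B_def[abs_def])
    also have "integral {a..b} B = integral {a..b} (\<lambda>t. inner_H \<Omega> (\<lambda>x. - h (x, t)) C)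
        + integral {a..b} (\<lambda>t. inner_H \<Omega> (\<lambda>x. j (x, t) (e (x, t))) \<phi>)"
      unfolding B_def[abs_def] by (rule Henstock_Kurzweil_Integration.integral_add) (use m1[of a b] m2[of a b] ab in auto)
    also have "integral {a..b} (\<lambda>t. inner_H \<Omega> (\<lambda>x. - h (x, t)) C) = - inner_H \<Omega> H C"
      using m1[of a b] ab by (simp add: H_def[abs_def] inner_H_uminus_left)
    also have "integral {a..b} (\<lambda>t. inner_H \<Omega> (\<lambda>x. j (x, t) (e (x, t))) \<phi>) = inner_H \<Omega> J \<phi>"
      using m2[of a b] ab by (simp add: J_def)
    finally show "inner_H \<Omega> H C = inner_H \<Omega> (\<lambda>x. De x + J x) \<phi>"
      using inner_H_add_left[OF DeL JL L(1)] by simp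
  qed
  have adjoint: "inner_H \<Omega> E C = inner_H \<Omega> (\<lambda>x. - Dh x) \<psi>" if C: "has_weak_curl \<Omega> \<psi> C" for \<psi> C
  proof -
    note L = has_weak_curl_L2[OF C]
    note ev = weak_solution_magnetic[OF \<Omega> T \<mu> h0 sol rep_h C]
    note m = mean[OF e L(2)]
    have "inner_H \<Omega> Dh \<psi> = - inner_H \<Omega> E C"
      using ev[of a] ev[of b] ab Dh_eq[OF L(1)] diff[of "\<lambda>t. inner_H \<Omega> (\<lambda>x. e (x, t)) C"] m[of 0 b]
      by (simp add: E_def)
    then show ?thesis by (simp add: inner_H_uminus_left)
  qed
  note curlE = V0_of_V_adjoint[OF \<Omega> EL L2_uminus[OF DhL] adjoint]
  have "inner_H \<Omega> (\<lambda>x. - Dh x) H = inner_H \<Omega> E (\<lambda>x. De x + J x)"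
    using V0_iff[OF \<Omega> curlE(1)] curlE(2) curlH by blast
  then have bal: "inner_H \<Omega> E De + inner_H \<Omega> H Dh = - inner_H \<Omega> J E"
    using inner_H_add_right[OF DeL JL EL]
    by (simp add: inner_H_uminus_left inner_H_commute[of \<Omega> Dh] inner_H_commute[of \<Omega> J])
  have Ei: "inner_H \<Omega> E De = integral {a..b} (\<lambda>s. inner_H \<Omega> (u s) De)"
    unfolding E_def by (rule time_integral_continuous_rep[OF \<Omega> e rep_e ab(1) less_imp_le[OF ab(3)] DeL])
  have Hi: "inner_H \<Omega> H Dh = integral {a..b} (\<lambda>s. inner_H \<Omega> (v s) Dh)"
    unfolding H_def by (rule time_integral_continuous_rep[OF \<Omega> h rep_h ab(1) less_imp_le[OF ab(3)] DhL])
  have "integral {a..b} (\<lambda>s. inner_H \<Omega> (u s) De + inner_H \<Omega> (v s) Dh) = - inner_H \<Omega> J E"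
    unfolding bal[symmetric] Ei Hi
    by (intro Henstock_Kurzweil_Integration.integral_add integrable_continuous_real
        continuous_on_subset[OF C_H_inner_continuous[OF u DeL]]
        continuous_on_subset[OF C_H_inner_continuous[OF v DhL]]) (use ab in auto)
  moreover have "inner_H \<Omega> (u s) De + inner_H \<Omega> (v s) Dh =
      (inner_H \<Omega> (\<lambda>x. \<epsilon> x *v u b x) (u s) + inner_H \<Omega> (\<lambda>x. \<mu> x *v v b x) (v s))
    - (inner_H \<Omega> (\<lambda>x. \<epsilon> x *v u a x) (u s) + inner_H \<Omega> (\<lambda>x. \<mu> x *v v a x) (v s))"
    if "s \<in> {a..b}" for s
  proof -
    have "s \<in> {0..T}" using that ab by auto
    then show ?thesis
      using De_eq[OF uL] Dh_eq[OF vL] by (simp add: inner_H_commute[of \<Omega> "u s"] inner_H_commute[of \<Omega> "v s"])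
  qed
  ultimately show ?thesis
    using Henstock_Kurzweil_Integration.integral_cong[of "{a..b}"] by (metis (mono_tags, lifting))
qed

theorem theorem4p1:
  fixes \<Omega> :: "vec3 set" and T :: real
    and \<epsilon> \<mu> :: "vec3 \<Rightarrow> real^3^3"
    and j j1 :: "vec3 \<times> real \<Rightarrow> vec3 \<Rightarrow> vec3"
    and j0 e h :: "vec3 \<times> real \<Rightarrow> vec3"
    and e0 h0 :: "vec3 \<Rightarrow> vec3"
    and e_hat h_hat :: "real \<Rightarrow> vec3 \<Rightarrow> vec3"
  assumes "open \<Omega>" and "0 < T"
    and "material_field \<Omega> \<epsilon>" and "material_field \<Omega> \<mu>"
    and "\<forall>z\<in>QT \<Omega> T. \<forall>\<xi>. j z \<xi> = j0 z + j1 z \<xi>"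
    and "j0 \<in> L2 (QT \<Omega> T)"
    and "caratheodory (QT \<Omega> T) j1"
    and "\<exists>c1>0. \<forall>z\<in>QT \<Omega> T. \<forall>\<xi>. norm (j1 z \<xi>) \<le> c1 * norm \<xi>"
    and "e0 \<in> L2 \<Omega>" and "h0 \<in> L2 \<Omega>"
    and "weak_solution \<Omega> T \<epsilon> \<mu> j e0 h0 e h"
    and "continuous_rep \<Omega> T e e_hat" and "continuous_rep \<Omega> T h h_hat"
  shows "\<forall>t\<in>{0..T}.
    1/2 * ((norm_Hw \<Omega> \<epsilon> (e_hat t))\<^sup>2 + (norm_Hw \<Omega> \<mu> (h_hat t))\<^sup>2)
    + (LINT s|lebesgue_on {0<..<t}. LINT x|lebesgue_on \<Omega>. j (x, s) (e (x, s)) \<bullet> e (x, s))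
    = 1/2 * ((norm_Hw \<Omega> \<epsilon> e0)\<^sup>2 + (norm_Hw \<Omega> \<mu> h0)\<^sup>2)"
proof -
  note \<Omega> = assms(1) and T = assms(2) and \<epsilon> = assms(3) and \<mu> = assms(4) and e0 = assms(9) and h0 = assms(10)
    and sol = assms(11) and rep_e = assms(12) and rep_h = assms(13)
  have \<Omega>b: "\<Omega> \<in> sets borel" and Tb: "{0<..<T} \<in> sets borel" and Tf: "{0<..<T} \<in> lmeasurable" using \<Omega> by auto
  have Qb: "QT \<Omega> T \<in> sets borel" unfolding QT_def by (rule borel_Times[OF \<Omega>b Tb])
  have eL: "e \<in> L2 (QT \<Omega> T)" using sol by (simp add: weak_solution_def)
  obtain c1 where c1: "\<And>z \<xi>. z \<in> QT \<Omega> T \<Longrightarrow> norm (j1 z \<xi>) \<le> c1 * norm \<xi>" using assms(8) by blast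
  have jL: "(\<lambda>z. j z (e z)) \<in> L2 (QT \<Omega> T)"
    by (rule current_L2[OF Qb _ assms(6,7) c1 eL]) (use assms(5) in blast)
  have u: "e_hat \<in> C_H \<Omega> T" and v: "h_hat \<in> C_H \<Omega> T" using rep_e rep_h by (auto simp: continuous_rep_def)
  define p where "p s = (LINT x|lebesgue_on \<Omega>. j (x, s) (e (x, s)) \<bullet> e (x, s))" for s
  define n where "n s = norm_H \<Omega> (\<lambda>x. j (x, s) (e (x, s)))" for s
  have p: "integrable (lebesgue_on {0<..<T}) p"
    unfolding p_def using lebesgue_on_Fubini(2)[OF \<Omega>b Tb L2_inner_integrable[OF jL eL, unfolded QT_def]] by simp
  have n: "integrable (lebesgue_on {0<..<T}) n"
  proof -
    have "integrable (lebesgue_on {0<..<T}) (\<lambda>s. LINT x|lebesgue_on \<Omega>. j (x, s) (e (x, s)) \<bullet> j (x, s) (e (x, s)))"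
      using lebesgue_on_Fubini(2)[OF \<Omega>b Tb L2_inner_integrable[OF jL jL, unfolded QT_def]] by simp
    then have n2: "integrable (lebesgue_on {0<..<T}) (\<lambda>s. (n s)\<^sup>2)"
      by (simp add: n_def norm_H_power2 inner_H_def)
    have "(\<lambda>s. sqrt ((n s)\<^sup>2)) \<in> borel_measurable (lebesgue_on {0<..<T})"
      by (rule measurable_compose[OF borel_measurable_integrable[OF n2] borel_measurable_sqrt])
    moreover have "(\<lambda>s. sqrt ((n s)\<^sup>2)) = n" by (auto simp: n_def norm_H_nonneg)
    ultimately have nm: "n \<in> borel_measurable (lebesgue_on {0<..<T})" by simp
    have "integrable (lebesgue_on {0<..<T}) (\<lambda>s. 1 + (n s)\<^sup>2)"
      using n2 integrable_const_lebesgue_on[OF Tf, of "1 :: real"] by simp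
    then show ?thesis
    proof (rule Bochner_Integration.integrable_bound[OF _ nm])
      show "AE s in lebesgue_on {0<..<T}. norm (n s) \<le> norm (1 + (n s)\<^sup>2)"
      proof (rule AE_I2)
        fix s
        have "0 \<le> (\<bar>n s\<bar> - 1)\<^sup>2" "0 \<le> (n s)\<^sup>2" by simp_all
        then have "2 * \<bar>n s\<bar> \<le> 1 + (n s)\<^sup>2" by (simp add: power2_eq_square algebra_simps)
        then show "norm (n s) \<le> norm (1 + (n s)\<^sup>2)" by simp
      qed
    qed
  qed
  define f where "f r s = inner_H \<Omega> (\<lambda>x. \<epsilon> x *v e_hat r x) (e_hat s) + inner_H \<Omega> (\<lambda>x. \<mu> x *v h_hat r x) (h_hat s)" for r s
  \<comment> \<open>The fields are controlled on \<open>[0, T]\<close> only; clamping the time makes the scalar functions continuous on the line.\<close>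
  define cl where "cl t = max 0 (min T t)" for t
  have cl: "cl t \<in> {0..T}" "t \<in> {0..T} \<Longrightarrow> cl t = t" for t using T by (auto simp: cl_def)
  have clc: "continuous_on UNIV cl" unfolding cl_def by (intro continuous_intros)
  define F where "F r s = f (cl r) (cl s)" for r s
  define P where "P t = integral {0..cl t} p" for t
  define N where "N t = integral {0..cl t} n" for t
  have f_cont: "continuous_on ({0..T} \<times> {0..T}) (\<lambda>(r, s). f r s)"
    using continuous_on_add[OF material_form_continuous[OF \<epsilon> u] material_form_continuous[OF \<mu> v]]
    by (simp add: f_def case_prod_beta')
  have F_cont: "continuous_on UNIV (\<lambda>(r, s). F r s)"
  proof -
    have "continuous_on UNIV (\<lambda>z. (\<lambda>(r, s). f r s) (cl (fst z), cl (snd z)))"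
      by (rule continuous_on_compose2[OF f_cont])
         (use cl in \<open>auto intro!: continuous_intros continuous_on_compose2[OF clc]\<close>)
    then show ?thesis by (simp add: F_def case_prod_beta')
  qed
  have sym: "F r s = F s r" for r s
    unfolding F_def f_def using material_field_symmetric[OF \<epsilon>] material_field_symmetric[OF \<mu>] by metis
  have prim: "continuous_on UNIV (\<lambda>t. integral {0..cl t} g)" if "integrable (lebesgue_on {0<..<T}) g" for g :: "real \<Rightarrow> real"
    by (rule continuous_on_compose2[OF indefinite_integral_continuous_1[OF lebesgue_integral_interval(2)[OF that order_refl order_refl]] clc])
       (use cl in auto)
  have P_cont: "continuous_on UNIV P" and N_cont: "continuous_on UNIV N"
    unfolding P_def N_def using prim p n by auto
  have step: "integral {0..cl b} g - integral {0..cl a} g = integral {a..b} g"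
    if "integrable (lebesgue_on {0<..<T}) g" "0 \<le> a" "a \<le> b" "b \<le> T" for g :: "real \<Rightarrow> real" and a b
    using Henstock_Kurzweil_Integration.integral_combine[OF that(2,3) lebesgue_integral_interval(2)[OF that(1) order_refl that(4)]]
      cl(2)[of a] cl(2)[of b] that by simp
  have incr: "\<exists>d>0. \<forall>a b. 0 \<le> a \<longrightarrow> a < b \<longrightarrow> b < T \<longrightarrow> b - a < d \<longrightarrow>
      \<bar>integral {a..b} (\<lambda>s. F b s - F a s) + (b - a) * (P b - P a)\<bar> \<le> (b - a) * \<kappa> * (N b - N a)"
    if \<kappa>: "0 < \<kappa>" for \<kappa>
  proof -
    obtain d where d: "0 < d" "\<And>r s. r \<in> {0..T} \<Longrightarrow> s \<in> {0..T} \<Longrightarrow> \<bar>r - s\<bar> < d \<Longrightarrow>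
        norm_H \<Omega> (\<lambda>x. e_hat s x - e_hat r x) \<le> \<kappa>"
      using C_H_uniformly_continuous[OF u \<kappa>] by metis
    have "\<bar>integral {a..b} (\<lambda>s. F b s - F a s) + (b - a) * (P b - P a)\<bar> \<le> (b - a) * \<kappa> * (N b - N a)"
      if ab: "0 \<le> a" "a < b" "b < T" and small: "b - a < d" for a b
    proof -
      define E where "E x = (LINT t|lebesgue_on {a<..<b}. e (x, t))" for x
      define J where "J x = (LINT t|lebesgue_on {a<..<b}. j (x, t) (e (x, t)))" for x
      have Ib: "{a<..<b} \<in> sets borel" and If: "{a<..<b} \<in> lmeasurable" by auto
      have sub: "{a<..<b} \<subseteq> {0<..<T}" using ab by auto
      have restr: "g \<in> L2 (\<Omega> \<times> {a<..<b})" if "g \<in> L2 (QT \<Omega> T)" for g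
        by (rule L2_subset[OF that]) (use ab \<Omega>b in \<open>auto simp: QT_def intro!: borel_Times\<close>)
      have EL: "E \<in> L2 \<Omega>" unfolding E_def by (rule L2_time_integral(1)[OF \<Omega>b Ib If restr[OF eL]])
      have "integral {a..b} (\<lambda>s. F b s - F a s) = integral {a..b} (\<lambda>s. f b s - f a s)"
        by (rule Henstock_Kurzweil_Integration.integral_cong) (use ab cl(2) in \<open>auto simp: F_def\<close>)
      also have "\<dots> = - inner_H \<Omega> J E"
        unfolding f_def J_def E_def
        by (rule energy_increment[OF \<Omega> T \<epsilon> \<mu> jL e0 h0 sol rep_e rep_h ab])
      also have "inner_H \<Omega> J E = (LINT r|lebesgue_on {a<..<b}. inner_H \<Omega> (\<lambda>x. j (x, r) (e (x, r))) E)"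
        unfolding J_def by (rule L2_time_integral(3)[OF \<Omega>b Ib If restr[OF jL] EL])
      finally have 1: "integral {a..b} (\<lambda>s. F b s - F a s)
          = - (LINT r|lebesgue_on {a<..<b}. inner_H \<Omega> (\<lambda>x. j (x, r) (e (x, r))) E)" .
      note pi = lebesgue_integral_interval[OF p ab(1) less_imp_le[OF ab(3)]]
      note ni = lebesgue_integral_interval[OF n ab(1) less_imp_le[OF ab(3)]]
      have 2: "P b - P a = (LINT r|lebesgue_on {a<..<b}. p r)"
        unfolding P_def pi(3) using step[OF p] ab by simp
      have 3: "N b - N a = (LINT r|lebesgue_on {a<..<b}. n r)"
        unfolding N_def ni(3) using step[OF n] ab by simp
      note ji = L2_time_integral(2)[OF \<Omega>b Ib If restr[OF jL] EL]
      \<comment> \<open>\<open>E\<close> may be replaced by \<open>(b - a) e(r)\<close> at every single time \<open>r\<close>, since \<open>e\<close> varies by at most \<open>\<kappa>\<close> on \<open>[a, b]\<close>.\<close>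
      have near: "AE r in lebesgue_on {a<..<b}.
          \<bar>(b - a) * p r - inner_H \<Omega> (\<lambda>x. j (x, r) (e (x, r))) E\<bar> \<le> (b - a) * \<kappa> * n r"
        using AE_lebesgue_on_subset[OF continuous_rep_AE[OF \<Omega> eL rep_e] sub Ib Tb]
          L2_slices(1)[OF \<Omega>b Ib restr[OF jL]] AE_space
      proof eventually_elim
        case (elim r)
        then have r: "r \<in> {a<..<b}" by simp
        have er: "e_hat r \<in> L2 \<Omega>" using elim by blast
        note d' = L2_diff[OF EL L2_scaleR[OF er, of "b - a"]]
        have pr: "p r = inner_H \<Omega> (\<lambda>x. j (x, r) (e (x, r))) (e_hat r)"
        proof -
          have "p r = inner_H \<Omega> (\<lambda>x. e (x, r)) (\<lambda>x. j (x, r) (e (x, r)))"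
            by (simp add: p_def inner_H_def inner_commute)
          also have "\<dots> = inner_H \<Omega> (e_hat r) (\<lambda>x. j (x, r) (e (x, r)))" using elim by blast
          finally show ?thesis by (simp add: inner_H_commute)
        qed
        have "(b - a) * p r - inner_H \<Omega> (\<lambda>x. j (x, r) (e (x, r))) E
            = - inner_H \<Omega> (\<lambda>x. j (x, r) (e (x, r))) (\<lambda>x. E x - (b - a) *\<^sub>R e_hat r x)"
          using inner_H_diff_right[OF EL L2_scaleR[OF er] elim(2)] by (simp add: pr inner_H_scaleR_right)
        then have "\<bar>(b - a) * p r - inner_H \<Omega> (\<lambda>x. j (x, r) (e (x, r))) E\<bar>
            \<le> n r * norm_H \<Omega> (\<lambda>x. E x - (b - a) *\<^sub>R e_hat r x)"
          using inner_H_Cauchy_Schwarz[OF elim(2) d'] by (simp add: n_def)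
        also have "\<dots> \<le> n r * ((b - a) * \<kappa>)"
        proof (rule mult_left_mono)
          show "norm_H \<Omega> (\<lambda>x. E x - (b - a) *\<^sub>R e_hat r x) \<le> (b - a) * \<kappa>"
            unfolding E_def
          proof (rule time_integral_near_rep[OF \<Omega> eL rep_e])
            fix s assume "s \<in> {a..b}"
            then show "norm_H \<Omega> (\<lambda>x. e_hat s x - e_hat r x) \<le> \<kappa>"
              using r ab small by (intro d(2)) auto
          qed (use ab r in auto)
          show "0 \<le> n r" by (simp add: n_def norm_H_nonneg)
        qed
        finally show ?case by (simp add: mult_ac)
      qed
      have "integral {a..b} (\<lambda>s. F b s - F a s) + (b - a) * (P b - P a)
          = (LINT r|lebesgue_on {a<..<b}. (b - a) * p r - inner_H \<Omega> (\<lambda>x. j (x, r) (e (x, r))) E)"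
        unfolding 1 2 using pi(1) ji by (simp add: Bochner_Integration.integral_diff)
      also have "\<bar>\<dots>\<bar> \<le> (LINT r|lebesgue_on {a<..<b}. \<bar>(b - a) * p r - inner_H \<Omega> (\<lambda>x. j (x, r) (e (x, r))) E\<bar>)"
        by (rule integral_abs_bound)
      also have "\<dots> \<le> (LINT r|lebesgue_on {a<..<b}. (b - a) * \<kappa> * n r)"
        by (rule integral_mono_AE[OF _ _ near]) (use pi(1) ni(1) ji in auto)
      also have "\<dots> = (b - a) * \<kappa> * (N b - N a)" unfolding 3 by simp
      finally show ?thesis .
    qed
    then show ?thesis using d(1) by blast
  qed
  have n0: "0 \<le> n s" for s by (simp add: n_def norm_H_nonneg)
  have Nmono: "N s \<le> N t" if "0 \<le> s" "s \<le> t" "t \<le> T" for s t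
  proof -
    have "0 \<le> integral {s..t} n"
      by (rule integral_nonneg[OF lebesgue_integral_interval(2)[OF n that(1,3)]]) (rule n0)
    then show ?thesis using step[OF n that] by (simp add: N_def)
  qed
  have cl0: "cl 0 = 0" using T by (simp add: cl_def)
  have interior: "F t t / 2 + P t = F 0 0 / 2 + P 0" if "t \<in> {0..<T}" for t
    by (rule energy_balance_from_increments[OF F_cont sym P_cont N_cont Nmono _ incr])
       (use that cl0 in \<open>auto simp: N_def\<close>)
  have balance: "F t t / 2 + P t = F 0 0 / 2 + P 0" if t: "t \<in> {0..T}" for t
  proof (rule continuous_constant_on_closure[of "{0..<T}" "\<lambda>t. F t t / 2 + P t"])
    have "continuous_on UNIV (\<lambda>t. (\<lambda>(r, s). F r s) (t, t))"
      by (rule continuous_on_compose2[OF F_cont]) (auto intro!: continuous_intros)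
    then have "continuous_on UNIV (\<lambda>t. F t t / 2 + P t)"
      using P_cont by (auto intro!: continuous_intros)
    then show "continuous_on (closure {0..<T}) (\<lambda>t. F t t / 2 + P t)" by (rule continuous_on_subset) simp
    show "t \<in> closure {0..<T}" using t T by (simp add: closure_atLeastLessThan)
  qed (rule interior)
  have init: "f 0 0 = (norm_Hw \<Omega> \<epsilon> e0)\<^sup>2 + (norm_Hw \<Omega> \<mu> h0)\<^sup>2"
  proof -
    have L: "e_hat 0 \<in> L2 \<Omega>" "h_hat 0 \<in> L2 \<Omega>" using T by (auto intro: C_H_L2[OF u] C_H_L2[OF v])
    have "inner_H \<Omega> (\<lambda>x. \<epsilon> x *v e_hat 0 x) (e_hat 0) = inner_H \<Omega> (\<lambda>x. \<epsilon> x *v e0 x) e0"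
    proof (rule initial_energy[OF \<Omega> \<epsilon> L(1) e0])
      fix \<phi> assume \<phi>: "\<phi> \<in> test_functions \<Omega>"
      show "inner_H \<Omega> (\<lambda>x. \<epsilon> x *v e_hat 0 x) \<phi> = inner_H \<Omega> (\<lambda>x. \<epsilon> x *v e0 x) \<phi>"
        using weak_solution_electric[OF \<Omega> T \<epsilon> jL e0 sol rep_e test_function_V0(2,1)[OF \<Omega> \<phi>], of 0] T by simp
    qed
    moreover have "inner_H \<Omega> (\<lambda>x. \<mu> x *v h_hat 0 x) (h_hat 0) = inner_H \<Omega> (\<lambda>x. \<mu> x *v h0 x) h0"
    proof (rule initial_energy[OF \<Omega> \<mu> L(2) h0])
      fix \<phi> assume \<phi>: "\<phi> \<in> test_functions \<Omega>"
      show "inner_H \<Omega> (\<lambda>x. \<mu> x *v h_hat 0 x) \<phi> = inner_H \<Omega> (\<lambda>x. \<mu> x *v h0 x) \<phi>"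
        using weak_solution_magnetic[OF \<Omega> T \<mu> h0 sol rep_h test_function_V0(1)[OF \<Omega> \<phi>], of 0] T by simp
    qed
    ultimately show ?thesis
      by (simp add: f_def material_field_norm[OF \<epsilon>] material_field_norm[OF \<mu>])
  qed
  show ?thesis
  proof
    fix t assume t: "t \<in> {0..T}"
    have "f t t = (norm_Hw \<Omega> \<epsilon> (e_hat t))\<^sup>2 + (norm_Hw \<Omega> \<mu> (h_hat t))\<^sup>2"
      by (simp add: f_def material_field_norm[OF \<epsilon>] material_field_norm[OF \<mu>])
    moreover have "(LINT s|lebesgue_on {0<..<t}. p s) = P t"
      using lebesgue_integral_interval(3)[OF p order_refl, of t] t cl(2)[OF t] by (simp add: P_def)
    ultimately show "1/2 * ((norm_Hw \<Omega> \<epsilon> (e_hat t))\<^sup>2 + (norm_Hw \<Omega> \<mu> (h_hat t))\<^sup>2)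
      + (LINT s|lebesgue_on {0<..<t}. LINT x|lebesgue_on \<Omega>. j (x, s) (e (x, s)) \<bullet> e (x, s))
      = 1/2 * ((norm_Hw \<Omega> \<epsilon> e0)\<^sup>2 + (norm_Hw \<Omega> \<mu> h0)\<^sup>2)"
      using balance[OF t] cl(2)[OF t] init cl0 unfolding p_def[symmetric]
      by (simp add: F_def P_def)
  qed
qed

end
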